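(* Let $E\subset\mathbb{R}^{N\times n}$ be bounded and such that $E$ and $K:=\operatorname{Rco}_f E$ have the approximation property with $K_\delta=\operatorname{Rco}_f E_\delta$ for some compact sets $E_\delta\subset\mathbb{R}^{N\times n}$, $\delta>0$; that is, there is a family of compact sets $E_\delta$, $\delta>0$, such that (i) $E_\delta\subset \operatorname{Rco}_f E_\delta\subset \operatorname{int}\operatorname{Rco}_f E$ for every $\delta>0$; (ii) for every $\varepsilon>0$ there exists $\delta_0>0$ such that $\mathrm{dist}(\eta;E)\le\varepsilon$ for all $\eta\in E_\delta$ and all $\delta\in(0,\delta_0]$; (iii) for every $\eta\in\operatorname{int}\operatorname{Rco}_f E$ there exists $\delta_0>0$ such that $\eta\in \operatorname{Rco}_f E_\delta$ for all $\delta\in(0,\delta_0]$. Then $\operatorname{int}\operatorname{Rco}_f E$ has the relaxation property with respect to $E$.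
   Context: A function $f:\mathbb{R}^{N\times n}\to\mathbb{R}$ is rank one convex if $f(\lambda\xi+(1-\lambda)\eta)\le\lambda f(\xi)+(1-\lambda)f(\eta)$ for every $\lambda\in[0,1]$ and every $\xi,\eta\in\mathbb{R}^{N\times n}$ with $\operatorname{rank}(\xi-\eta)=1$. For a set $E\subset\mathbb{R}^{N\times n}$, $$\operatorname{Rco}_f E=\{\xi\in\mathbb{R}^{N\times n}: f(\xi)\le 0 \text{ for every rank one convex } f:\mathbb{R}^{N\times n}\to\mathbb{R} \text{ with } f|_E\le 0\}.$$ Here $\operatorname{int}$ denotes the interior and $\mathrm{dist}(\cdot;E)$ the distance to $E$ in $\mathbb{R}^{N\times n}$. Relaxation property: for $E,K\subset\mathbb{R}^{N\times n}$, $K$ has the relaxation property with respect to $E$ if for every bounded open set $\Omega\subset\mathbb{R}^n$ and every affine function $u_\xi$ with constant gradient $Du_\xi=\xi\in K$, there exists a sequence $u_\nu\in Aff_{piec}(\overline\Omega;\mathbb{R}^N)$ such that $u_\nu\in u_\xi+W^{1,\infty}_0(\Omega;\mathbb{R}^N)$, $Du_\nu(x)\in E\cup K$ for a.e. $x\in\Omega$, $u_\nu\rightharpoonup u_\xi$ weakly* in $W^{1,\infty}(\Omega;\mathbb{R}^N)$, and $\lim_{\nu\to+\infty}\int_\Omega \mathrm{dist}(Du_\nu(x);E)\,dx=0$. Conventions: $Aff_{piec}(\overline\Omega;\mathbb{R}^N)$ is the set of piecewise affine maps, i.e. maps $u\in W^{1,\infty}(\Omega;\mathbb{R}^N)\cap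 C(\overline\Omega;\mathbb{R}^N)$ for which there are countably many disjoint open sets $\Omega_k\subset\Omega$ with $\operatorname{meas}(\Omega\setminus\bigcup_k\Omega_k)=0$ such that $u$ is affine (with constant gradient) on each $\Omega_k$. $W^{1,\infty}_0(\Omega;\mathbb{R}^N)=W^{1,\infty}(\Omega;\mathbb{R}^N)\cap W^{1,1}_0(\Omega;\mathbb{R}^N)$. *)

theory Defs
  imports "HOL-Analysis.Analysis"
begin

section \<open>Rank one convexity\<close>

definition rank_one_convex :: "(real^'n^'N \<Rightarrow> real) \<Rightarrow> bool" where
  "rank_one_convex f \<longleftrightarrow>
     (\<forall>t\<in>{0..1}. \<forall>\<xi> \<eta>. rank (\<xi> - \<eta>) = 1 \<longrightarrow>
        f (t *\<^sub>R \<xi> + (1 - t) *\<^sub>R \<eta>) \<le> t * f \<xi> + (1 - t) * f \<eta>)"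

definition Rco_f :: "(real^'n^'N) set \<Rightarrow> (real^'n^'N) set" where
  "Rco_f E = {\<xi>. \<forall>f. rank_one_convex f \<and> (\<forall>\<eta>\<in>E. f \<eta> \<le> 0) \<longrightarrow> f \<xi> \<le> 0}"

section \<open>Test functions\<close>

primrec Ck :: "nat \<Rightarrow> ('a::euclidean_space \<Rightarrow> 'b::real_normed_vector) \<Rightarrow> bool" where
  "Ck 0 f \<longleftrightarrow> continuous_on UNIV f"
| "Ck (Suc k) f \<longleftrightarrow>
     (\<forall>x. f differentiable at x) \<and> (\<forall>e\<in>Basis. Ck k (\<lambda>x. frechet_derivative f (at x) e))"

text \<open>A function in \<open>C\<^sub>c\<^sup>\<infinity>(\<Omega>)\<close> is represented by its extension by zero to the whole space.\<close>

definition test_functions ::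
    "'a::euclidean_space set \<Rightarrow> ('a \<Rightarrow> 'b::real_normed_vector) set" where
  "test_functions \<Omega> =
     {\<phi>. (\<forall>k. Ck k \<phi>) \<and> compact (closure {x. \<phi> x \<noteq> 0}) \<and> closure {x. \<phi> x \<noteq> 0} \<subseteq> \<Omega>}"

section \<open>Lebesgue and Sobolev spaces\<close>

text \<open>Elements of the spaces below are functions rather than classes of functions that agree
  almost everywhere, and their values outside \<open>\<Omega>\<close> are irrelevant. Accordingly a weak
  gradient is a relation between functions: it determines \<open>G\<close> only up to null subsets
  of \<open>\<Omega>\<close>.\<close>

definition Linf :: "'a::euclidean_space set \<Rightarrow> ('a \<Rightarrow> 'b::euclidean_space) set" where
  "Linf \<Omega> = {f \<in> borel_measurable (lebesgue_on \<Omega>).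
     \<exists>C. AE x in lebesgue_on \<Omega>. norm (f x) \<le> C}"

definition L1loc :: "'a::euclidean_space set \<Rightarrow> ('a \<Rightarrow> 'b::euclidean_space) set" where
  "L1loc \<Omega> = {f. \<forall>C. compact C \<and> C \<subseteq> \<Omega> \<longrightarrow> integrable (lebesgue_on C) f}"

definition has_weak_gradient ::
    "(real^'n \<Rightarrow> real^'N) \<Rightarrow> (real^'n \<Rightarrow> real^'n^'N) \<Rightarrow> (real^'n) set \<Rightarrow> bool" where
  "has_weak_gradient u G \<Omega> \<longleftrightarrow> u \<in> L1loc \<Omega> \<and> G \<in> L1loc \<Omega> \<and>
     (\<forall>\<phi>\<in>test_functions \<Omega>. \<forall>i j.
        (LINT x|lebesgue_on \<Omega>. u x $ i * frechet_derivative \<phi> (at x) (axis j 1)) =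
        - (LINT x|lebesgue_on \<Omega>. G x $ i $ j * \<phi> x))"

definition W1inf :: "(real^'n) set \<Rightarrow> (real^'n \<Rightarrow> real^'N) set" where
  "W1inf \<Omega> = {u \<in> Linf \<Omega>. \<exists>G\<in>Linf \<Omega>. has_weak_gradient u G \<Omega>}"

text \<open>\<open>W\<^sub>0\<^sup>1\<^sup>,\<^sup>1(\<Omega>)\<close> is the closure of the test functions in the norm
  of \<open>W\<^sup>1\<^sup>,\<^sup>1(\<Omega>)\<close>.\<close>

definition W011 :: "(real^'n) set \<Rightarrow> (real^'n \<Rightarrow> real^'N) set" where
  "W011 \<Omega> = {u. integrable (lebesgue_on \<Omega>) u \<and>
     (\<exists>G. integrable (lebesgue_on \<Omega>) G \<and> has_weak_gradient u G \<Omega> \<and>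
        (\<exists>\<phi> :: nat \<Rightarrow> real^'n \<Rightarrow> real^'N. (\<forall>k. \<phi> k \<in> test_functions \<Omega>) \<and>
           (\<lambda>k. LINT x|lebesgue_on \<Omega>. norm (\<phi> k x - u x)) \<longlonglongrightarrow> 0 \<and>
           (\<lambda>k. LINT x|lebesgue_on \<Omega>. norm (jacobian (\<phi> k) (at x) - G x)) \<longlonglongrightarrow> 0))}"

definition W01inf :: "(real^'n) set \<Rightarrow> (real^'n \<Rightarrow> real^'N) set" where
  "W01inf \<Omega> = W1inf \<Omega> \<inter> W011 \<Omega>"

definition weak_star_Linf :: "'a::euclidean_space set \<Rightarrow>
    (nat \<Rightarrow> 'a \<Rightarrow> 'b::euclidean_space) \<Rightarrow> ('a \<Rightarrow> 'b) \<Rightarrow> bool" where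
  "weak_star_Linf \<Omega> f g \<longleftrightarrow> (\<forall>\<nu>. f \<nu> \<in> Linf \<Omega>) \<and> g \<in> Linf \<Omega> \<and>
     (\<forall>h. integrable (lebesgue_on \<Omega>) h \<longrightarrow>
        (\<lambda>\<nu>. LINT x|lebesgue_on \<Omega>. f \<nu> x \<bullet> h x) \<longlonglongrightarrow> (LINT x|lebesgue_on \<Omega>. g x \<bullet> h x))"

definition weak_star_W1inf ::
    "(real^'n) set \<Rightarrow> (nat \<Rightarrow> real^'n \<Rightarrow> real^'N) \<Rightarrow> (real^'n \<Rightarrow> real^'N) \<Rightarrow> bool" where
  "weak_star_W1inf \<Omega> u v \<longleftrightarrow> weak_star_Linf \<Omega> u v \<and>
     (\<exists>Du Dv. (\<forall>\<nu>. has_weak_gradient (u \<nu>) (Du \<nu>) \<Omega>) \<and> has_weak_gradient v Dv \<Omega> \<and>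
        weak_star_Linf \<Omega> Du Dv)"

section \<open>Piecewise affine maps and the relaxation property\<close>

definition affine_with_gradient ::
    "(real^'n) set \<Rightarrow> real^'n^'N \<Rightarrow> (real^'n \<Rightarrow> real^'N) \<Rightarrow> bool" where
  "affine_with_gradient S \<xi> u \<longleftrightarrow> (\<exists>b. \<forall>x\<in>S. u x = \<xi> *v x + b)"

text \<open>Some of the \<open>\<Omega>\<^sub>k\<close> may be empty, so finite families of pieces are included.\<close>

definition Aff_piec :: "(real^'n) set \<Rightarrow> (real^'n \<Rightarrow> real^'N) set" where
  "Aff_piec \<Omega> = {u \<in> W1inf \<Omega>. continuous_on (closure \<Omega>) u \<and>
     (\<exists>\<Omega>k :: nat \<Rightarrow> (real^'n) set. disjoint_family \<Omega>k \<and>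
        (\<forall>k. open (\<Omega>k k) \<and> \<Omega>k k \<subseteq> \<Omega> \<and> (\<exists>\<xi>. affine_with_gradient (\<Omega>k k) \<xi> u)) \<and>
        negligible (\<Omega> - (\<Union>k. \<Omega>k k)))}"

text \<open>The integrals of the distance are finite: \<open>\<Omega>\<close> is bounded, \<open>u \<nu> \<in> W1inf \<Omega>\<close>, and
  hence \<open>Du \<nu>\<close>, being unique almost everywhere, is essentially bounded.\<close>

definition relaxation_property ::
    "(real^'n^'N) set \<Rightarrow> (real^'n^'N) set \<Rightarrow> bool" where
  "relaxation_property K E \<longleftrightarrow>
     (\<forall>\<Omega> :: (real^'n) set. bounded \<Omega> \<and> open \<Omega> \<longrightarrow>
        (\<forall>\<xi>\<in>K. \<forall>u\<xi> :: real^'n \<Rightarrow> real^'N. affine_with_gradient UNIV \<xi> u\<xi> \<longrightarrow>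
           (\<exists>u Du.
              (\<forall>\<nu>::nat. u \<nu> \<in> Aff_piec \<Omega> \<and>
                 (\<lambda>x. u \<nu> x - u\<xi> x) \<in> W01inf \<Omega> \<and>
                 has_weak_gradient (u \<nu>) (Du \<nu>) \<Omega> \<and>
                 (AE x in lebesgue_on \<Omega>. Du \<nu> x \<in> E \<union> K)) \<and>
              weak_star_W1inf \<Omega> u u\<xi> \<and>
              (\<lambda>\<nu>. LINT x|lebesgue_on \<Omega>. infdist (Du \<nu> x) E) \<longlonglongrightarrow> 0)))"

end

theory Submission
  imports Defs
begin

text \<open>For an integrand \<open>g \<ge> 0\<close> on the open set \<open>U = int Rco\<^sub>f E\<close> let \<open>h \<xi>\<close> be the least constant such that on
  every bounded open set \<open>\<Omega>\<close> there are arbitrarily small, compactly supported, piecewise affine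
  perturbations \<open>w\<close> with \<open>\<xi> + Dw \<in> U\<close> whose average of \<open>g (\<xi> + Dw)\<close> is at most \<open>h \<xi>\<close>, up to an arbitrarily
  small error. Simple laminates show that \<open>h\<close> is rank one convex on \<open>U\<close>. For
  \<open>g = dist(\<cdot>; E\<^sub>\<delta>)\<close> it vanishes on \<open>E\<^sub>\<delta>\<close>. Since \<open>Rco\<^sub>f E\<^sub>\<delta>\<close> does not meet the frontier of \<open>U\<close>, some function
  that is rank one convex on the whole space is \<open>\<le> 0\<close> on \<open>E\<^sub>\<delta>\<close> and \<open>\<ge> h\<close> on \<open>U\<close>. Hence \<open>h = 0\<close> on \<open>Rco\<^sub>f E\<^sub>\<delta>\<close>,
  which provides the approximating maps. They have compact support in \<open>\<Omega>\<close> and tend to the affine map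
  uniformly, so the Sobolev and weak* statements follow by mollification and integration by parts.\<close>

section \<open>Functions that are affine almost everywhere\<close>

text \<open>The detour through \<open>dist(.; E_\<delta>)\<close> is forced: \<open>E\<close> need
  not lie in \<open>U\<close>, so for \<open>dist(.; E)\<close> itself the constant competitor says
  nothing about \<open>h\<close> on \<open>E\<close>. The compact sets \<open>E_\<delta>\<close> do
  lie in \<open>U\<close>, and passing from one distance to the other costs only a uniform
  \<epsilon>. The main obstacle is that a point of \<open>Rco_f E_\<delta>\<close> can be tested
  only with functions that are rank one convex on all matrices, while the competitors defining
  \<open>h\<close> must keep their gradients in \<open>U\<close>. Continuity of rank one convex
  functions and compactness of the frontier of \<open>U\<close> (here boundedness of
  \<open>E\<close> enters) produce finitely many functions that separate the whole frontier from the
  hull at once. Compact support, instead of mere zero boundary values, lets competitors on disjoint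
  open sets be added without a gluing estimate, and it turns their mollifications into test
  functions. The Lipschitz constants of the competitors stay uncontrolled; every bound uniform along
  the sequence comes from the boundedness of \<open>U\<close>.\<close>

definition aff_at :: "('a::euclidean_space \<Rightarrow> 'b::real_normed_vector) \<Rightarrow> ('a \<Rightarrow> 'b) \<Rightarrow> 'a \<Rightarrow> bool" where
  "aff_at f D x \<longleftrightarrow> linear D \<and> (\<exists>r>0. \<forall>y\<in>ball x r. f y = f x + D (y - x))"

text \<open>The pieces are not named; \<open>\<Gamma>\<close> records which gradients may occur
  almost everywhere. An inclusion such as \<open>\<xi> + matrix D \<in> U\<close> thus becomes part
  of the predicate. A countable family of pieces is recovered only at the end, by a Vitali
  covering.\<close>

definition pw_affine :: "('a::euclidean_space \<Rightarrow> 'b::real_normed_vector) set \<Rightarrow> ('a \<Rightarrow> 'b) \<Rightarrow> bool" where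
  "pw_affine \<Gamma> f \<longleftrightarrow> negligible {x. \<not> (\<exists>D\<in>\<Gamma>. aff_at f D x)}"

lemma aff_atI:
  assumes "linear D" "open S" "x \<in> S" "\<And>y. y \<in> S \<Longrightarrow> f y = c + D y"
  shows "aff_at f D x"
proof -
  obtain r where "r > 0" "ball x r \<subseteq> S" using assms open_contains_ball by blast
  then show ?thesis unfolding aff_at_def using assms
    by (auto simp: linear_diff intro!: exI[of _ r])
qed

lemma aff_at_nbhd:
  assumes "aff_at f D x"
  obtains r c where "r > 0" "\<And>y. y \<in> ball x r \<Longrightarrow> f y = c + D y" "\<And>y. y \<in> ball x r \<Longrightarrow> aff_at f D y"
proof -
  obtain r where r: "r > 0" "\<And>y. y \<in> ball x r \<Longrightarrow> f y = f x + D (y - x)" and l: "linear D"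
    using assms unfolding aff_at_def by blast
  have *: "f y = (f x - D x) + D y" if "y \<in> ball x r" for y
    using r(2)[OF that] l by (simp add: linear_diff)
  show ?thesis
    by (rule that[OF r(1) *]) (auto intro: aff_atI[OF l open_ball[of x r] _ *])
qed

lemma aff_at_linear: "aff_at f D x \<Longrightarrow> linear D"
  by (simp add: aff_at_def)

lemma open_aff_at: "open {x. aff_at f D x}"
  unfolding open_contains_ball
proof clarify
  fix x assume "aff_at f D x"
  then obtain r where "r > 0" "\<And>y. y \<in> ball x r \<Longrightarrow> aff_at f D y" by (metis aff_at_nbhd)
  then show "\<exists>e>0. ball x e \<subseteq> {x. aff_at f D x}" by blast
qed

lemma open_Ex_aff_at: "open {x. \<exists>D\<in>\<Gamma>. aff_at f D x}"
proof -
  have "{x. \<exists>D\<in>\<Gamma>. aff_at f D x} = (\<Union>D\<in>\<Gamma>. {x. aff_at f D x})" by auto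
  then show ?thesis using open_aff_at by (auto intro!: open_UN)
qed

lemma aff_at_has_derivative:
  assumes "aff_at f D x"
  shows "(f has_derivative D) (at x)"
proof -
  obtain r c where r: "r > 0" "\<And>y. y \<in> ball x r \<Longrightarrow> f y = c + D y" using aff_at_nbhd[OF assms] by metis
  have "((\<lambda>y. c + D y) has_derivative D) (at x)"
    using aff_at_linear[OF assms] by (auto intro!: derivative_eq_intros linear_imp_has_derivative)
  then show ?thesis
    by (rule has_derivative_transform_within_open[of _ _ _ _ "ball x r"]) (use r in auto)
qed

lemma frechet_derivative_aff_at: "aff_at f D x \<Longrightarrow> frechet_derivative f (at x) = D"
  using aff_at_has_derivative frechet_derivative_at by blast

lemma aff_at_unique: "aff_at f D x \<Longrightarrow> aff_at f D' x \<Longrightarrow> D = D'"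
  using frechet_derivative_aff_at by blast

lemma aff_at_cong:
  assumes "aff_at f D x" "open S" "x \<in> S" "\<And>y. y \<in> S \<Longrightarrow> g y = f y"
  shows "aff_at g D x"
proof -
  obtain r c where r: "r > 0" "\<And>y. y \<in> ball x r \<Longrightarrow> f y = c + D y" using aff_at_nbhd[OF assms(1)] by metis
  show ?thesis
    by (rule aff_atI[of D "ball x r \<inter> S" x g c]) (use r assms aff_at_linear in auto)
qed

lemma aff_at_add:
  assumes "aff_at f D x" "aff_at g D' x"
  shows "aff_at (\<lambda>y. f y + g y) (\<lambda>h. D h + D' h) x"
proof -
  obtain r c where r: "r > 0" "\<And>y. y \<in> ball x r \<Longrightarrow> f y = c + D y" using aff_at_nbhd[OF assms(1)] by metis
  obtain s d where s: "s > 0" "\<And>y. y \<in> ball x s \<Longrightarrow> g y = d + D' y" using aff_at_nbhd[OF assms(2)] by metis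
  show ?thesis
    by (rule aff_atI[of _ "ball x r \<inter> ball x s" x _ "c + d"])
       (use r s aff_at_linear[OF assms(1)] aff_at_linear[OF assms(2)] in \<open>auto intro: linear_compose_add\<close>)
qed

lemma aff_at_compose:
  assumes "aff_at f D x" "linear T"
  shows "aff_at (\<lambda>y. T (f y)) (\<lambda>h. T (D h)) x"
proof -
  obtain r c where r: "r > 0" "\<And>y. y \<in> ball x r \<Longrightarrow> f y = c + D y" using aff_at_nbhd[OF assms(1)] by metis
  show ?thesis
    by (rule aff_atI[of _ "ball x r" x _ "T c"])
       (use r assms(2) linear_compose[OF aff_at_linear[OF assms(1)] assms(2)] in \<open>auto simp: linear_add o_def\<close>)
qed

lemma aff_at_affine: "linear D \<Longrightarrow> aff_at (\<lambda>y. c + D y) D x"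
  by (rule aff_atI[of _ UNIV]) auto

lemma pw_affine_affine: "linear D \<Longrightarrow> D \<in> \<Gamma> \<Longrightarrow> pw_affine \<Gamma> (\<lambda>y. c + D y)"
  unfolding pw_affine_def using aff_at_affine by (metis (mono_tags, lifting) Collect_empty_eq negligible_empty)

lemma pw_affine_const: "(\<lambda>h. 0) \<in> \<Gamma> \<Longrightarrow> pw_affine \<Gamma> (\<lambda>y. c)"
  using pw_affine_affine[of "\<lambda>h. 0" \<Gamma> c] linear_zero by auto

lemma pw_affine_mono: "pw_affine \<Gamma> f \<Longrightarrow> \<Gamma> \<subseteq> \<Gamma>' \<Longrightarrow> pw_affine \<Gamma>' f"
  unfolding pw_affine_def by (erule negligible_subset) blast

lemma pw_affine_add:
  assumes "pw_affine \<Gamma> f" "pw_affine \<Gamma>' g" "\<And>D D'. D \<in> \<Gamma> \<Longrightarrow> D' \<in> \<Gamma>' \<Longrightarrow> (\<lambda>h. D h + D' h) \<in> \<Delta>"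
  shows "pw_affine \<Delta> (\<lambda>y. f y + g y)"
proof -
  have "negligible ({x. \<not> (\<exists>D\<in>\<Gamma>. aff_at f D x)} \<union> {x. \<not> (\<exists>D\<in>\<Gamma>'. aff_at g D x)})"
    using assms unfolding pw_affine_def by simp
  then show ?thesis unfolding pw_affine_def
    by (rule negligible_subset) (use aff_at_add assms(3) in blast)
qed

lemma pw_affine_sum:
  assumes "finite I" "\<And>i. i \<in> I \<Longrightarrow> pw_affine UNIV (f i)"
  shows "pw_affine UNIV (\<lambda>y. \<Sum>i\<in>I. f i y)"
  using assms by (induction I) (auto intro: pw_affine_const pw_affine_add[of UNIV _ UNIV])

lemma pw_affine_compose:
  assumes "pw_affine \<Gamma> f" "linear T" "\<And>D. D \<in> \<Gamma> \<Longrightarrow> (\<lambda>h. T (D h)) \<in> \<Delta>"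
  shows "pw_affine \<Delta> (\<lambda>y. T (f y))"
  using assms(1) unfolding pw_affine_def
  by (rule negligible_subset) (use aff_at_compose[OF _ assms(2)] assms(3) in blast)

lemma aff_at_bound:
  assumes "L-lipschitz_on UNIV f" "aff_at f D x"
  shows "norm (D h) \<le> L * norm h"
proof -
  obtain r c where r: "r > 0" "\<And>y. y \<in> ball x r \<Longrightarrow> f y = c + D y" using aff_at_nbhd[OF assms(2)] by metis
  have l: "linear D" using assms aff_at_linear by blast
  show ?thesis
  proof (cases "h = 0")
    case True then show ?thesis using l by (simp add: linear_0)
  next
    case False
    define t where "t = r / (2 * norm h)"
    have t: "t > 0" using r False by (simp add: t_def)
    have "x + t *\<^sub>R h \<in> ball x r" using r False by (simp add: dist_norm t_def)
    then have "f (x + t *\<^sub>R h) - f x = t *\<^sub>R D h"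
      using r l by (auto simp: linear_add linear_scale)
    moreover have "norm (f (x + t *\<^sub>R h) - f x) \<le> L * norm (t *\<^sub>R h)"
      using lipschitz_onD[OF assms(1), of "x + t *\<^sub>R h" x] by (simp add: dist_norm)
    ultimately have "t * norm (D h) \<le> t * (L * norm h)" using t by (simp add: algebra_simps)
    then show ?thesis using t by simp
  qed
qed

section \<open>Lattice operations on piecewise affine functions, and measurability of their
  gradients\<close>

lemma linear_functional_inner:
  fixes D :: "'a::euclidean_space \<Rightarrow> real"
  assumes "linear D" obtains v where "D = (\<lambda>h. v \<bullet> h)"
proof
  show "D = (\<lambda>h. adjoint D 1 \<bullet> h)"
    using adjoint_works[OF assms, of _ 1] by (auto simp: inner_commute)
qed

text \<open>Near a point where the values differ, or where both values and gradients agree, the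
  maximum coincides with one of the two functions. What remains is the set \<open>Z\<close> of
  crossings with different gradients, which locally lies in a hyperplane. Hence maxima create no
  gradient outside \<open>\<Gamma>\<close>.\<close>

lemma pw_affine_max:
  fixes f g :: "'a::euclidean_space \<Rightarrow> real"
  assumes f: "pw_affine \<Gamma> f" "continuous_on UNIV f" and g: "pw_affine \<Gamma> g" "continuous_on UNIV g"
  shows "pw_affine \<Gamma> (\<lambda>y. max (f y) (g y))"
proof -
  define Z where "Z = {x. f x = g x \<and> (\<exists>D D'. aff_at f D x \<and> aff_at g D' x \<and> D \<noteq> D')}"
  have "negligible Z"
  proof (rule locally_negligible_alt[THEN iffD2], rule ballI)
    fix x assume "x \<in> Z"
    then obtain D D' where x: "f x = g x" "aff_at f D x" "aff_at g D' x" "D \<noteq> D'" unfolding Z_def by blast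
    obtain r c where r: "r > 0" "\<And>y. y \<in> ball x r \<Longrightarrow> f y = c + D y" using aff_at_nbhd[OF x(2)] by metis
    obtain s d where s: "s > 0" "\<And>y. y \<in> ball x s \<Longrightarrow> g y = d + D' y" using aff_at_nbhd[OF x(3)] by metis
    obtain v where v: "D = (\<lambda>h. v \<bullet> h)" using linear_functional_inner[OF aff_at_linear[OF x(2)]] .
    obtain v' where v': "D' = (\<lambda>h. v' \<bullet> h)" using linear_functional_inner[OF aff_at_linear[OF x(3)]] .
    let ?U = "Z \<inter> (ball x r \<inter> ball x s)"
    have "openin (top_of_set Z) ?U" by (simp add: openin_open_Int open_Int)
    moreover have "x \<in> ?U" using \<open>x \<in> Z\<close> r s by simp
    moreover have "negligible ?U"
    proof (rule negligible_subset[OF negligible_hyperplane])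
      show "v - v' \<noteq> 0 \<or> d - c \<noteq> 0" using x(4) v v' by auto
      show "?U \<subseteq> {y. (v - v') \<bullet> y = d - c}"
      proof
        fix y assume y: "y \<in> ?U"
        then have "f y = g y" by (simp add: Z_def)
        then have "c + D y = d + D' y" using r s y by simp
        then show "y \<in> {y. (v - v') \<bullet> y = d - c}" by (simp add: v v' inner_diff_left)
      qed
    qed
    ultimately show "\<exists>U. openin (top_of_set Z) U \<and> x \<in> U \<and> negligible U" by blast
  qed
  then have "negligible (Z \<union> {x. \<not> (\<exists>D\<in>\<Gamma>. aff_at f D x)} \<union> {x. \<not> (\<exists>D\<in>\<Gamma>. aff_at g D x)})"
    using f g unfolding pw_affine_def by simp
  then show ?thesis unfolding pw_affine_def
  proof (elim negligible_subset, intro subsetI, rule_tac ccontr)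
    fix x assume a: "x \<in> {x. \<not> (\<exists>D\<in>\<Gamma>. aff_at (\<lambda>y. max (f y) (g y)) D x)}"
      and b: "x \<notin> Z \<union> {x. \<not> (\<exists>D\<in>\<Gamma>. aff_at f D x)} \<union> {x. \<not> (\<exists>D\<in>\<Gamma>. aff_at g D x)}"
    obtain D D' where D: "aff_at f D x" "D \<in> \<Gamma>" "aff_at g D' x" "D' \<in> \<Gamma>" using b by auto
    consider "f x < g x" | "f x > g x" | "f x = g x" by linarith
    then have "\<exists>D\<in>\<Gamma>. aff_at (\<lambda>y. max (f y) (g y)) D x"
    proof cases
      case 1
      have "open {y. f y < g y}" using f g by (intro open_Collect_less) auto
      then have "aff_at (\<lambda>y. max (f y) (g y)) D' x"
        by (rule aff_at_cong[OF D(3)]) (use 1 in auto)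
      then show ?thesis using D by blast
    next
      case 2
      have "open {y. g y < f y}" using f g by (intro open_Collect_less) auto
      then have "aff_at (\<lambda>y. max (f y) (g y)) D x"
        by (rule aff_at_cong[OF D(1)]) (use 2 in auto)
      then show ?thesis using D by blast
    next
      case 3
      then have DD: "D = D'" using b D unfolding Z_def by blast
      obtain r where r: "r > 0" "\<And>y. y \<in> ball x r \<Longrightarrow> f y = f x + D (y - x)"
        using D(1) unfolding aff_at_def by blast
      obtain s where s: "s > 0" "\<And>y. y \<in> ball x s \<Longrightarrow> g y = g x + D (y - x)"
        using D(3) DD unfolding aff_at_def by blast
      have "max (f y) (g y) = f y" if "y \<in> ball x r \<inter> ball x s" for y
        using r(2)[of y] s(2)[of y] 3 that by (metis IntE max.idem)
      then have "aff_at (\<lambda>y. max (f y) (g y)) D x"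
        using r(1) s(1) by (intro aff_at_cong[OF D(1), of "ball x r \<inter> ball x s"]) (simp_all add: open_Int)
      then show ?thesis using D by blast
    qed
    then show False using a by blast
  qed
qed

lemma pw_affine_min:
  fixes f g :: "'a::euclidean_space \<Rightarrow> real"
  assumes f: "pw_affine \<Gamma> f" "continuous_on UNIV f" and g: "pw_affine \<Gamma> g" "continuous_on UNIV g"
  shows "pw_affine \<Gamma> (\<lambda>y. min (f y) (g y))"
proof -
  let ?\<Delta> = "(\<lambda>D h. - D h) ` \<Gamma>"
  have l: "linear (uminus :: real \<Rightarrow> real)" by (rule linear_uminus)
  have "pw_affine ?\<Delta> (\<lambda>y. - f y)" "pw_affine ?\<Delta> (\<lambda>y. - g y)"
    by (rule pw_affine_compose[OF f(1) l], simp) (rule pw_affine_compose[OF g(1) l], simp)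
  then have m: "pw_affine ?\<Delta> (\<lambda>y. max (- f y) (- g y))"
    using f g by (intro pw_affine_max continuous_intros) auto
  have "pw_affine \<Gamma> (\<lambda>y. - max (- f y) (- g y))"
    by (rule pw_affine_compose[OF m l]) auto
  then show ?thesis by (simp add: minus_max_eq_min)
qed

text \<open>On the open set of full measure where \<open>f\<close> is locally affine the derivative
  is locally constant, so every function \<open>T\<close> of it is continuous there. This covers
  \<open>\<lambda>D. g (\<xi> + matrix D)\<close> for an arbitrary integrand
  \<open>g\<close>.\<close>

lemma pw_affine_borel_measurable:
  fixes T :: "('a::euclidean_space \<Rightarrow> 'b::real_normed_vector) \<Rightarrow> 'c::euclidean_space"
  assumes "pw_affine \<Gamma> f"
  shows "(\<lambda>x. T (frechet_derivative f (at x))) \<in> borel_measurable lebesgue"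
proof -
  define O' where "O' = {x. \<exists>D\<in>\<Gamma>. aff_at f D x}"
  have o: "open O'" unfolding O'_def by (rule open_Ex_aff_at)
  have n: "negligible (- O')" using assms unfolding pw_affine_def O'_def Collect_neg_eq .
  have "continuous_on O' (\<lambda>x. T (frechet_derivative f (at x)))"
    unfolding continuous_on_eq_continuous_at[OF o]
  proof
    fix x assume "x \<in> O'"
    then obtain D where D: "aff_at f D x" unfolding O'_def by blast
    have "isCont (\<lambda>y. T D) x" by simp
    moreover have "\<forall>\<^sub>F y in nhds x. T (frechet_derivative f (at y)) = T D"
      unfolding eventually_nhds
      by (rule exI[of _ "{x. aff_at f D x}"]) (use D open_aff_at in \<open>auto simp: frechet_derivative_aff_at\<close>)
    ultimately show "isCont (\<lambda>x. T (frechet_derivative f (at x))) x"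
      using isCont_cong by force
  qed
  then have "(\<lambda>x. indicator O' x *\<^sub>R T (frechet_derivative f (at x))) \<in> borel_measurable borel"
    using o by (intro borel_measurable_continuous_on_indicator) auto
  then have "(\<lambda>x. indicator O' x *\<^sub>R T (frechet_derivative f (at x))) \<in> borel_measurable lebesgue"
    by (simp add: measurable_completion)
  then show ?thesis
  proof (rule borel_measurable_AE)
    have "- O' \<in> null_sets lebesgue" using n negligible_iff_null_sets by blast
    then have "AE x in lebesgue. x \<notin> - O'" by (rule AE_not_in)
    then show "AE x in lebesgue. indicator O' x *\<^sub>R T (frechet_derivative f (at x)) = T (frechet_derivative f (at x))"
      by eventually_elim simp
  qed
qed

section \<open>Integration by parts for Lipschitz functions\<close>

lemma borel_measurable_lebesgue_continuous:
  fixes f :: "'a::euclidean_space \<Rightarrow> 'b::euclidean_space"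
  assumes "continuous_on UNIV f"
  shows "f \<in> borel_measurable lebesgue"
  using borel_measurable_continuous_onI[OF assms] by (simp add: measurable_completion)

lemma integrable_lebesgue_bounded_support:
  fixes f :: "'a::euclidean_space \<Rightarrow> 'b::euclidean_space"
  assumes "f \<in> borel_measurable lebesgue" "\<And>x. norm (f x) \<le> B" "\<And>x. x \<notin> cball 0 R \<Longrightarrow> f x = 0"
  shows "integrable lebesgue f"
proof -
  have "integrable lebesgue (\<lambda>x. indicator (cball 0 R) x *\<^sub>R B)"
    by (intro integrable_indicator) (use emeasure_lborel_cball_finite in auto)
  then show ?thesis
    by (rule Bochner_Integration.integrable_bound[OF _ assms(1)])
       (use assms(2,3) in \<open>auto simp: indicator_def intro: order_trans[OF _ abs_ge_self]\<close>)
qed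

lemma integrable_lebesgue_continuous_bounded_support:
  fixes f :: "'a::euclidean_space \<Rightarrow> 'b::euclidean_space"
  assumes c: "continuous_on UNIV f" and z: "\<And>x. x \<notin> cball 0 R \<Longrightarrow> f x = 0"
  shows "integrable lebesgue f"
proof -
  have "bounded (f ` cball 0 R)"
    using compact_imp_bounded[OF compact_continuous_image[OF continuous_on_subset[OF c] compact_cball[of 0 R]]] by simp
  then obtain C where C: "\<And>x. x \<in> cball 0 R \<Longrightarrow> norm (f x) \<le> C"
    unfolding bounded_iff by blast
  have "norm (f x) \<le> \<bar>C\<bar>" for x
    using C[of x] z[of x] by (cases "x \<in> cball 0 R") auto
  from integrable_lebesgue_bounded_support[OF borel_measurable_lebesgue_continuous[OF c] this z]
  show ?thesis .
qed

lemma lebesgue_integral_translation: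
  fixes f :: "'a::euclidean_space \<Rightarrow> 'b::euclidean_space"
  assumes "continuous_on UNIV f"
  shows "(LINT x|lebesgue. f (x + e)) = (LINT x|lebesgue. f x)"
proof -
  have m: "f \<in> borel_measurable borel" using assms by (rule borel_measurable_continuous_onI)
  have "(LINT x|lebesgue. f x) = (LINT x|lborel. f x)"
    using m by (intro integral_completion) simp
  also have "\<dots> = (LINT x|distr lborel borel ((+) e). f x)" by (simp add: lborel_distr_plus)
  also have "\<dots> = (LINT x|lborel. f (e + x))" using m by (intro integral_distr) simp_all
  also have "\<dots> = (LINT x|lebesgue. f (e + x))"
    using m by (intro integral_completion[symmetric]) simp
  finally show ?thesis by (simp add: add.commute)
qed

lemma has_derivative_imp_sequentially:
  fixes f :: "'a::real_normed_vector \<Rightarrow> real"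
  assumes "(f has_derivative f') (at x)"
  shows "(\<lambda>k. (f (x + inverse (Suc k) *\<^sub>R e) - f x) * Suc k) \<longlonglongrightarrow> f' e"
proof -
  have lin: "linear f'" using assms has_derivative_linear by blast
  have "((\<lambda>t. x + t *\<^sub>R e) has_derivative (\<lambda>t. t *\<^sub>R e)) (at 0)"
    by (auto intro!: derivative_eq_intros)
  then have "((\<lambda>t. f (x + t *\<^sub>R e)) has_derivative (\<lambda>t. f' (t *\<^sub>R e))) (at 0)"
    using diff_chain_at[of "\<lambda>t. x + t *\<^sub>R e" _ 0 f f'] assms by (auto simp: o_def)
  then have "((\<lambda>t. f (x + t *\<^sub>R e)) has_real_derivative f' e) (at 0)"
    using lin by (auto simp: has_field_derivative_def linear_scale mult.commute[of _ "f' e"])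
  then have lim: "((\<lambda>t. (f (x + t *\<^sub>R e) - f x) / t) \<longlongrightarrow> f' e) (at 0)"
    by (simp add: DERIV_def)
  have "filterlim (\<lambda>k. inverse (real (Suc k))) (at 0) sequentially"
    by (intro filterlim_atI LIMSEQ_inverse_real_of_nat always_eventually) auto
  from filterlim_compose[OF lim this] show ?thesis
    by (simp add: field_simps)
qed

text \<open>Difference quotients can be moved from \<open>u\<close> to \<open>\<phi>\<close> by translation invariance; then pass to the
  limit by dominated convergence.\<close>

lemma integration_by_parts_lipschitz:
  fixes u \<phi> :: "'a::euclidean_space \<Rightarrow> real"
  assumes u: "L-lipschitz_on UNIV u" and \<phi>: "M-lipschitz_on UNIV \<phi>" and bd: "bounded {x. \<phi> x \<noteq> 0}"
    and du: "AE x in lebesgue. (u has_derivative u' x) (at x)" "(\<lambda>x. u' x e) \<in> borel_measurable lebesgue"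
    and d\<phi>: "AE x in lebesgue. (\<phi> has_derivative \<phi>' x) (at x)" "(\<lambda>x. \<phi>' x e) \<in> borel_measurable lebesgue"
  shows "(LINT x|lebesgue. u' x e * \<phi> x) = - (LINT x|lebesgue. u x * \<phi>' x e)"
proof -
  have cu: "continuous_on UNIV u" using u lipschitz_on_continuous_on by blast
  have c\<phi>: "continuous_on UNIV \<phi>" using \<phi> lipschitz_on_continuous_on by blast
  have LM: "0 \<le> L" "0 \<le> M" using u \<phi> lipschitz_on_nonneg by auto
  obtain R0 where R0: "\<And>x. \<phi> x \<noteq> 0 \<Longrightarrow> norm x \<le> R0" using bd by (auto simp: bounded_iff)
  \<comment> \<open>One ball that contains the support of \<open>\<phi>\<close> and of all its
    translates by \<open>t *\<^sub>R e\<close> with \<open>0 \<le> t \<le> 1\<close>; its indicator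
    times a constant dominates all difference quotients.\<close>
  define R where "R = \<bar>R0\<bar> + norm e"
  have R: "\<phi> (x - t *\<^sub>R e) = 0" if "x \<notin> cball 0 R" "0 \<le> t" "t \<le> 1" for x t
  proof (rule ccontr)
    assume "\<phi> (x - t *\<^sub>R e) \<noteq> 0"
    then have "norm (x - t *\<^sub>R e) \<le> R0" by (rule R0)
    moreover have "norm (t *\<^sub>R e) \<le> norm e" using that mult_right_mono[of t 1 "norm e"] by simp
    moreover have "norm x \<le> norm (x - t *\<^sub>R e) + norm (t *\<^sub>R e)" using norm_triangle_ineq[of "x - t *\<^sub>R e" "t *\<^sub>R e"] by simp
    ultimately show False using that by (simp add: R_def)
  qed
  have bdd: "\<exists>B. \<forall>x\<in>cball 0 R. \<bar>f x\<bar> \<le> B" if c: "continuous_on UNIV f" for f :: "'a \<Rightarrow> real"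
    using compact_imp_bounded[OF compact_continuous_image[OF continuous_on_subset[OF c] compact_cball[of 0 R]]]
    by (auto simp: bounded_iff)
  obtain Bu where Bu: "\<And>x. x \<in> cball 0 R \<Longrightarrow> \<bar>u x\<bar> \<le> Bu" using bdd[OF cu] by blast
  obtain B\<phi> where B\<phi>: "\<And>x. x \<in> cball 0 R \<Longrightarrow> \<bar>\<phi> x\<bar> \<le> B\<phi>" using bdd[OF c\<phi>] by blast
  have ind: "integrable lebesgue (\<lambda>x::'a. indicator (cball 0 R) x *\<^sub>R C)" for C :: real
    by (intro integrable_indicator) (use emeasure_lborel_cball_finite in auto)
  define t where "t = (\<lambda>k. inverse (real (Suc k)))"
  have t: "0 < t k" "t k \<le> 1" for k by (auto simp: t_def field_simps)
  have st: "real (Suc k) = inverse (t k)" for k by (simp add: t_def)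
  define A where "A = (\<lambda>k x. (u (x + t k *\<^sub>R e) - u x) * Suc k * \<phi> x)"
  define B where "B = (\<lambda>k x. u x * ((\<phi> (x - t k *\<^sub>R e) - \<phi> x) * Suc k))"
  have Aint: "(\<lambda>k. LINT x|lebesgue. A k x) \<longlonglongrightarrow> (LINT x|lebesgue. u' x e * \<phi> x)"
  proof (rule integral_dominated_convergence)
    show "(\<lambda>x. u' x e * \<phi> x) \<in> borel_measurable lebesgue"
      using du borel_measurable_lebesgue_continuous[OF c\<phi>] by (intro borel_measurable_times)
    show "A k \<in> borel_measurable lebesgue" for k
      unfolding A_def by (intro borel_measurable_lebesgue_continuous continuous_intros continuous_on_compose2[OF cu] continuous_on_compose2[OF c\<phi>]) auto
    show "integrable lebesgue (\<lambda>x::'a. indicator (cball 0 R) x *\<^sub>R (L * norm e * B\<phi>))" by (rule ind)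
    show "AE x in lebesgue. (\<lambda>k. A k x) \<longlonglongrightarrow> u' x e * \<phi> x"
      using du(1)
    proof eventually_elim
      case (elim x)
      show ?case unfolding A_def t_def
        by (intro tendsto_mult has_derivative_imp_sequentially[OF elim] tendsto_const)
    qed
    show "AE x in lebesgue. norm (A k x) \<le> indicator (cball 0 R) x *\<^sub>R (L * norm e * B\<phi>)" for k
    proof (rule AE_I2)
      fix x
      show "norm (A k x) \<le> indicator (cball 0 R) x *\<^sub>R (L * norm e * B\<phi>)"
      proof (cases "x \<in> cball 0 R")
        case True
        have "\<bar>u (x + t k *\<^sub>R e) - u x\<bar> \<le> L * (t k * norm e)"
          using lipschitz_onD[OF u, of "x + t k *\<^sub>R e" x] t[of k] by (simp add: dist_norm)
        then have "\<bar>(u (x + t k *\<^sub>R e) - u x) * Suc k\<bar> \<le> L * norm e"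
          using t[of k] unfolding st by (simp add: abs_mult field_simps)
        then have "\<bar>(u (x + t k *\<^sub>R e) - u x) * Suc k\<bar> * \<bar>\<phi> x\<bar> \<le> L * norm e * B\<phi>"
          using B\<phi>[OF True] LM by (intro mult_mono) auto
        then show ?thesis using True by (simp add: A_def abs_mult)
      next
        case False
        then show ?thesis using R[of x 0] by (simp add: A_def)
      qed
    qed
  qed
  have Bint: "(\<lambda>k. LINT x|lebesgue. B k x) \<longlonglongrightarrow> (LINT x|lebesgue. u x * (- \<phi>' x e))"
  proof (rule integral_dominated_convergence)
    show "(\<lambda>x. u x * (- \<phi>' x e)) \<in> borel_measurable lebesgue"
      using d\<phi> borel_measurable_lebesgue_continuous[OF cu] by (intro borel_measurable_times borel_measurable_uminus)
    show "B k \<in> borel_measurable lebesgue" for k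
      unfolding B_def by (intro borel_measurable_lebesgue_continuous continuous_intros continuous_on_compose2[OF cu] continuous_on_compose2[OF c\<phi>]) auto
    show "integrable lebesgue (\<lambda>x::'a. indicator (cball 0 R) x *\<^sub>R (Bu * (M * norm e)))" by (rule ind)
    show "AE x in lebesgue. (\<lambda>k. B k x) \<longlonglongrightarrow> u x * (- \<phi>' x e)"
      using d\<phi>(1)
    proof eventually_elim
      case (elim x)
      have "(\<lambda>k. (\<phi> (x + inverse (Suc k) *\<^sub>R (- e)) - \<phi> x) * Suc k) \<longlonglongrightarrow> \<phi>' x (- e)"
        by (rule has_derivative_imp_sequentially[OF elim])
      moreover have "\<phi>' x (- e) = - \<phi>' x e" using has_derivative_linear[OF elim] by (simp add: linear_neg)
      ultimately show ?case unfolding B_def t_def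
        by (intro tendsto_mult tendsto_const) simp
    qed
    show "AE x in lebesgue. norm (B k x) \<le> indicator (cball 0 R) x *\<^sub>R (Bu * (M * norm e))" for k
    proof (rule AE_I2)
      fix x
      show "norm (B k x) \<le> indicator (cball 0 R) x *\<^sub>R (Bu * (M * norm e))"
      proof (cases "x \<in> cball 0 R")
        case True
        have "\<bar>\<phi> (x - t k *\<^sub>R e) - \<phi> x\<bar> \<le> M * (t k * norm e)"
          using lipschitz_onD[OF \<phi>, of "x - t k *\<^sub>R e" x] t[of k] by (simp add: dist_norm)
        then have "\<bar>(\<phi> (x - t k *\<^sub>R e) - \<phi> x) * Suc k\<bar> \<le> M * norm e"
          using t[of k] unfolding st by (simp add: abs_mult field_simps)
        then have "\<bar>u x\<bar> * \<bar>(\<phi> (x - t k *\<^sub>R e) - \<phi> x) * Suc k\<bar> \<le> Bu * (M * norm e)"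
          using Bu[OF True] LM by (intro mult_mono) auto
        then show ?thesis using True by (simp add: B_def abs_mult)
      next
        case False
        then show ?thesis using R[of x 0] R[of x "t k"] t[of k] by (simp add: B_def)
      qed
    qed
  qed
  have "(LINT x|lebesgue. A k x) = (LINT x|lebesgue. B k x)" for k
  proof -
    let ?s = "real (Suc k)"
    have i0: "integrable lebesgue (\<lambda>x. u x * \<phi> (x - s *\<^sub>R e))" if s: "0 \<le> s" "s \<le> 1" for s
    proof (rule integrable_lebesgue_continuous_bounded_support)
      show "continuous_on UNIV (\<lambda>x. u x * \<phi> (x - s *\<^sub>R e))"
        by (intro continuous_intros continuous_on_compose2[OF cu] continuous_on_compose2[OF c\<phi>]) auto
      show "x \<notin> cball 0 R \<Longrightarrow> u x * \<phi> (x - s *\<^sub>R e) = 0" for x using R[of x s] s by simp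
    qed
    have i1: "integrable lebesgue (\<lambda>x. u x * \<phi> x)" using i0[of 0] by simp
    have i2: "integrable lebesgue (\<lambda>x. u x * \<phi> (x - t k *\<^sub>R e))" using i0[of "t k"] t[of k] by simp
    have i3: "integrable lebesgue (\<lambda>x. u (x + t k *\<^sub>R e) * \<phi> x)"
    proof (rule integrable_lebesgue_continuous_bounded_support)
      show "continuous_on UNIV (\<lambda>x. u (x + t k *\<^sub>R e) * \<phi> x)"
        by (intro continuous_intros continuous_on_compose2[OF cu] continuous_on_compose2[OF c\<phi>]) auto
      show "x \<notin> cball 0 R \<Longrightarrow> u (x + t k *\<^sub>R e) * \<phi> x = 0" for x using R[of x 0] by simp
    qed
    have tr: "(LINT x|lebesgue. u (x + t k *\<^sub>R e) * \<phi> x) = (LINT x|lebesgue. u x * \<phi> (x - t k *\<^sub>R e))"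
    proof -
      have "continuous_on UNIV (\<lambda>x. u x * \<phi> (x - t k *\<^sub>R e))"
        by (intro continuous_intros continuous_on_compose2[OF cu] continuous_on_compose2[OF c\<phi>]) auto
      from lebesgue_integral_translation[OF this, of "t k *\<^sub>R e"] show ?thesis by simp
    qed
    have "(LINT x|lebesgue. A k x) = (LINT x|lebesgue. ?s * (u (x + t k *\<^sub>R e) * \<phi> x) - ?s * (u x * \<phi> x))"
      unfolding A_def by (intro Bochner_Integration.integral_cong refl) (simp add: algebra_simps)
    also have "\<dots> = ?s * (LINT x|lebesgue. u (x + t k *\<^sub>R e) * \<phi> x) - ?s * (LINT x|lebesgue. u x * \<phi> x)"
      using i1 i3 by (subst Bochner_Integration.integral_diff) auto
    also have "\<dots> = (LINT x|lebesgue. ?s * (u x * \<phi> (x - t k *\<^sub>R e)) - ?s * (u x * \<phi> x))"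
      unfolding tr using i1 i2 by (subst Bochner_Integration.integral_diff) auto
    also have "\<dots> = (LINT x|lebesgue. B k x)"
      unfolding B_def by (intro Bochner_Integration.integral_cong refl) (simp add: algebra_simps)
    finally show ?thesis .
  qed
  then have "(LINT x|lebesgue. u' x e * \<phi> x) = (LINT x|lebesgue. u x * (- \<phi>' x e))"
    using LIMSEQ_unique[OF Aint] Bint by simp
  then show ?thesis by simp
qed

lemma pw_affine_AE_derivative:
  assumes "pw_affine \<Gamma> f"
  shows "AE x in lebesgue. \<exists>D\<in>\<Gamma>. aff_at f D x"
    "AE x in lebesgue. (f has_derivative frechet_derivative f (at x)) (at x)"
proof -
  have "{x. \<not> (\<exists>D\<in>\<Gamma>. aff_at f D x)} \<in> null_sets lebesgue"
    using assms negligible_iff_null_sets unfolding pw_affine_def by blast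
  then have "AE x in lebesgue. x \<notin> {x. \<not> (\<exists>D\<in>\<Gamma>. aff_at f D x)}" by (rule AE_not_in)
  then show *: "AE x in lebesgue. \<exists>D\<in>\<Gamma>. aff_at f D x" by simp
  show "AE x in lebesgue. (f has_derivative frechet_derivative f (at x)) (at x)"
    using * by eventually_elim (auto simp: frechet_derivative_aff_at intro: aff_at_has_derivative)
qed

text \<open>Integration by parts against the constant 1: here \<open>w\<close> takes the role of the
  compactly supported factor and the other factor has derivative 0.\<close>

lemma integral_gradient_pw_affine:
  fixes w :: "'a::euclidean_space \<Rightarrow> real"
  assumes "L-lipschitz_on UNIV w" "bounded {x. w x \<noteq> 0}" "pw_affine \<Gamma> w"
  shows "(LINT x|lebesgue. frechet_derivative w (at x) e) = 0"
proof -
  have "(LINT x|lebesgue. (\<lambda>_. 0) e * w x) = - (LINT x|lebesgue. 1 * frechet_derivative w (at x) e)"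
    by (rule integration_by_parts_lipschitz[where L=0 and u'="\<lambda>x _. 0" and u="\<lambda>_. 1"])
       (use assms pw_affine_AE_derivative[OF assms(3)] pw_affine_borel_measurable[OF assms(3), of "\<lambda>D. D e"]
         in \<open>auto simp: lipschitz_on_def\<close>)
  then show ?thesis by simp
qed

section \<open>Cutoff and sawtooth functions\<close>

text \<open>The support condition of \<open>test_functions\<close>, separated from smoothness
  because the competitors are only Lipschitz.\<close>

definition cpt_supp :: "('a::topological_space \<Rightarrow> 'b::zero) \<Rightarrow> 'a set \<Rightarrow> bool" where
  "cpt_supp f \<Omega> \<longleftrightarrow> compact (closure {x. f x \<noteq> 0}) \<and> closure {x. f x \<noteq> 0} \<subseteq> \<Omega>"

lemma cpt_suppI:
  fixes f :: "'a::t2_space \<Rightarrow> 'b::zero"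
  assumes "compact C" "C \<subseteq> \<Omega>" "\<And>x. f x \<noteq> 0 \<Longrightarrow> x \<in> C"
  shows "cpt_supp f \<Omega>"
proof -
  have "closure {x. f x \<noteq> 0} \<subseteq> C" using assms by (intro closure_minimal compact_imp_closed) auto
  moreover from this have "closure {x. f x \<noteq> 0} = C \<inter> closure {x. f x \<noteq> 0}" by blast
  then have "compact (closure {x. f x \<noteq> 0})"
    using compact_Int_closed[OF assms(1) closed_closure] by metis
  ultimately show ?thesis unfolding cpt_supp_def using assms(2) by blast
qed

lemma cpt_suppE:
  assumes "cpt_supp f \<Omega>"
  obtains C where "compact C" "C \<subseteq> \<Omega>" "\<And>x. f x \<noteq> 0 \<Longrightarrow> x \<in> C"
proof (rule that)
  show "compact (closure {x. f x \<noteq> 0})" "closure {x. f x \<noteq> 0} \<subseteq> \<Omega>"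
    using assms unfolding cpt_supp_def by auto
  show "f x \<noteq> 0 \<Longrightarrow> x \<in> closure {x. f x \<noteq> 0}" for x
    using closure_subset[of "{x. f x \<noteq> 0}"] by auto
qed

lemma lipschitz_on_max:
  fixes f g :: "'a::metric_space \<Rightarrow> real"
  assumes "L-lipschitz_on X f" "L-lipschitz_on X g"
  shows "L-lipschitz_on X (\<lambda>x. max (f x) (g x))"
proof (rule lipschitz_onI)
  show "0 \<le> L" using assms lipschitz_on_nonneg by auto
  fix x y assume xy: "x \<in> X" "y \<in> X"
  have "\<bar>f x - f y\<bar> \<le> L * dist x y" "\<bar>g x - g y\<bar> \<le> L * dist x y"
    using lipschitz_onD[OF assms(1) xy] lipschitz_onD[OF assms(2) xy] by (auto simp: dist_real_def)
  then show "dist (max (f x) (g x)) (max (f y) (g y)) \<le> L * dist x y"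
    unfolding dist_real_def by linarith
qed

lemma lipschitz_on_min:
  fixes f g :: "'a::metric_space \<Rightarrow> real"
  assumes "L-lipschitz_on X f" "L-lipschitz_on X g"
  shows "L-lipschitz_on X (\<lambda>x. min (f x) (g x))"
  using lipschitz_on_minus[OF lipschitz_on_max[OF lipschitz_on_minus[OF assms(1)] lipschitz_on_minus[OF assms(2)]]]
  by (simp add: minus_max_eq_min)

lemma lipschitz_on_sum:
  fixes f :: "'i \<Rightarrow> 'a::metric_space \<Rightarrow> 'b::real_normed_vector"
  assumes "finite I" "\<And>i. i \<in> I \<Longrightarrow> (L i)-lipschitz_on X (f i)"
  shows "(\<Sum>i\<in>I. L i)-lipschitz_on X (\<lambda>x. \<Sum>i\<in>I. f i x)"
  using assms by (induction I) (auto intro!: lipschitz_intros)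

lemma lipschitz_on_affine_functional:
  fixes v :: "'a::real_inner"
  assumes "\<bar>a\<bar> * norm v \<le> L"
  shows "L-lipschitz_on X (\<lambda>x. c + a * (v \<bullet> x))"
proof (rule lipschitz_onI)
  show "0 \<le> L" using assms by (metis abs_ge_zero mult_nonneg_nonneg norm_ge_zero order_trans)
  fix x y
  have "dist (c + a * (v \<bullet> x)) (c + a * (v \<bullet> y)) = \<bar>a\<bar> * \<bar>v \<bullet> (x - y)\<bar>"
    by (simp add: dist_real_def inner_diff_right abs_mult[symmetric] right_diff_distrib)
  also have "\<dots> \<le> \<bar>a\<bar> * (norm v * norm (x - y))"
    by (intro mult_left_mono Cauchy_Schwarz_ineq2) auto
  also have "\<dots> \<le> L * norm (x - y)" using assms by (metis mult.assoc mult_right_mono norm_ge_zero)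
  finally show "dist (c + a * (v \<bullet> x)) (c + a * (v \<bullet> y)) \<le> L * dist x y" by (simp add: dist_norm)
qed

lemma pw_affine_functional:
  "(\<lambda>h. a * (v \<bullet> h)) \<in> \<Gamma> \<Longrightarrow> pw_affine \<Gamma> (\<lambda>x. c + a * (v \<bullet> x))"
  by (rule pw_affine_affine) (auto intro!: linearI simp: inner_add_right algebra_simps)

text \<open>The distance in the l1 norm replaces the Euclidean one: it is a sum of absolute values
  of coordinates, hence piecewise affine, and it dominates the Euclidean norm, which puts the
  support of the tent into the Euclidean ball.\<close>

lemma tent_function:
  fixes x :: "'a::euclidean_space"
  obtains \<tau> L where "L-lipschitz_on UNIV \<tau>" "pw_affine UNIV \<tau>" "\<And>y. 0 \<le> \<tau> y"
    "\<And>y. \<tau> y \<noteq> 0 \<Longrightarrow> y \<in> cball x \<rho>" "\<tau> x = max 0 \<rho>"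
proof -
  define a where "a = (\<lambda>b y. max (- (x \<bullet> b) + 1 * (b \<bullet> y)) (x \<bullet> b + (- 1) * (b \<bullet> y)))"
  have a: "a b y = \<bar>y \<bullet> b - x \<bullet> b\<bar>" for b y by (simp add: a_def inner_commute)
  have al: "1-lipschitz_on UNIV (a b)" if "b \<in> Basis" for b
    unfolding a_def using that by (intro lipschitz_on_max lipschitz_on_affine_functional) auto
  have ap: "pw_affine UNIV (a b)" if "b \<in> Basis" for b
    unfolding a_def using that
    by (intro pw_affine_max pw_affine_functional continuous_intros) auto
  define s where "s = (\<lambda>y. \<Sum>b\<in>Basis. a b y)"
  have sl: "(\<Sum>b\<in>(Basis::'a set). 1)-lipschitz_on UNIV s" unfolding s_def
    by (rule lipschitz_on_sum) (use al in auto)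
  have sp: "pw_affine UNIV s" unfolding s_def by (rule pw_affine_sum) (use ap in auto)
  have "(\<lambda>h. - h) = (uminus :: real \<Rightarrow> real)" by auto
  then have ms: "pw_affine UNIV (\<lambda>y. \<rho> + - s y)"
    using pw_affine_add[OF pw_affine_const[of UNIV \<rho>] pw_affine_compose[OF sp linear_uminus[where 'a=real], of UNIV], of UNIV]
    by simp
  have l: "(\<Sum>b\<in>(Basis::'a set). 1)-lipschitz_on UNIV (\<lambda>y. \<rho> + - s y)"
    using lipschitz_on_add[OF lipschitz_on_constant[of UNIV \<rho>] lipschitz_on_minus[OF sl]] by simp
  define \<tau> where "\<tau> = (\<lambda>y. max 0 (\<rho> + - s y))"
  show ?thesis
  proof (rule that)
    show "(\<Sum>b\<in>(Basis::'a set). 1)-lipschitz_on UNIV \<tau>"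
      unfolding \<tau>_def by (rule lipschitz_on_max[OF lipschitz_on_mono[OF lipschitz_on_constant subset_refl] l]) simp
    show "pw_affine UNIV \<tau>" unfolding \<tau>_def
      using lipschitz_on_continuous_on[OF l] by (intro pw_affine_max ms pw_affine_const) auto
    show "0 \<le> \<tau> y" for y by (simp add: \<tau>_def)
    show "\<tau> x = max 0 \<rho>" by (simp add: \<tau>_def s_def a)
    fix y assume "\<tau> y \<noteq> 0"
    then have "s y < \<rho>" by (auto simp: \<tau>_def max_def split: if_splits)
    moreover have "norm (y - x) \<le> s y" using norm_le_l1[of "y - x"] by (simp add: s_def a inner_diff_left)
    ultimately show "y \<in> cball x \<rho>" by (simp add: dist_norm norm_minus_commute)
  qed
qed

text \<open>Compactness reduces to a finite sum of tents, which stays piecewise affine, unlike the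
  distance to the complement of \<Omega>. The result is merely positive on \<open>C\<close>; the
  callers rescale it by its minimum there.\<close>

lemma cutoff_function:
  fixes \<Omega> :: "'a::euclidean_space set"
  assumes "open \<Omega>" "compact C" "C \<subseteq> \<Omega>"
  obtains d L where "L-lipschitz_on UNIV d" "pw_affine UNIV d" "\<And>x. 0 \<le> d x"
    "cpt_supp d \<Omega>" "\<And>x. x \<in> C \<Longrightarrow> 0 < (d x :: real)"
proof -
  have "\<exists>\<tau> L \<rho>. L-lipschitz_on UNIV \<tau> \<and> pw_affine UNIV \<tau> \<and> (\<forall>y. 0 \<le> \<tau> y) \<and>
          (\<forall>y. \<tau> y \<noteq> 0 \<longrightarrow> y \<in> cball x \<rho>) \<and> \<tau> x > (0::real) \<and> cball x \<rho> \<subseteq> \<Omega>" if "x \<in> C" for x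
  proof -
    have "x \<in> \<Omega>" using that assms(3) by (rule rev_subsetD)
    then obtain \<rho> where r: "\<rho> > 0" "cball x \<rho> \<subseteq> \<Omega>"
      using assms(1)[unfolded open_contains_cball] by (elim ballE exE) auto
    obtain \<tau> L where t: "L-lipschitz_on UNIV \<tau>" "pw_affine UNIV \<tau>" "\<And>y. 0 \<le> \<tau> y"
       "\<And>y. \<tau> y \<noteq> 0 \<Longrightarrow> y \<in> cball x \<rho>" "\<tau> x = max 0 \<rho>" by (rule tent_function[of x \<rho>]) (rule that; assumption)
    show ?thesis using r t by (intro exI[of _ \<tau>] exI[of _ L] exI[of _ \<rho>]) auto
  qed
  then have "\<forall>x\<in>C. \<exists>p. (fst (snd p))-lipschitz_on UNIV (fst p) \<and> pw_affine UNIV (fst p) \<and> (\<forall>y. 0 \<le> fst p y) \<and>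
          (\<forall>y. fst p y \<noteq> 0 \<longrightarrow> y \<in> cball x (snd (snd p))) \<and> fst p x > (0::real) \<and> cball x (snd (snd p)) \<subseteq> \<Omega>"
    unfolding split_paired_Ex by simp
  from bchoice[OF this] obtain p where p: "\<forall>x\<in>C. (fst (snd (p x)))-lipschitz_on UNIV (fst (p x)) \<and> pw_affine UNIV (fst (p x)) \<and>
     (\<forall>y. 0 \<le> fst (p x) y) \<and> (\<forall>y. fst (p x) y \<noteq> 0 \<longrightarrow> y \<in> cball x (snd (snd (p x)))) \<and> fst (p x) x > (0::real) \<and>
     cball x (snd (snd (p x))) \<subseteq> \<Omega>" ..
  define \<tau> where "\<tau> x = fst (p x)" for x
  define L where "L x = fst (snd (p x))" for x
  define \<rho> where "\<rho> x = snd (snd (p x))" for x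
  have t: "\<And>x. x \<in> C \<Longrightarrow> (L x)-lipschitz_on UNIV (\<tau> x)"
     "\<And>x. x \<in> C \<Longrightarrow> pw_affine UNIV (\<tau> x)" "\<And>x y. x \<in> C \<Longrightarrow> 0 \<le> \<tau> x y"
     "\<And>x y. x \<in> C \<Longrightarrow> \<tau> x y \<noteq> 0 \<Longrightarrow> y \<in> cball x (\<rho> x)" "\<And>x. x \<in> C \<Longrightarrow> \<tau> x x > 0"
     "\<And>x. x \<in> C \<Longrightarrow> cball x (\<rho> x) \<subseteq> \<Omega>"
    using p unfolding \<tau>_def L_def \<rho>_def by blast+
  have o: "open {y. 0 < \<tau> x y}" if "x \<in> C" for x
    using lipschitz_on_continuous_on[OF t(1)[OF that]] by (intro open_Collect_less) auto
  have cov: "C \<subseteq> (\<Union>x\<in>C. {y. 0 < \<tau> x y})" using t(5) by blast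
  obtain F where F: "F \<subseteq> C" "finite F" "C \<subseteq> (\<Union>x\<in>F. {y. 0 < \<tau> x y})"
    using compactE_image[OF assms(2) o cov] by blast
  define d where "d = (\<lambda>y. \<Sum>x\<in>F. \<tau> x y)"
  show ?thesis
  proof (rule that)
    show "(\<Sum>x\<in>F. L x)-lipschitz_on UNIV d" unfolding d_def
      by (rule lipschitz_on_sum) (use F t in auto)
    show "pw_affine UNIV d" unfolding d_def by (rule pw_affine_sum) (use F t in auto)
    show "0 \<le> d x" for x unfolding d_def by (rule sum_nonneg) (use F t in auto)
    show "cpt_supp d \<Omega>"
    proof (rule cpt_suppI)
      show "compact (\<Union>x\<in>F. cball x (\<rho> x))" using F by (intro compact_UN) auto
      show "(\<Union>x\<in>F. cball x (\<rho> x)) \<subseteq> \<Omega>" using F(1) t(6) by blast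
      fix y assume "d y \<noteq> 0"
      then have "\<exists>x\<in>F. \<tau> x y \<noteq> 0" unfolding d_def using sum.neutral by metis
      then obtain x where x: "x \<in> F" "\<tau> x y \<noteq> 0" by (elim bexE)
      show "y \<in> (\<Union>x\<in>F. cball x (\<rho> x))"
        by (rule UN_I[OF x(1)], rule t(4)[OF subsetD[OF F(1) x(1)] x(2)])
    qed
    show "0 < d y" if "y \<in> C" for y
    proof -
      obtain x where x: "x \<in> F" "0 < \<tau> x y" using F(3) \<open>y \<in> C\<close> by auto
      then show ?thesis unfolding d_def using F(1,2) t(3) by (intro sum_pos2[of F x]) auto
    qed
  qed
qed

text \<open>A periodic sawtooth would be an infinite maximum of teeth. Only finite maxima are used
  here, so nonnegativity is claimed on a slab of prescribed width, which suffices on a bounded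
  set.\<close>

lemma sawtooth_function:
  fixes \<nu> :: "'a::euclidean_space" and t \<delta> :: real
  assumes t: "0 < t" "t < 1" and \<delta>: "0 < \<delta>"
  shows "\<exists>s. (norm \<nu>)-lipschitz_on UNIV s \<and> pw_affine {\<lambda>h. (1 - t) * (\<nu> \<bullet> h), \<lambda>h. - t * (\<nu> \<bullet> h)} s \<and>
     (\<forall>x. s x \<le> \<delta>) \<and> (\<forall>x. \<bar>\<nu> \<bullet> x\<bar> \<le> real N * \<delta> \<longrightarrow> 0 \<le> s x)"
proof -
  let ?\<Gamma> = "{\<lambda>h. (1 - t) * (\<nu> \<bullet> h), \<lambda>h. - t * (\<nu> \<bullet> h)}"
  \<comment> \<open>The tooth over the strip \<open>k * \<delta> \<le> \<nu> \<bullet> x \<le> (k +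
    1) * \<delta>\<close>: it rises with gradient \<open>(1 - t) *\<^sub>R \<nu>\<close> on the
    first fraction \<open>t\<close> of the strip, falls with gradient
    \<open>- t *\<^sub>R \<nu>\<close> on the rest, and is negative outside.\<close>
  define T where "T = (\<lambda>(k::real) x. min (- (1 - t) * (k * \<delta>) + (1 - t) * (\<nu> \<bullet> x)) (t * ((k + 1) * \<delta>) + (- t) * (\<nu> \<bullet> x)))"
  have le: "a * norm \<nu> \<le> norm \<nu>" if "a \<le> 1" for a using mult_right_mono[OF that norm_ge_zero[of \<nu>]] by simp
  have Tl: "(norm \<nu>)-lipschitz_on UNIV (T k)" for k
    unfolding T_def using t by (intro lipschitz_on_min lipschitz_on_affine_functional) (auto intro!: le)
  have Tp: "pw_affine ?\<Gamma> (T k)" for k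
    unfolding T_def by (intro pw_affine_min pw_affine_functional continuous_intros) auto
  have T\<delta>: "T k x \<le> \<delta>" for k x
  proof (cases "\<nu> \<bullet> x \<le> (k + 1) * \<delta>")
    case True
    then have "(1 - t) * (\<nu> \<bullet> x - k * \<delta>) \<le> (1 - t) * \<delta>" using t by (intro mult_left_mono) (auto simp: algebra_simps)
    also have "\<dots> \<le> \<delta>" using t \<delta> mult_right_mono[of "1 - t" 1 \<delta>] by simp
    finally show ?thesis unfolding T_def by (simp add: algebra_simps min_le_iff_disj)
  next
    case False
    then have "t * ((k + 1) * \<delta> - \<nu> \<bullet> x) \<le> 0" using t by (intro mult_nonneg_nonpos) auto
    then show ?thesis unfolding T_def using \<delta> by (simp add: algebra_simps min_le_iff_disj)
  qed
  have T0: "0 \<le> T k x" if "k * \<delta> \<le> \<nu> \<bullet> x" "\<nu> \<bullet> x \<le> (k + 1) * \<delta>" for k x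
  proof -
    have "0 \<le> (1 - t) * (\<nu> \<bullet> x - k * \<delta>)" "0 \<le> t * ((k + 1) * \<delta> - \<nu> \<bullet> x)" using t that by simp_all
    then show ?thesis unfolding T_def by (simp add: algebra_simps)
  qed
  show ?thesis
  proof (induction N)
    case 0
    show ?case using Tl[of 0] Tp[of 0] T\<delta> T0[of 0] \<delta> by (intro exI[of _ "T 0"]) auto
  next
    case (Suc N)
    then obtain s where s: "(norm \<nu>)-lipschitz_on UNIV s" "pw_affine ?\<Gamma> s" "\<And>x. s x \<le> \<delta>"
      "\<And>x. \<bar>\<nu> \<bullet> x\<bar> \<le> real N * \<delta> \<Longrightarrow> 0 \<le> s x" by blast
    \<comment> \<open>One new tooth on either side: the strips with indices \<open>N\<close> and
      \<open>- N - 1\<close> widen the slab from \<open>N * \<delta>\<close> to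
      \<open>(N + 1) * \<delta>\<close>.\<close>
    let ?s = "\<lambda>x. max (s x) (max (T (real N) x) (T (- real N - 1) x))"
    show ?case
    proof (intro exI[of _ ?s] conjI allI impI)
      show "(norm \<nu>)-lipschitz_on UNIV ?s" using s Tl by (intro lipschitz_on_max) auto
      show "pw_affine ?\<Gamma> ?s"
        using s Tl Tp by (intro pw_affine_max lipschitz_on_continuous_on lipschitz_on_max) auto
      show "?s x \<le> \<delta>" for x using s T\<delta> by simp
      fix x assume x: "\<bar>\<nu> \<bullet> x\<bar> \<le> real (Suc N) * \<delta>"
      consider "\<bar>\<nu> \<bullet> x\<bar> \<le> real N * \<delta>" | "real N * \<delta> \<le> \<nu> \<bullet> x" | "\<nu> \<bullet> x \<le> - (real N * \<delta>)" by linarith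
      then show "0 \<le> ?s x"
      proof cases
        case 1 then show ?thesis using s by (simp add: le_max_iff_disj)
      next
        case 2 then show ?thesis using T0[of "real N" x] x by (simp add: algebra_simps le_max_iff_disj)
      next
        case 3 then show ?thesis using T0[of "- real N - 1" x] x by (simp add: algebra_simps le_max_iff_disj)
      qed
    qed
  qed
qed

lemma open_inner_compact:
  fixes \<Omega> :: "'a::euclidean_space set"
  assumes "open \<Omega>" "bounded \<Omega>" "\<eta> > 0"
  obtains C where "compact C" "C \<subseteq> \<Omega>" "measure lebesgue (\<Omega> - C) < \<eta>"
proof -
  have "\<Omega> \<in> sets lebesgue" using assms by auto
  then obtain C where C: "closed C" "C \<subseteq> \<Omega>" "\<Omega> - C \<in> lmeasurable" "emeasure lebesgue (\<Omega> - C) < ennreal \<eta>"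
    using sets_lebesgue_inner_closed assms by blast
  have "compact C" using C assms bounded_subset compact_eq_bounded_closed by blast
  moreover have "measure lebesgue (\<Omega> - C) < \<eta>"
    using C assms(3) by (metis emeasure_eq_measure2 ennreal_less_iff measure_nonneg)
  ultimately show ?thesis using C that by blast
qed

section \<open>Simple laminates\<close>

lemma compact_positive_lower_bound:
  fixes f :: "'a::topological_space \<Rightarrow> real"
  assumes "compact C" "continuous_on C f" "\<And>x. x \<in> C \<Longrightarrow> 0 < f x"
  obtains m where "m > 0" "\<And>x. x \<in> C \<Longrightarrow> m \<le> f x"
proof (cases "C = {}")
  case True then show ?thesis using that[of 1] by auto
next
  case False
  then obtain x where "x \<in> C" "\<forall>y\<in>C. f x \<le> f y" using continuous_attains_inf assms by blast
  then show ?thesis using that[of "f x"] assms(3) by auto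
qed

lemma sets_aff_at: "{x. aff_at f D x} \<in> sets lebesgue"
  using borel_open[OF open_aff_at[of f D]] by (intro sets_completionI_sets) simp

text \<open>A sawtooth has the right gradients but no compact support. It is truncated from above by
  a cutoff \<open>e\<close> of slope at most \<open>\<eta>\<close>. On a compact set that nearly
  fills \<Omega> the teeth stay below \<open>e\<close> and keep their gradients; in the boundary
  layer the truncation adds only gradients of size at most \<open>\<eta>\<close>. This smallness is
  what later keeps the perturbed gradient inside \<open>U\<close>.\<close>

lemma laminate_function_aux:
  fixes \<nu> :: "'a::euclidean_space"
  assumes \<Omega>: "open \<Omega>" "bounded \<Omega>" and t: "0 < t" "t < 1" and \<eta>: "\<eta> > 0"
  defines "D\<^sub>1 \<equiv> (\<lambda>h. (1 - t) * (\<nu> \<bullet> h))" and "D\<^sub>2 \<equiv> (\<lambda>h. - t * (\<nu> \<bullet> h))"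
  obtains \<psi> L where "L-lipschitz_on UNIV \<psi>" "cpt_supp \<psi> \<Omega>" "\<And>x. 0 \<le> \<psi> x" "\<And>x. \<psi> x \<le> \<eta>"
    "pw_affine ({D\<^sub>1, D\<^sub>2} \<union> {D. \<forall>h. \<bar>D h\<bar> \<le> \<eta> * norm h}) \<psi>"
    "measure lebesgue (\<Omega> - {x. aff_at \<psi> D\<^sub>1 x} - {x. aff_at \<psi> D\<^sub>2 x}) \<le> \<eta>"
proof -
  obtain C where C: "compact C" "C \<subseteq> \<Omega>" "measure lebesgue (\<Omega> - C) < \<eta>"
    using open_inner_compact[OF \<Omega> \<eta>] by blast
  obtain d L where d: "L-lipschitz_on UNIV d" "pw_affine UNIV d" "\<And>x. 0 \<le> d x"
    "cpt_supp d \<Omega>" "\<And>x. x \<in> C \<Longrightarrow> 0 < (d x :: real)"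
    by (rule cutoff_function[OF \<Omega>(1) C(1,2)]) (rule that; assumption)
  have L0: "0 \<le> L" using d(1) lipschitz_on_nonneg by blast
  \<comment> \<open>Scales the cutoff \<open>d\<close>, whose Lipschitz constant is
    \<open>L\<close>, down to slope at most \<open>\<eta>\<close>; the summand 1 covers
    \<open>L = 0\<close>.\<close>
  define \<kappa> where "\<kappa> = \<eta> / (L + 1)"
  have \<kappa>: "\<kappa> > 0" "\<kappa> * L \<le> \<eta>" using \<eta> L0 by (auto simp: \<kappa>_def field_simps)
  obtain m where m: "m > 0" "\<And>x. x \<in> C \<Longrightarrow> m \<le> d x"
    using compact_positive_lower_bound[OF C(1) continuous_on_subset[OF lipschitz_on_continuous_on[OF d(1)]] d(5)] by auto
  \<comment> \<open>Teeth of height at most \<open>\<delta>\<close> lie strictly below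
    \<open>\<kappa> * m\<close>, the lower bound of \<open>e\<close> on \<open>C\<close>, and also
    respect the sup bound \<open>\<eta>\<close>.\<close>
  define \<delta> where "\<delta> = min \<eta> (\<kappa> * m / 2)"
  have \<delta>: "\<delta> > 0" "\<delta> \<le> \<eta>" "\<delta> < \<kappa> * m" using \<eta> \<kappa> m by (auto simp: \<delta>_def min_def)
  obtain B where B: "\<And>x. x \<in> \<Omega> \<Longrightarrow> norm x \<le> B" using \<Omega>(2) by (auto simp: bounded_iff)
  \<comment> \<open>Enough teeth for the slab to contain \<Omega>, so that the sawtooth is
    nonnegative there.\<close>
  obtain N :: nat where N: "norm \<nu> * \<bar>B\<bar> / \<delta> \<le> real N" using real_arch_simple by blast
  obtain s where s: "(norm \<nu>)-lipschitz_on UNIV s" "pw_affine {D\<^sub>1, D\<^sub>2} s" "\<And>x. s x \<le> \<delta>"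
      "\<And>x. \<bar>\<nu> \<bullet> x\<bar> \<le> real N * \<delta> \<Longrightarrow> 0 \<le> s x"
    using sawtooth_function[OF t \<delta>(1), of \<nu> N] unfolding D\<^sub>1_def D\<^sub>2_def by blast
  have s0: "0 \<le> s x" if "x \<in> \<Omega>" for x
  proof (rule s(4))
    have "\<bar>\<nu> \<bullet> x\<bar> \<le> norm \<nu> * norm x" by (rule Cauchy_Schwarz_ineq2)
    also have "\<dots> \<le> norm \<nu> * \<bar>B\<bar>" using B[OF that] by (intro mult_left_mono) auto
    also have "\<dots> \<le> real N * \<delta>" using N \<delta>(1) by (simp add: field_simps)
    finally show "\<bar>\<nu> \<bullet> x\<bar> \<le> real N * \<delta>" .
  qed
  let ?\<Gamma> = "{D\<^sub>1, D\<^sub>2} \<union> {D. \<forall>h. \<bar>D h\<bar> \<le> \<eta> * norm h}"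
  define e where "e = (\<lambda>x. \<kappa> * d x)"
  have el: "\<eta>-lipschitz_on UNIV e"
    unfolding e_def using lipschitz_on_mono[OF lipschitz_on_cmult_real_nonneg[OF d(1), of \<kappa>]] \<kappa> by auto
  have e1: "pw_affine UNIV e" unfolding e_def
    by (rule pw_affine_compose[OF d(2)]) (auto intro: linearI simp: algebra_simps)
  have "negligible {x. \<not> (\<exists>D\<in>?\<Gamma>. aff_at e D x)}"
  proof (rule negligible_subset)
    show "negligible {x. \<not> (\<exists>D\<in>UNIV. aff_at e D x)}" using e1 unfolding pw_affine_def .
    have "\<And>D x. aff_at e D x \<Longrightarrow> D \<in> ?\<Gamma>" using aff_at_bound[OF el] by auto
    then show "{x. \<not> (\<exists>D\<in>?\<Gamma>. aff_at e D x)} \<subseteq> {x. \<not> (\<exists>D\<in>UNIV. aff_at e D x)}" by blast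
  qed
  then have ep: "pw_affine ?\<Gamma> e" unfolding pw_affine_def .
  have z\<Gamma>: "(\<lambda>h. 0) \<in> ?\<Gamma>" using \<eta> by auto
  \<comment> \<open>Outside \<Omega> the sawtooth may be negative. Since \<open>e\<close> vanishes
    wherever \<open>d\<close> does, the maximum with 0 gives \<open>\<psi>\<close> the support of
    the cutoff.\<close>
  define \<psi> where "\<psi> = (\<lambda>x. max 0 (min (s x) (e x)))"
  define M where "M = max (norm \<nu>) \<eta>"
  have M: "norm \<nu> \<le> M" "\<eta> \<le> M" "0 \<le> M" using \<eta> by (auto simp: M_def)
  have \<psi>l: "M-lipschitz_on UNIV \<psi>" unfolding \<psi>_def
    by (intro lipschitz_on_max lipschitz_on_min lipschitz_on_mono[OF s(1)] lipschitz_on_mono[OF el]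
        lipschitz_on_mono[OF lipschitz_on_constant]) (use M in auto)
  show ?thesis
  proof (rule that[OF \<psi>l])
    obtain K where K: "compact K" "K \<subseteq> \<Omega>" "\<And>x. d x \<noteq> 0 \<Longrightarrow> x \<in> K" by (rule cpt_suppE[OF d(4)]) (rule that; assumption)
    show "cpt_supp \<psi> \<Omega>"
    proof (rule cpt_suppI[OF K(1,2)])
      fix x assume "\<psi> x \<noteq> 0"
      then have "d x \<noteq> 0" by (auto simp: \<psi>_def e_def min_def max_def split: if_splits)
      then show "x \<in> K" by (rule K(3))
    qed
    show "0 \<le> \<psi> x" for x by (simp add: \<psi>_def)
    show "\<psi> x \<le> \<eta>" for x using s(3)[of x] \<delta> \<eta> by (simp add: \<psi>_def min_le_iff_disj)
    show "pw_affine ?\<Gamma> \<psi>" unfolding \<psi>_def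
      by (intro pw_affine_max pw_affine_min pw_affine_const ep z\<Gamma> pw_affine_mono[OF s(2)] continuous_intros
         lipschitz_on_continuous_on[OF s(1)] lipschitz_on_continuous_on[OF el]) auto
    let ?Z = "{x. \<not> (\<exists>D\<in>{D\<^sub>1, D\<^sub>2}. aff_at s D x)}"
    have nZ: "negligible ?Z" using s(2) unfolding pw_affine_def .
    have sub: "\<Omega> - {x. aff_at \<psi> D\<^sub>1 x} - {x. aff_at \<psi> D\<^sub>2 x} \<subseteq> (\<Omega> - C) \<union> ?Z"
    proof (rule ccontr)
      assume "\<not> ?thesis"
      then obtain x where x: "x \<in> C" "\<not> aff_at \<psi> D\<^sub>1 x" "\<not> aff_at \<psi> D\<^sub>2 x" "x \<notin> ?Z" by auto
      then obtain D where D: "D \<in> {D\<^sub>1, D\<^sub>2}" "aff_at s D x" by auto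
      have o: "open (\<Omega> \<inter> {y. s y < e y})"
        using \<Omega> lipschitz_on_continuous_on[OF s(1)] lipschitz_on_continuous_on[OF el] by (intro open_Int open_Collect_less) auto
      have "s x \<le> \<delta>" by (rule s(3))
      also have "\<dots> < \<kappa> * m" by (rule \<delta>)
      also have "\<dots> \<le> e x" unfolding e_def using m(2)[OF x(1)] \<kappa> by simp
      finally have xe: "x \<in> \<Omega> \<inter> {y. s y < e y}" using x(1) C by auto
      have "aff_at \<psi> D x"
        by (rule aff_at_cong[OF D(2) o xe]) (use s0 in \<open>auto simp: \<psi>_def\<close>)
      then show False using D x by auto
    qed
    have m1: "\<Omega> \<in> lmeasurable" using \<Omega> by (simp add: lmeasurable_open)
    have mC: "\<Omega> - C \<in> lmeasurable" using m1 lmeasurable_compact[OF C(1)] by (simp add: fmeasurable.Diff)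
    then have m2: "(\<Omega> - C) \<union> ?Z \<in> lmeasurable"
      using negligible_imp_measurable[OF nZ] by (rule fmeasurable.Un)
    have m3: "\<Omega> - {x. aff_at \<psi> D\<^sub>1 x} - {x. aff_at \<psi> D\<^sub>2 x} \<in> sets lebesgue"
      using \<Omega> by (intro sets.Diff sets_aff_at) auto
    have "measure lebesgue (\<Omega> - {x. aff_at \<psi> D\<^sub>1 x} - {x. aff_at \<psi> D\<^sub>2 x}) \<le> measure lebesgue ((\<Omega> - C) \<union> ?Z)"
      by (rule measure_mono_fmeasurable[OF sub m3 m2])
    also have "\<dots> = measure lebesgue (\<Omega> - C)"
      using nZ mC by (intro measure_negligible_symdiff) (auto intro: negligible_subset)
    also have "\<dots> < \<eta>" by (rule C)
    finally show "measure lebesgue (\<Omega> - {x. aff_at \<psi> D\<^sub>1 x} - {x. aff_at \<psi> D\<^sub>2 x}) \<le> \<eta>" by simp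
  qed
qed

text \<open>The volume fractions of the two gradients come for free: the integral of the gradient of \<open>\<psi>\<close> vanishes
  because \<open>\<psi>\<close> has compact support.\<close>

lemma laminate_function:
  fixes \<nu> :: "'a::euclidean_space"
  assumes \<Omega>: "open \<Omega>" "bounded \<Omega>" and t: "0 < t" "t < 1" and \<eta>: "\<eta> > 0" and \<nu>: "\<nu> \<noteq> 0"
  defines "D\<^sub>1 \<equiv> (\<lambda>h. (1 - t) * (\<nu> \<bullet> h))" and "D\<^sub>2 \<equiv> (\<lambda>h. - t * (\<nu> \<bullet> h))"
  obtains \<psi> L where "L-lipschitz_on UNIV \<psi>" "cpt_supp \<psi> \<Omega>" "\<And>x. 0 \<le> \<psi> x" "\<And>x. \<psi> x \<le> \<eta>"
    "pw_affine ({D\<^sub>1, D\<^sub>2} \<union> {D. \<forall>h. \<bar>D h\<bar> \<le> \<eta> * norm h}) \<psi>"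
    "measure lebesgue (\<Omega> - {x. aff_at \<psi> D\<^sub>1 x} - {x. aff_at \<psi> D\<^sub>2 x}) \<le> \<eta>"
    "measure lebesgue (\<Omega> \<inter> {x. aff_at \<psi> D\<^sub>1 x}) \<le> t * measure lebesgue \<Omega> + \<eta>"
    "measure lebesgue (\<Omega> \<inter> {x. aff_at \<psi> D\<^sub>2 x}) \<le> (1 - t) * measure lebesgue \<Omega> + \<eta>"
proof -
  \<comment> \<open>The residual set has measure at most \<open>\<theta>\<close> and carries
    derivatives of size at most \<open>\<theta> * norm \<nu>\<close>. The bounds
    \<open>\<theta> \<le> 1\<close> and \<open>\<theta> \<le> \<eta> * norm \<nu>\<close> make the
    resulting error at most \<open>\<eta>\<close> times the squared norm of \<open>\<nu>\<close>, a
    factor that cancels in \<open>key\<close>.\<close>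
  define \<theta> where "\<theta> = min \<eta> (min 1 (\<eta> * norm \<nu>))"
  have \<theta>: "\<theta> > 0" "\<theta> \<le> \<eta>" "\<theta> \<le> 1" "\<theta> \<le> \<eta> * norm \<nu>" using \<eta> \<nu> by (auto simp: \<theta>_def)
  obtain \<psi> L where \<psi>: "L-lipschitz_on UNIV \<psi>" "cpt_supp \<psi> \<Omega>" "\<And>x. 0 \<le> \<psi> x" "\<And>x. \<psi> x \<le> \<theta>"
    "pw_affine ({D\<^sub>1, D\<^sub>2} \<union> {D. \<forall>h. \<bar>D h\<bar> \<le> \<theta> * norm h}) \<psi>"
    "measure lebesgue (\<Omega> - {x. aff_at \<psi> D\<^sub>1 x} - {x. aff_at \<psi> D\<^sub>2 x}) \<le> \<theta>"
    by (rule laminate_function_aux[OF \<Omega> t \<theta>(1), of \<nu>, folded D\<^sub>1_def D\<^sub>2_def]) (rule that; assumption)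
  let ?\<Gamma> = "{D\<^sub>1, D\<^sub>2} \<union> {D. \<forall>h. \<bar>D h\<bar> \<le> \<theta> * norm h}"
  define A1 where "A1 = \<Omega> \<inter> {x. aff_at \<psi> D\<^sub>1 x}"
  define A2 where "A2 = \<Omega> \<inter> {x. aff_at \<psi> D\<^sub>2 x}"
  define R where "R = \<Omega> - {x. aff_at \<psi> D\<^sub>1 x} - {x. aff_at \<psi> D\<^sub>2 x}"
  have m0: "\<Omega> \<in> lmeasurable" using \<Omega> by (simp add: lmeasurable_open)
  have mA: "A1 \<in> lmeasurable" "A2 \<in> lmeasurable" unfolding A1_def A2_def
    using \<Omega> open_aff_at by (auto intro!: lmeasurable_open bounded_Int)
  have mR: "R \<in> lmeasurable" unfolding R_def
    using m0 by (intro fmeasurable_Diff sets_aff_at)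
  have "D\<^sub>1 \<nu> \<noteq> D\<^sub>2 \<nu>" unfolding D\<^sub>1_def D\<^sub>2_def using \<nu> by (simp add: algebra_simps)
  then have D12: "D\<^sub>1 \<noteq> D\<^sub>2" by auto
  have dis: "A1 \<inter> A2 = {}" unfolding A1_def A2_def using D12 aff_at_unique by blast
  have split: "measure lebesgue \<Omega> = measure lebesgue A1 + measure lebesgue A2 + measure lebesgue R"
  proof -
    have "\<Omega> = (A1 \<union> A2) \<union> R" unfolding A1_def A2_def R_def by auto
    moreover have "measure lebesgue ((A1 \<union> A2) \<union> R) = measure lebesgue (A1 \<union> A2) + measure lebesgue R"
    proof -
      have "(A1 \<union> A2) \<inter> R = {}" by (auto simp: A1_def A2_def R_def)
      then show ?thesis using mA mR by (simp add: measure_Un3 fmeasurable.Un)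
    qed
    moreover have "measure lebesgue (A1 \<union> A2) = measure lebesgue A1 + measure lebesgue A2"
      using mA dis by (simp add: measure_Un3)
    ultimately show ?thesis by simp
  qed
  define F where "F = (\<lambda>x. frechet_derivative \<psi> (at x) \<nu>)"
  let ?n = "norm \<nu>"
  have i: "integrable lebesgue (\<lambda>x. indicator S x * c :: real)" if "S \<in> lmeasurable" for S and c :: real
    using that by (intro integrable_mult_left integrable_real_indicator) (auto simp: fmeasurable_def)
  have iv: "(LINT x|lebesgue. indicator S x * c :: real) = c * measure lebesgue S" if "S \<in> lmeasurable" for S and c :: real
    using that by (simp add: fmeasurable_def)
  obtain K where K: "compact K" "K \<subseteq> \<Omega>" "\<And>x. \<psi> x \<noteq> 0 \<Longrightarrow> x \<in> K" by (rule cpt_suppE[OF \<psi>(2)]) (rule that; assumption)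
  have bs: "bounded {x. \<psi> x \<noteq> 0}" by (rule bounded_subset[OF compact_imp_bounded[OF K(1)]]) (use K(3) in auto)
  have F0: "(LINT x|lebesgue. F x) = 0"
    unfolding F_def by (rule integral_gradient_pw_affine[OF \<psi>(1) bs \<psi>(5)])
  \<comment> \<open>The values of the derivative \<open>F\<close> in direction \<open>\<nu>\<close>
    on the two laminate sets. Since \<open>F\<close> integrates to zero, the integral of
    \<open>G\<close>, which weighs \<open>A1\<close> against \<open>A2\<close>, is controlled by the
    contribution of \<open>R\<close> alone.\<close>
  define G where "G = (\<lambda>x. indicator A1 x * ((1 - t) * ?n\<^sup>2) + indicator A2 x * (- t * ?n\<^sup>2))"
  have Gi: "integrable lebesgue G" unfolding G_def by (intro Bochner_Integration.integrable_add i mA)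
  have Gv: "(LINT x|lebesgue. G x) = (1 - t) * ?n\<^sup>2 * measure lebesgue A1 - t * ?n\<^sup>2 * measure lebesgue A2"
    unfolding G_def Bochner_Integration.integral_add[OF i[OF mA(1)] i[OF mA(2)]] iv[OF mA(1)] iv[OF mA(2)] by simp
  have ae: "AE x in lebesgue. \<bar>F x - G x\<bar> \<le> indicator R x * (\<theta> * ?n)"
    using pw_affine_AE_derivative(1)[OF \<psi>(5)]
  proof eventually_elim
    case (elim x)
    then obtain D where D: "D \<in> ?\<Gamma>" "aff_at \<psi> D x" by blast
    have FD: "F x = D \<nu>" unfolding F_def by (simp add: frechet_derivative_aff_at[OF D(2)])
    show ?case
    proof (cases "x \<in> \<Omega>")
      case False
      have "aff_at (\<lambda>x. 0::real) (\<lambda>h. 0) x" using aff_at_affine[of "\<lambda>h. 0" 0 x] linear_zero by simp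
      then have "aff_at \<psi> (\<lambda>h. 0) x"
        by (rule aff_at_cong[of _ _ _ "- K"]) (use False K compact_imp_closed in auto)
      then have "F x = 0" using FD aff_at_unique[OF D(2)] by simp
      then show ?thesis using False by (simp add: G_def A1_def A2_def R_def)
    next
      case True
      consider "D = D\<^sub>1" | "D = D\<^sub>2" | "D \<noteq> D\<^sub>1" "D \<noteq> D\<^sub>2" by blast
      then show ?thesis
      proof cases
        case 1
        then have "x \<in> A1" "x \<notin> A2" using D True dis by (auto simp: A1_def)
        then show ?thesis using FD 1 \<theta> by (auto simp: G_def D\<^sub>1_def power2_norm_eq_inner intro: mult_nonneg_nonneg)
      next
        case 2
        then have "x \<in> A2" "x \<notin> A1" using D True dis by (auto simp: A2_def)
        then show ?thesis using FD 2 \<theta> by (auto simp: G_def D\<^sub>2_def power2_norm_eq_inner intro: mult_nonneg_nonneg)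
      next
        case 3
        have "\<not> aff_at \<psi> D\<^sub>1 x" "\<not> aff_at \<psi> D\<^sub>2 x"
          using aff_at_unique[OF D(2), of D\<^sub>1] aff_at_unique[OF D(2), of D\<^sub>2] 3 by metis+
        then have "x \<notin> A1" "x \<notin> A2" "x \<in> R" using True by (simp_all add: A1_def A2_def R_def)
        moreover have "\<bar>D \<nu>\<bar> \<le> \<theta> * ?n" using D 3 by auto
        ultimately show ?thesis using FD by (auto simp: G_def)
      qed
    qed
  qed
  have Fm: "F \<in> borel_measurable lebesgue" unfolding F_def using pw_affine_borel_measurable[OF \<psi>(5), of "\<lambda>D. D \<nu>"] .
  have FG: "integrable lebesgue (\<lambda>x. F x - G x)"
    by (rule Bochner_Integration.integrable_bound[OF i[OF mR, of "\<theta> * ?n"]])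
       (use Fm Gi ae in \<open>auto elim: eventually_mono\<close>)
  then have Fi: "integrable lebesgue F" using Bochner_Integration.integrable_add[OF FG Gi] by simp
  have "\<bar>(LINT x|lebesgue. F x - G x)\<bar> \<le> (LINT x|lebesgue. \<bar>F x - G x\<bar>)"
    using integral_abs_bound .
  also have "\<dots> \<le> (LINT x|lebesgue. indicator R x * (\<theta> * ?n))"
    using FG by (intro integral_mono_AE i mR ae) auto
  also have "\<dots> = \<theta> * ?n * measure lebesgue R" using iv[OF mR] by simp
  also have "\<dots> \<le> \<theta> * ?n * \<theta>" using \<psi>(6) \<theta> unfolding R_def by (intro mult_left_mono) auto
  also have "\<dots> \<le> (\<eta> * ?n) * ?n * 1" using \<theta> \<eta> by (intro mult_mono) auto
  finally have "\<bar>LINT x|lebesgue. G x\<bar> \<le> \<eta> * ?n\<^sup>2"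
    using F0 Bochner_Integration.integral_diff[OF Fi Gi] by (simp add: power2_eq_square mult.assoc)
  then have "\<bar>((1 - t) * measure lebesgue A1 - t * measure lebesgue A2) * ?n\<^sup>2\<bar> \<le> \<eta> * ?n\<^sup>2"
    unfolding Gv by (simp add: algebra_simps)
  then have "\<bar>(1 - t) * measure lebesgue A1 - t * measure lebesgue A2\<bar> * ?n\<^sup>2 \<le> \<eta> * ?n\<^sup>2"
    by (simp add: abs_mult)
  then have key: "\<bar>(1 - t) * measure lebesgue A1 - t * measure lebesgue A2\<bar> \<le> \<eta>"
    using \<nu> by simp
  \<comment> \<open>With \<open>|.|\<close> for Lebesgue measure,
    \<open>|A1| - t |\<Omega>| = ((1 - t) |A1| - t |A2|) - t |R|\<close>, and symmetrically for
    \<open>A2\<close>. So \<open>key\<close> yields both upper bounds once the terms with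
    \<open>R\<close> are dropped.\<close>
  have tR: "0 \<le> t * measure lebesgue R" "0 \<le> (1 - t) * measure lebesgue R" using t by auto
  show ?thesis
  proof (rule that[OF \<psi>(1-3)])
    show "\<psi> x \<le> \<eta>" for x using \<psi>(4)[of x] \<theta> by simp
    have "\<theta> * norm h \<le> \<eta> * norm h" for h :: 'a using \<theta> by (intro mult_right_mono) auto
    then show "pw_affine ({D\<^sub>1, D\<^sub>2} \<union> {D. \<forall>h. \<bar>D h\<bar> \<le> \<eta> * norm h}) \<psi>"
      by (intro pw_affine_mono[OF \<psi>(5)]) (auto intro: order_trans)
    show "measure lebesgue (\<Omega> - {x. aff_at \<psi> D\<^sub>1 x} - {x. aff_at \<psi> D\<^sub>2 x}) \<le> \<eta>" using \<psi>(6) \<theta> by simp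
    show "measure lebesgue (\<Omega> \<inter> {x. aff_at \<psi> D\<^sub>1 x}) \<le> t * measure lebesgue \<Omega> + \<eta>"
      using key tR unfolding A1_def[symmetric] split by (simp add: algebra_simps abs_le_iff)
    show "measure lebesgue (\<Omega> \<inter> {x. aff_at \<psi> D\<^sub>2 x}) \<le> (1 - t) * measure lebesgue \<Omega> + \<eta>"
      using key tR unfolding A2_def[symmetric] split by (simp add: algebra_simps abs_le_iff)
  qed
qed

section \<open>Relaxation of an integrand\<close>

text \<open>Since \<open>\<Omega>\<close> is quantified inside the predicate, a laminate can be refined by inserting maps
  into the (irregular) open sets where its gradient is constant. No covering or rescaling argument is needed.\<close>

definition relaxes :: "(real^'n^'N) set \<Rightarrow> (real^'n^'N \<Rightarrow> real) \<Rightarrow> real^'n^'N \<Rightarrow> real \<Rightarrow> bool" where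
  "relaxes U g \<xi> c \<longleftrightarrow> (\<forall>\<Omega> \<epsilon>. open \<Omega> \<and> bounded \<Omega> \<and> \<epsilon> > 0 \<longrightarrow>
     (\<exists>w L. L-lipschitz_on UNIV w \<and> cpt_supp w \<Omega> \<and> (\<forall>x. norm (w x) \<le> \<epsilon>) \<and>
        pw_affine {D. \<xi> + matrix D \<in> U} w \<and>
        (LINT x|lebesgue. indicator \<Omega> x * g (\<xi> + jacobian w (at x))) \<le> c * measure lebesgue \<Omega> + \<epsilon>))"

section \<open>Jacobians of locally affine maps and integrability of the integrand\<close>

lemma jacobian_aff_at: "aff_at w D x \<Longrightarrow> jacobian w (at x) = matrix D"
  by (simp add: jacobian_def frechet_derivative_aff_at)

lemma matrix_apply_linear:
  fixes D :: "real^'n \<Rightarrow> real^'N"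
  shows "linear D \<Longrightarrow> matrix D *v h = D h"
  by (simp add: matrix_works)

lemma matrix_eq_linear:
  fixes D :: "real^'n \<Rightarrow> real^'N"
  assumes "linear D" "\<And>h. D h = M *v h"
  shows "matrix D = M"
  using assms by (simp add: matrix_eq matrix_works)

lemma norm_matrix_bound:
  fixes M :: "real^'n^'N"
  assumes "\<And>h. norm (M *v h) \<le> c * norm h" "0 \<le> c"
  shows "norm M \<le> real (CARD('N) * CARD('n)) * c"
proof -
  have e: "\<bar>M $ i $ j\<bar> \<le> c" for i j
  proof -
    have "\<bar>M $ i $ j\<bar> = \<bar>(M *v axis j 1) $ i\<bar>" by (simp add: matrix_vector_mul_component inner_axis)
    also have "\<dots> \<le> norm (M *v axis j 1)" by (rule component_le_norm_cart)
    also have "\<dots> \<le> c" using assms(1)[of "axis j 1"] by simp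
    finally show ?thesis .
  qed
  have "norm M \<le> (\<Sum>i\<in>UNIV. norm (M $ i))" by (simp add: norm_vec_def L2_set_le_sum)
  also have "\<dots> \<le> (\<Sum>i\<in>(UNIV::'N set). real CARD('n) * c)"
  proof (rule sum_mono)
    fix i
    have "norm (M $ i) \<le> (\<Sum>j\<in>UNIV. \<bar>M $ i $ j\<bar>)" by (rule norm_le_l1_cart)
    also have "\<dots> \<le> (\<Sum>j\<in>(UNIV::'n set). c)" by (intro sum_mono e)
    finally show "norm (M $ i) \<le> real CARD('n) * c" by simp
  qed
  finally show ?thesis by simp
qed

lemma integrable_pw_affine_integrand:
  fixes w :: "real^'n \<Rightarrow> real^'N"
  assumes w: "pw_affine {D. \<xi> + matrix D \<in> U} w"
    and g: "\<And>X. X \<in> U \<Longrightarrow> 0 \<le> g X" "\<And>X. X \<in> U \<Longrightarrow> g X \<le> M" and S: "S \<in> lmeasurable"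
  shows "integrable lebesgue (\<lambda>x. indicator S x * (g (\<xi> + jacobian w (at x)) :: real))"
proof (rule Bochner_Integration.integrable_bound)
  show "integrable lebesgue (\<lambda>x. indicator S x * \<bar>M\<bar>)"
    using S by (intro integrable_mult_left integrable_real_indicator) (auto simp: fmeasurable_def)
  show "(\<lambda>x. indicator S x * g (\<xi> + jacobian w (at x))) \<in> borel_measurable lebesgue"
    using S pw_affine_borel_measurable[OF w, of "\<lambda>D. g (\<xi> + matrix D)"]
    by (intro borel_measurable_times borel_measurable_indicator) (auto simp: jacobian_def)
  show "AE x in lebesgue. norm (indicator S x * g (\<xi> + jacobian w (at x))) \<le> norm (indicator S x * \<bar>M\<bar>)"
    using pw_affine_AE_derivative(1)[OF w]
  proof eventually_elim
    case (elim x)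
    then obtain D where "\<xi> + matrix D \<in> U" "jacobian w (at x) = matrix D" using jacobian_aff_at by blast
    then show ?case using g[of "\<xi> + matrix D"] by (auto simp: indicator_def)
  qed
qed

lemma relaxes_zero:
  fixes U :: "(real^'n^'N) set"
  assumes "\<xi> \<in> U"
  shows "relaxes U g \<xi> (g \<xi> :: real)"
  unfolding relaxes_def
proof (intro allI impI, elim conjE)
  fix \<Omega> :: "(real^'n) set" and \<epsilon> :: real
  assume \<Omega>: "open \<Omega>" "bounded \<Omega>" "0 < \<epsilon>"
  let ?w = "\<lambda>_::real^'n. 0::real^'N"
  have a: "aff_at ?w (\<lambda>h. 0) x" for x using aff_at_affine[of "\<lambda>h. 0" 0 x] linear_zero by simp
  have m0: "matrix (\<lambda>h::real^'n. 0::real^'N) = 0" by (rule matrix_eq_linear) (auto simp: linear_zero)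
  have j: "jacobian ?w (at x) = 0" for x using jacobian_aff_at[OF a] m0 by simp
  have "cpt_supp ?w \<Omega>" by (simp add: cpt_supp_def)
  moreover have "pw_affine {D. \<xi> + matrix D \<in> U} ?w"
    by (rule pw_affine_const) (simp add: m0 assms)
  moreover have "\<Omega> \<in> lmeasurable" using \<Omega> by (simp add: lmeasurable_open)
  ultimately show "\<exists>w L. L-lipschitz_on UNIV w \<and> cpt_supp w \<Omega> \<and> (\<forall>x. norm (w x) \<le> \<epsilon>) \<and>
        pw_affine {D. \<xi> + matrix D \<in> U} w \<and>
        (LINT x|lebesgue. indicator \<Omega> x * g (\<xi> + jacobian w (at x))) \<le> g \<xi> * measure lebesgue \<Omega> + \<epsilon>"
    using \<Omega> by (intro exI[of _ ?w] exI[of _ 0]) (auto simp: j lipschitz_on_constant fmeasurable_def mult.commute)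
qed

text \<open>Makes the admissible constants bounded below, so that their infimum is meaningful, and
  lets volume estimates be multiplied by them.\<close>

lemma relaxes_nonneg:
  fixes U :: "(real^'n^'N) set"
  assumes "relaxes U g \<xi> c" and g: "\<And>X. X \<in> U \<Longrightarrow> 0 \<le> g X"
  shows "0 \<le> c"
proof (rule ccontr)
  assume c: "\<not> 0 \<le> c"
  let ?B = "ball (0::real^'n) 1"
  have B: "0 < measure lebesgue ?B" using content_ball_pos[of 1 "0::real^'n"] by simp
  \<comment> \<open>Half of the deficit: the upper bound
    \<open>c * measure lebesgue ?B + \<epsilon>\<close> is then still negative.\<close>
  define \<epsilon> where "\<epsilon> = - c * measure lebesgue ?B / 2"
  have \<epsilon>: "\<epsilon> > 0" using c B by (simp add: \<epsilon>_def mult_neg_pos)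
  obtain w where w: "pw_affine {D. \<xi> + matrix D \<in> U} w"
     "(LINT x|lebesgue. indicator ?B x * g (\<xi> + jacobian w (at x))) \<le> c * measure lebesgue ?B + \<epsilon>"
    using assms(1)[unfolded relaxes_def, rule_format, of ?B \<epsilon>] \<epsilon> by auto
  have "0 \<le> (LINT x|lebesgue. indicator ?B x * g (\<xi> + jacobian w (at x)))"
  proof (rule integral_nonneg_AE)
    show "AE x in lebesgue. 0 \<le> indicator ?B x * g (\<xi> + jacobian w (at x))"
      using pw_affine_AE_derivative(1)[OF w(1)]
    proof eventually_elim
      case (elim x)
      then obtain D where "\<xi> + matrix D \<in> U" "jacobian w (at x) = matrix D" using jacobian_aff_at by blast
      then show ?case using g[of "\<xi> + matrix D"] by (auto simp: indicator_def)
    qed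
  qed
  then have "0 \<le> c * measure lebesgue ?B + \<epsilon>" using w(2) by linarith
  then show False using mult_neg_pos[of c "measure lebesgue ?B"] c B unfolding \<epsilon>_def by linarith
qed

text \<open>A small excess in the constant can be absorbed by the additive error, because \<Omega>
  has finite measure. Hence the infimum of the admissible constants is itself admissible.\<close>

lemma relaxes_approx:
  fixes U :: "(real^'n^'N) set"
  assumes "\<And>c'. c < c' \<Longrightarrow> relaxes U g \<xi> c'"
  shows "relaxes U g \<xi> c"
  unfolding relaxes_def
proof (intro allI impI, elim conjE)
  fix \<Omega> :: "(real^'n) set" and \<epsilon> :: real
  assume \<Omega>: "open \<Omega>" "bounded \<Omega>" "0 < \<epsilon>"
  define m where "m = measure lebesgue \<Omega>"
  have m: "0 \<le> m" by (simp add: m_def)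
  \<comment> \<open>The excess \<open>(c' - c) * m\<close> is at most \<open>\<epsilon> / 2\<close>,
    the other half being the error granted for \<open>c'\<close>; the summand 1 avoids dividing by
    zero when \<open>m = 0\<close>.\<close>
  define c' where "c' = c + \<epsilon> / (2 * (m + 1))"
  have "c < c'" using \<Omega> m by (simp add: c'_def)
  have "\<epsilon> / (2 * (m + 1)) * m \<le> \<epsilon> / 2" using \<Omega> m by (simp add: field_simps)
  then have le: "c' * m + \<epsilon> / 2 \<le> c * m + \<epsilon>" unfolding c'_def distrib_right by linarith
  obtain w L where "L-lipschitz_on UNIV w" "cpt_supp w \<Omega>" "\<forall>x. norm (w x) \<le> \<epsilon> / 2"
      "pw_affine {D. \<xi> + matrix D \<in> U} w"
      "(LINT x|lebesgue. indicator \<Omega> x * g (\<xi> + jacobian w (at x))) \<le> c' * m + \<epsilon> / 2"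
    using assms[OF \<open>c < c'\<close>, unfolded relaxes_def, rule_format, of \<Omega> "\<epsilon> / 2"] \<Omega> unfolding m_def by auto
  moreover have "\<forall>x. norm (w x) \<le> \<epsilon>"
  proof
    fix x show "norm (w x) \<le> \<epsilon>" using calculation(3)[rule_format, of x] \<Omega>(3) by simp
  qed
  ultimately show "\<exists>w L. L-lipschitz_on UNIV w \<and> cpt_supp w \<Omega> \<and> (\<forall>x. norm (w x) \<le> \<epsilon>) \<and>
        pw_affine {D. \<xi> + matrix D \<in> U} w \<and>
        (LINT x|lebesgue. indicator \<Omega> x * g (\<xi> + jacobian w (at x))) \<le> c * measure lebesgue \<Omega> + \<epsilon>"
    using le unfolding m_def by (intro exI[of _ w] exI[of _ L]) auto
qed

text \<open>The laminate \<open>w0\<close> moves the gradient from \<open>\<xi>\<close> to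
  \<open>A\<close> on \<open>A1\<close> and to \<open>B\<close> on \<open>A2\<close>; competitors
  for \<open>A\<close> and \<open>B\<close> are then inserted into these open sets. Their compact
  supports are disjoint, so near any point at most one of them is active. The volume fractions of
  the laminate supply the weights \<open>t\<close> and \<open>1 - t\<close>.\<close>

lemma relaxes_rank_one:
  fixes U :: "(real^'n^'N) set"
  assumes U: "open U" "A \<in> U" "B \<in> U" "\<xi> \<in> U"
    and g: "\<And>X. X \<in> U \<Longrightarrow> 0 \<le> g X" "\<And>X. X \<in> U \<Longrightarrow> g X \<le> M"
    and AB: "\<And>h. (A - B) *v h = (\<nu> \<bullet> h) *\<^sub>R a" "A \<noteq> B"
    and t: "0 < t" "t < 1" and \<xi>: "\<xi> = t *\<^sub>R A + (1 - t) *\<^sub>R B"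
    and r: "relaxes U g A c\<^sub>1" "relaxes U g B c\<^sub>2"
  shows "relaxes U g \<xi> (t * c\<^sub>1 + (1 - t) * c\<^sub>2)"
  unfolding relaxes_def
proof (intro allI impI, elim conjE)
  fix \<Omega> :: "(real^'n) set" and \<epsilon> :: real
  assume \<Omega>: "open \<Omega>" "bounded \<Omega>" "0 < \<epsilon>"
  \<comment> \<open>For nonnegative constants the upper bounds on the measures of \<open>A1\<close>
    and \<open>A2\<close> turn into upper bounds on the integrals.\<close>
  have c0: "0 \<le> c\<^sub>1" "0 \<le> c\<^sub>2" using relaxes_nonneg[OF r(1) g(1)] relaxes_nonneg[OF r(2) g(1)] by auto
  have M0: "0 \<le> M" using g[OF U(2)] by simp
  have \<nu>: "\<nu> \<noteq> 0"
  proof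
    assume "\<nu> = 0"
    then have "A - B = 0" using AB(1) by (intro matrix_eq[THEN iffD2]) simp
    then show False using AB(2) by simp
  qed
  define k where "k = real (CARD('N) * CARD('n))"
  obtain r where rr: "r > 0" "ball \<xi> r \<subseteq> U" using U open_contains_ball by blast
  \<comment> \<open>The three entries control, in this order, the volume errors weighted by
    \<open>c\<^sub>1\<close>, \<open>c\<^sub>2\<close> and \<open>M\<close>, the sup norm of
    \<open>w0\<close>, and the size of the boundary layer gradients, which have to stay in
    \<open>ball \<xi> r\<close>. The other half of \<open>\<epsilon>\<close> is spent on
    \<open>w1\<close> and \<open>w2\<close>.\<close>
  define \<eta> where "\<eta> = min (\<epsilon> / (2 * (c\<^sub>1 + c\<^sub>2 + M + 1))) (min (\<epsilon> / (2 * (norm a + 1))) (r / (2 * (k * norm a + 1))))"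
  have k0: "0 \<le> k * norm a" by (simp add: k_def)
  have \<eta>: "\<eta> > 0" using \<Omega> c0 M0 rr k0 norm_ge_zero[of a] by (simp add: \<eta>_def add_nonneg_pos)
  have \<eta>1: "\<eta> * (c\<^sub>1 + c\<^sub>2 + M) \<le> \<epsilon> / 2"
  proof -
    have "\<eta> * (c\<^sub>1 + c\<^sub>2 + M) \<le> \<eta> * (c\<^sub>1 + c\<^sub>2 + M + 1)" using \<eta> by simp
    also have "\<dots> \<le> \<epsilon> / (2 * (c\<^sub>1 + c\<^sub>2 + M + 1)) * (c\<^sub>1 + c\<^sub>2 + M + 1)"
      using c0 M0 by (intro mult_right_mono) (auto simp: \<eta>_def)
    also have "\<dots> = \<epsilon> / 2" using c0 M0 by (simp add: field_simps)
    finally show ?thesis .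
  qed
  have \<eta>2: "\<eta> * norm a \<le> \<epsilon> / 2"
  proof -
    have "\<eta> * norm a \<le> \<eta> * (norm a + 1)" using \<eta> by simp
    also have "\<dots> \<le> \<epsilon> / (2 * (norm a + 1)) * (norm a + 1)" by (intro mult_right_mono) (auto simp: \<eta>_def)
    also have "\<dots> = \<epsilon> / 2" using norm_ge_zero[of a] by (simp add: field_simps add_nonneg_eq_0_iff)
    finally show ?thesis .
  qed
  have \<eta>3: "k * (\<eta> * norm a) < r"
  proof -
    have "k * (\<eta> * norm a) = \<eta> * (k * norm a)" by simp
    also have "\<dots> \<le> \<eta> * (k * norm a + 1)" using \<eta> by simp
    also have "\<dots> \<le> r / (2 * (k * norm a + 1)) * (k * norm a + 1)"
      using k0 by (intro mult_right_mono) (auto simp: \<eta>_def)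
    also have "\<dots> = r / 2" using k0 by (simp add: field_simps)
    also have "\<dots> < r" using rr by simp
    finally show ?thesis .
  qed
  define D\<^sub>1 where "D\<^sub>1 = (\<lambda>h. (1 - t) * (\<nu> \<bullet> h))"
  define D\<^sub>2 where "D\<^sub>2 = (\<lambda>h. - t * (\<nu> \<bullet> h))"
  let ?\<Gamma> = "{D\<^sub>1, D\<^sub>2} \<union> {D. \<forall>h. \<bar>D h\<bar> \<le> \<eta> * norm h}"
  obtain \<psi> L where \<psi>: "L-lipschitz_on UNIV \<psi>" "cpt_supp \<psi> \<Omega>" "\<And>x. 0 \<le> \<psi> x" "\<And>x. \<psi> x \<le> \<eta>"
    "pw_affine ?\<Gamma> \<psi>"
    "measure lebesgue (\<Omega> - {x. aff_at \<psi> D\<^sub>1 x} - {x. aff_at \<psi> D\<^sub>2 x}) \<le> \<eta>"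
    "measure lebesgue (\<Omega> \<inter> {x. aff_at \<psi> D\<^sub>1 x}) \<le> t * measure lebesgue \<Omega> + \<eta>"
    "measure lebesgue (\<Omega> \<inter> {x. aff_at \<psi> D\<^sub>2 x}) \<le> (1 - t) * measure lebesgue \<Omega> + \<eta>"
    by (rule laminate_function[OF \<Omega>(1,2) t \<eta> \<nu>, folded D\<^sub>1_def D\<^sub>2_def]) (rule that; assumption)
  define A1 where "A1 = \<Omega> \<inter> {x. aff_at \<psi> D\<^sub>1 x}"
  define A2 where "A2 = \<Omega> \<inter> {x. aff_at \<psi> D\<^sub>2 x}"
  define R where "R = \<Omega> - {x. aff_at \<psi> D\<^sub>1 x} - {x. aff_at \<psi> D\<^sub>2 x}"
  have A12: "open A1" "bounded A1" "open A2" "bounded A2"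
    using \<Omega> open_aff_at by (auto simp: A1_def A2_def bounded_Int intro!: open_Int)
  have "D\<^sub>1 \<nu> \<noteq> D\<^sub>2 \<nu>" unfolding D\<^sub>1_def D\<^sub>2_def using \<nu> by (simp add: algebra_simps)
  then have D12: "D\<^sub>1 \<noteq> D\<^sub>2" by auto
  have dis: "A1 \<inter> A2 = {}" unfolding A1_def A2_def using D12 aff_at_unique by blast
  have \<epsilon>4: "\<epsilon> / 4 > 0" using \<Omega> by simp
  obtain w1 L1 where w1: "L1-lipschitz_on UNIV w1" "cpt_supp w1 A1" "\<And>x. norm (w1 x) \<le> \<epsilon> / 4"
      "pw_affine {D. A + matrix D \<in> U} w1"
      "(LINT x|lebesgue. indicator A1 x * g (A + jacobian w1 (at x))) \<le> c\<^sub>1 * measure lebesgue A1 + \<epsilon> / 4"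
    using r(1)[unfolded relaxes_def, rule_format, of A1 "\<epsilon> / 4"] A12 \<epsilon>4 by auto
  obtain w2 L2 where w2: "L2-lipschitz_on UNIV w2" "cpt_supp w2 A2" "\<And>x. norm (w2 x) \<le> \<epsilon> / 4"
      "pw_affine {D. B + matrix D \<in> U} w2"
      "(LINT x|lebesgue. indicator A2 x * g (B + jacobian w2 (at x))) \<le> c\<^sub>2 * measure lebesgue A2 + \<epsilon> / 4"
    using r(2)[unfolded relaxes_def, rule_format, of A2 "\<epsilon> / 4"] A12 \<epsilon>4 by auto
  obtain K where K: "compact K" "K \<subseteq> \<Omega>" "\<And>x. \<psi> x \<noteq> 0 \<Longrightarrow> x \<in> K" by (rule cpt_suppE[OF \<psi>(2)]) (rule that; assumption)
  obtain K1 where K1: "compact K1" "K1 \<subseteq> A1" "\<And>x. w1 x \<noteq> 0 \<Longrightarrow> x \<in> K1" by (rule cpt_suppE[OF w1(2)]) (rule that; assumption)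
  obtain K2 where K2: "compact K2" "K2 \<subseteq> A2" "\<And>x. w2 x \<noteq> 0 \<Longrightarrow> x \<in> K2" by (rule cpt_suppE[OF w2(2)]) (rule that; assumption)
  define w0 where "w0 = (\<lambda>x. \<psi> x *\<^sub>R a)"
  define w where "w = (\<lambda>x. w0 x + w1 x + w2 x)"
  have lin_a: "linear (\<lambda>s::real. s *\<^sub>R a)" by (auto intro: linearI simp: algebra_simps)
  have w0_aff: "aff_at w0 (\<lambda>h. D h *\<^sub>R a) x" if "aff_at \<psi> D x" for D x
    unfolding w0_def by (rule aff_at_compose[OF that lin_a])
  have w0l: "(norm a * L)-lipschitz_on UNIV w0"
  proof (rule lipschitz_onI)
    show "0 \<le> norm a * L" using \<psi>(1) lipschitz_on_nonneg by (metis mult_nonneg_nonneg norm_ge_zero)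
    fix x y
    have "dist (w0 x) (w0 y) = norm a * dist (\<psi> x) (\<psi> y)"
      by (simp add: w0_def dist_norm scaleR_diff_left[symmetric] mult.commute)
    also have "\<dots> \<le> norm a * (L * dist x y)" using lipschitz_onD[OF \<psi>(1)] by (intro mult_left_mono) auto
    finally show "dist (w0 x) (w0 y) \<le> norm a * L * dist x y" by simp
  qed
  \<comment> \<open>The support of \<open>w2\<close> lies in a compact subset of \<open>A2\<close>,
    which is disjoint from \<open>A1\<close>; hence \<open>w2\<close> vanishes in a whole
    neighbourhood of \<open>x\<close>, not only at \<open>x\<close>.\<close>
  have claim1: "aff_at w (\<lambda>h. D\<^sub>1 h *\<^sub>R a + E h) x" if x: "x \<in> A1" and E: "aff_at w1 E x" for x E
  proof -
    have "aff_at (\<lambda>y. w0 y + w1 y) (\<lambda>h. D\<^sub>1 h *\<^sub>R a + E h) x"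
      using x by (intro aff_at_add w0_aff E) (auto simp: A1_def)
    then show ?thesis
    proof (rule aff_at_cong)
      show "open (- K2)" using K2(1) compact_imp_closed by blast
      show "x \<in> - K2" using x dis K2(2) by blast
      show "y \<in> - K2 \<Longrightarrow> w y = w0 y + w1 y" for y using K2(3)[of y] by (auto simp: w_def)
    qed
  qed
  have claim2: "aff_at w (\<lambda>h. D\<^sub>2 h *\<^sub>R a + E h) x" if x: "x \<in> A2" and E: "aff_at w2 E x" for x E
  proof -
    have "aff_at (\<lambda>y. w0 y + w2 y) (\<lambda>h. D\<^sub>2 h *\<^sub>R a + E h) x"
      using x by (intro aff_at_add w0_aff E) (auto simp: A2_def)
    then show ?thesis
    proof (rule aff_at_cong)
      show "open (- K1)" using K1(1) compact_imp_closed by blast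
      show "x \<in> - K1" using x dis K1(2) by blast
      show "y \<in> - K1 \<Longrightarrow> w y = w0 y + w2 y" for y using K1(3)[of y] by (auto simp: w_def)
    qed
  qed
  have claim3: "aff_at w (\<lambda>h. D h *\<^sub>R a) x" if x: "x \<notin> A1" "x \<notin> A2" and D: "aff_at \<psi> D x" for x D
  proof (rule aff_at_cong[OF w0_aff[OF D]])
    show "open (- K1 \<inter> - K2)" using K1(1) K2(1) compact_imp_closed by blast
    show "x \<in> - K1 \<inter> - K2" using x K1(2) K2(2) by blast
    show "y \<in> - K1 \<inter> - K2 \<Longrightarrow> w y = w0 y" for y using K1(3)[of y] K2(3)[of y] by (cases "w1 y = 0"; cases "w2 y = 0") (auto simp: w_def)
  qed
  have mA: "\<xi> + matrix (\<lambda>h. D\<^sub>1 h *\<^sub>R a + E h) = A + matrix E" if E: "linear E" for E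
  proof -
    have "matrix (\<lambda>h. D\<^sub>1 h *\<^sub>R a + E h) = (1 - t) *\<^sub>R (A - B) + matrix E"
    proof (rule matrix_eq_linear)
      show "linear (\<lambda>h. D\<^sub>1 h *\<^sub>R a + E h)"
        using E by (intro linear_compose_add) (auto intro!: linearI simp: D\<^sub>1_def inner_add_right algebra_simps)
      show "D\<^sub>1 h *\<^sub>R a + E h = ((1 - t) *\<^sub>R (A - B) + matrix E) *v h" for h
        by (simp only: matrix_vector_mult_add_rdistrib scaleR_matrix_vector_assoc[symmetric] AB(1) matrix_apply_linear[OF E] D\<^sub>1_def scaleR_scaleR)
    qed
    moreover have "\<xi> + (1 - t) *\<^sub>R (A - B) = A" using \<xi> by (simp add: algebra_simps)
    ultimately show ?thesis by (metis add.assoc)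
  qed
  have mB: "\<xi> + matrix (\<lambda>h. D\<^sub>2 h *\<^sub>R a + E h) = B + matrix E" if E: "linear E" for E
  proof -
    have "matrix (\<lambda>h. D\<^sub>2 h *\<^sub>R a + E h) = (- t) *\<^sub>R (A - B) + matrix E"
    proof (rule matrix_eq_linear)
      show "linear (\<lambda>h. D\<^sub>2 h *\<^sub>R a + E h)"
        using E by (intro linear_compose_add) (auto intro!: linearI simp: D\<^sub>2_def inner_add_right algebra_simps)
      show "D\<^sub>2 h *\<^sub>R a + E h = ((- t) *\<^sub>R (A - B) + matrix E) *v h" for h
        by (simp only: matrix_vector_mult_add_rdistrib scaleR_matrix_vector_assoc[symmetric] AB(1) matrix_apply_linear[OF E] D\<^sub>2_def scaleR_scaleR)
    qed
    moreover have "\<xi> + (- t) *\<^sub>R (A - B) = B" using \<xi> by (simp add: algebra_simps)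
    ultimately show ?thesis by (metis add.assoc)
  qed
  \<comment> \<open>Where neither inserted map is active the gradient is one of the laminate:
    \<open>A\<close>, \<open>B\<close>, or a matrix so close to \<open>\<xi>\<close> that openness
    of \<open>U\<close> applies.\<close>
  have mR: "\<xi> + matrix (\<lambda>h. D h *\<^sub>R a) \<in> U" if D\<Gamma>: "D \<in> ?\<Gamma>" and Dl: "linear D" for D
  proof -
    have m0: "matrix (\<lambda>h::real^'n. 0::real^'N) = 0" by (rule matrix_eq_linear) (auto simp: linear_zero)
    consider "D = D\<^sub>1" | "D = D\<^sub>2" | "\<forall>h. \<bar>D h\<bar> \<le> \<eta> * norm h" using D\<Gamma> by blast
    then show ?thesis
    proof cases
      case 1 then show ?thesis using mA[of "\<lambda>h. 0"] U m0 linear_zero by auto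
    next
      case 2 then show ?thesis using mB[of "\<lambda>h. 0"] U m0 linear_zero by auto
    next
      case 3
      have l: "linear (\<lambda>h. D h *\<^sub>R a)" using linear_compose[OF Dl lin_a] by (simp add: o_def)
      have "norm (matrix (\<lambda>h. D h *\<^sub>R a)) \<le> k * (\<eta> * norm a)"
        unfolding k_def
      proof (rule norm_matrix_bound)
        show "0 \<le> \<eta> * norm a" using \<eta> by simp
        fix h
        have "norm (matrix (\<lambda>h. D h *\<^sub>R a) *v h) = \<bar>D h\<bar> * norm a" by (simp add: matrix_apply_linear[OF l])
        also have "\<dots> \<le> (\<eta> * norm h) * norm a" using 3 by (intro mult_right_mono) auto
        finally show "norm (matrix (\<lambda>h. D h *\<^sub>R a) *v h) \<le> \<eta> * norm a * norm h" by (simp add: mult_ac)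
      qed
      then have "\<xi> + matrix (\<lambda>h. D h *\<^sub>R a) \<in> ball \<xi> r" using \<eta>3 by (simp add: dist_norm)
      then show ?thesis using rr by blast
    qed
  qed
  have wp: "pw_affine {D. \<xi> + matrix D \<in> U} w"
  proof -
    have "negligible ({x. \<not> (\<exists>D\<in>?\<Gamma>. aff_at \<psi> D x)} \<union> {x. \<not> (\<exists>D\<in>{D. A + matrix D \<in> U}. aff_at w1 D x)} \<union>
        {x. \<not> (\<exists>D\<in>{D. B + matrix D \<in> U}. aff_at w2 D x)})"
      using \<psi>(5) w1(4) w2(4) unfolding pw_affine_def by (intro negligible_Un)
    moreover have "{x. \<not> (\<exists>D\<in>{D. \<xi> + matrix D \<in> U}. aff_at w D x)} \<subseteq>
       ({x. \<not> (\<exists>D\<in>?\<Gamma>. aff_at \<psi> D x)} \<union> {x. \<not> (\<exists>D\<in>{D. A + matrix D \<in> U}. aff_at w1 D x)} \<union>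
        {x. \<not> (\<exists>D\<in>{D. B + matrix D \<in> U}. aff_at w2 D x)})"
    proof (rule subsetI, rule ccontr)
      fix x assume n: "x \<in> {x. \<not> (\<exists>D\<in>{D. \<xi> + matrix D \<in> U}. aff_at w D x)}"
        and "x \<notin> {x. \<not> (\<exists>D\<in>?\<Gamma>. aff_at \<psi> D x)} \<union> {x. \<not> (\<exists>D\<in>{D. A + matrix D \<in> U}. aff_at w1 D x)} \<union>
        {x. \<not> (\<exists>D\<in>{D. B + matrix D \<in> U}. aff_at w2 D x)}"
      then obtain D E1 E2 where D: "D \<in> ?\<Gamma>" "aff_at \<psi> D x" and E1: "A + matrix E1 \<in> U" "aff_at w1 E1 x"
        and E2: "B + matrix E2 \<in> U" "aff_at w2 E2 x" by blast
      have "\<exists>D. \<xi> + matrix D \<in> U \<and> aff_at w D x"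
      proof (cases "x \<in> A1")
        case True
        show ?thesis using claim1[OF True E1(2)] mA[OF aff_at_linear[OF E1(2)]] E1(1) by metis
      next
        case F1: False
        show ?thesis
        proof (cases "x \<in> A2")
          case True
          show ?thesis using claim2[OF True E2(2)] mB[OF aff_at_linear[OF E2(2)]] E2(1) by metis
        next
          case False
          show ?thesis using claim3[OF F1 False D(2)] mR[OF D(1) aff_at_linear[OF D(2)]] by blast
        qed
      qed
      then show False using n by blast
    qed
    ultimately show ?thesis unfolding pw_affine_def by (rule negligible_subset)
  qed
  have ml: "\<Omega> \<in> lmeasurable" "A1 \<in> lmeasurable" "A2 \<in> lmeasurable" using \<Omega> A12 by (auto intro: lmeasurable_open)
  have mR': "R \<in> lmeasurable" unfolding R_def using ml(1) by (intro fmeasurable_Diff sets_aff_at)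
  have i0: "integrable lebesgue (\<lambda>x. indicator R x * M)"
    using mR' by (intro integrable_mult_left integrable_real_indicator) (auto simp: fmeasurable_def)
  have i1: "integrable lebesgue (\<lambda>x. indicator A1 x * g (A + jacobian w1 (at x)))"
    by (rule integrable_pw_affine_integrand[OF w1(4) g ml(2)])
  have i2: "integrable lebesgue (\<lambda>x. indicator A2 x * g (B + jacobian w2 (at x)))"
    by (rule integrable_pw_affine_integrand[OF w2(4) g ml(3)])
  \<comment> \<open>Up to a null set the integrand is that of the inserted maps on \<open>A1\<close>
    and \<open>A2\<close>. On the remainder \<open>R\<close> only the bound \<open>M\<close> is
    available, which is harmless since \<open>R\<close> has measure at most
    \<open>\<eta>\<close>.\<close>
  have "(LINT x|lebesgue. indicator \<Omega> x * g (\<xi> + jacobian w (at x))) \<le>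
     (LINT x|lebesgue. (indicator A1 x * g (A + jacobian w1 (at x)) + indicator A2 x * g (B + jacobian w2 (at x))) + indicator R x * M)"
  proof (rule integral_mono_AE)
    show "integrable lebesgue (\<lambda>x. indicator \<Omega> x * g (\<xi> + jacobian w (at x)))"
      by (rule integrable_pw_affine_integrand[OF wp g ml(1)])
    show "integrable lebesgue (\<lambda>x. (indicator A1 x * g (A + jacobian w1 (at x)) + indicator A2 x * g (B + jacobian w2 (at x))) + indicator R x * M)"
      by (intro Bochner_Integration.integrable_add i0 i1 i2)
    show "AE x in lebesgue. indicator \<Omega> x * g (\<xi> + jacobian w (at x)) \<le>
      (indicator A1 x * g (A + jacobian w1 (at x)) + indicator A2 x * g (B + jacobian w2 (at x))) + indicator R x * M"
      using pw_affine_AE_derivative(1)[OF wp] pw_affine_AE_derivative(1)[OF w1(4)] pw_affine_AE_derivative(1)[OF w2(4)]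
    proof eventually_elim
      case (elim x)
      obtain D where D: "\<xi> + matrix D \<in> U" "aff_at w D x" using elim by blast
      obtain E1 where E1: "A + matrix E1 \<in> U" "aff_at w1 E1 x" using elim by blast
      obtain E2 where E2: "B + matrix E2 \<in> U" "aff_at w2 E2 x" using elim by blast
      consider "x \<notin> \<Omega>" | "x \<in> A1" | "x \<in> A2" | "x \<in> R" unfolding A1_def A2_def R_def by blast
      then show ?case
      proof cases
        case 1
        then show ?thesis by (simp add: A1_def A2_def R_def)
      next
        case 2
        have "\<xi> + jacobian w (at x) = A + jacobian w1 (at x)"
          using jacobian_aff_at[OF claim1[OF 2 E1(2)]] mA[OF aff_at_linear[OF E1(2)]] jacobian_aff_at[OF E1(2)] by simp
        moreover have "x \<notin> A2" "x \<notin> R" using 2 dis by (auto simp: A1_def R_def)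
        ultimately show ?thesis using 2 by (simp add: A1_def)
      next
        case 3
        have "\<xi> + jacobian w (at x) = B + jacobian w2 (at x)"
          using jacobian_aff_at[OF claim2[OF 3 E2(2)]] mB[OF aff_at_linear[OF E2(2)]] jacobian_aff_at[OF E2(2)] by simp
        moreover have "x \<notin> A1" "x \<notin> R" using 3 dis by (auto simp: A2_def R_def)
        ultimately show ?thesis using 3 by (simp add: A2_def)
      next
        case 4
        then have "x \<in> \<Omega>" "x \<notin> A1" "x \<notin> A2" by (auto simp: A1_def A2_def R_def)
        then show ?thesis using 4 g(2)[OF D(1)] jacobian_aff_at[OF D(2)] by simp
      qed
    qed
  qed
  also have "\<dots> = (LINT x|lebesgue. indicator A1 x * g (A + jacobian w1 (at x))) + (LINT x|lebesgue. indicator A2 x * g (B + jacobian w2 (at x)))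
      + (LINT x|lebesgue. indicator R x * M)"
    by (rule trans[OF Bochner_Integration.integral_add[OF Bochner_Integration.integrable_add[OF i1 i2] i0]])
       (simp only: Bochner_Integration.integral_add[OF i1 i2])
  also have "(LINT x|lebesgue. indicator R x * M) = M * measure lebesgue R" using mR' by (simp add: fmeasurable_def)
  finally have val: "(LINT x|lebesgue. indicator \<Omega> x * g (\<xi> + jacobian w (at x))) \<le>
      (c\<^sub>1 * measure lebesgue A1 + \<epsilon> / 4) + (c\<^sub>2 * measure lebesgue A2 + \<epsilon> / 4) + M * measure lebesgue R"
    using w1(5) w2(5) by linarith
  have "c\<^sub>1 * measure lebesgue A1 \<le> c\<^sub>1 * (t * measure lebesgue \<Omega> + \<eta>)"
    using \<psi>(7) c0 unfolding A1_def by (intro mult_left_mono)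
  moreover have "c\<^sub>2 * measure lebesgue A2 \<le> c\<^sub>2 * ((1 - t) * measure lebesgue \<Omega> + \<eta>)"
    using \<psi>(8) c0 unfolding A2_def by (intro mult_left_mono)
  moreover have "M * measure lebesgue R \<le> M * \<eta>" using \<psi>(6) M0 unfolding R_def by (intro mult_left_mono)
  ultimately have "(LINT x|lebesgue. indicator \<Omega> x * g (\<xi> + jacobian w (at x))) \<le>
     (t * c\<^sub>1 + (1 - t) * c\<^sub>2) * measure lebesgue \<Omega> + (\<eta> * (c\<^sub>1 + c\<^sub>2 + M) + \<epsilon> / 2)"
    using val by (simp add: algebra_simps)
  then have v: "(LINT x|lebesgue. indicator \<Omega> x * g (\<xi> + jacobian w (at x))) \<le>
     (t * c\<^sub>1 + (1 - t) * c\<^sub>2) * measure lebesgue \<Omega> + \<epsilon>" using \<eta>1 by linarith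
  have wl: "(norm a * L + L1 + L2)-lipschitz_on UNIV w" unfolding w_def
    by (intro lipschitz_on_add w0l w1(1) w2(1))
  have wc: "cpt_supp w \<Omega>"
  proof (rule cpt_suppI)
    show "compact (K \<union> K1 \<union> K2)" using K K1 K2 by (intro compact_Un)
    show "K \<union> K1 \<union> K2 \<subseteq> \<Omega>" using K(2) K1(2) K2(2) by (auto simp: A1_def A2_def)
    fix x assume "w x \<noteq> 0"
    then have "\<psi> x \<noteq> 0 \<or> w1 x \<noteq> 0 \<or> w2 x \<noteq> 0" by (auto simp: w_def w0_def)
    then show "x \<in> K \<union> K1 \<union> K2" using K(3) K1(3) K2(3) by blast
  qed
  have wb: "norm (w x) \<le> \<epsilon>" for x
  proof -
    have "norm (w0 x) = \<psi> x * norm a" using \<psi>(3)[of x] by (simp add: w0_def)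
    also have "\<dots> \<le> \<eta> * norm a" using \<psi>(4)[of x] by (intro mult_right_mono) auto
    finally have "norm (w0 x) \<le> \<epsilon> / 2" using \<eta>2 by linarith
    moreover have "norm (w x) \<le> norm (w0 x) + norm (w1 x) + norm (w2 x)"
      unfolding w_def using norm_triangle_ineq[of "w0 x + w1 x" "w2 x"] norm_triangle_ineq[of "w0 x" "w1 x"] by linarith
    ultimately show ?thesis using w1(3)[of x] w2(3)[of x] by linarith
  qed
  show "\<exists>w L. L-lipschitz_on UNIV w \<and> cpt_supp w \<Omega> \<and> (\<forall>x. norm (w x) \<le> \<epsilon>) \<and>
        pw_affine {D. \<xi> + matrix D \<in> U} w \<and>
        (LINT x|lebesgue. indicator \<Omega> x * g (\<xi> + jacobian w (at x))) \<le> (t * c\<^sub>1 + (1 - t) * c\<^sub>2) * measure lebesgue \<Omega> + \<epsilon>"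
    using wl wc wb wp v by blast
qed

section \<open>Continuity of rank one convex functions\<close>

text \<open>Continuity needs convexity only along the matrix units, that is, separate convexity in
  the entries. It is what makes the sets \<open>{X. 0 < f X}\<close> open in the compactness
  argument for the barrier.\<close>

definition convex_along :: "'a::real_vector set \<Rightarrow> ('a \<Rightarrow> real) \<Rightarrow> bool" where
  "convex_along V f \<longleftrightarrow> (\<forall>x. \<forall>v\<in>V. convex_on UNIV (\<lambda>t. f (x + t *\<^sub>R v)))"

lemma convex_along_interval:
  assumes "convex_along V f" "v \<in> V" "\<bar>t\<bar> \<le> r"
  shows "f (x + t *\<^sub>R v) \<le> max (f (x + r *\<^sub>R v)) (f (x - r *\<^sub>R v))"
proof (cases "r = 0")
  case True then show ?thesis using assms by simp
next
  case False
  then have r: "r > 0" using assms by linarith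
  define s where "s = (r + t) / (2 * r)"
  have s: "0 \<le> s" "s \<le> 1" using assms r by (auto simp: s_def field_simps)
  have t: "t = (1 - s) * (- r) + s * r" using r by (simp add: s_def field_simps)
  have "convex_on UNIV (\<lambda>t. f (x + t *\<^sub>R v))" using assms by (simp add: convex_along_def)
  from convex_onD[OF this s, of "- r" r]
  have "f (x + t *\<^sub>R v) \<le> (1 - s) * f (x - r *\<^sub>R v) + s * f (x + r *\<^sub>R v)"
    using t by simp
  also have "\<dots> \<le> (1 - s) * max (f (x + r *\<^sub>R v)) (f (x - r *\<^sub>R v)) + s * max (f (x + r *\<^sub>R v)) (f (x - r *\<^sub>R v))"
    using s by (intro add_mono mult_left_mono) auto
  also have "\<dots> = max (f (x + r *\<^sub>R v)) (f (x - r *\<^sub>R v))" by (simp add: algebra_simps)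
  finally show ?thesis .
qed

lemma convex_along_midpoint:
  assumes "convex_along V f" "v \<in> V"
  shows "2 * f x \<le> f (x + t *\<^sub>R v) + f (x - t *\<^sub>R v)"
proof -
  have "convex_on UNIV (\<lambda>t. f (x + t *\<^sub>R v))" using assms by (simp add: convex_along_def)
  from convex_onD[OF this, of "1/2" t "- t"] show ?thesis by simp
qed

text \<open>Convexity moves one coordinate at a time to an end of its interval, so the values on a
  box are bounded by those at its corners. The induction therefore has to vary the base point
  \<open>x\<close>.\<close>

lemma convex_along_bounded_above:
  fixes f :: "'a::real_vector \<Rightarrow> real"
  assumes "convex_along V f" "finite S" "S \<subseteq> V"
  shows "\<exists>M. \<forall>c. (\<forall>v\<in>S. \<bar>c v\<bar> \<le> r) \<longrightarrow> f (x + (\<Sum>v\<in>S. c v *\<^sub>R v)) \<le> M"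
  using assms(2,3)
proof (induction S arbitrary: x)
  case empty then show ?case by auto
next
  case (insert v S)
  obtain M1 where M1: "\<And>c. (\<forall>v\<in>S. \<bar>c v\<bar> \<le> r) \<Longrightarrow> f ((x + r *\<^sub>R v) + (\<Sum>v\<in>S. c v *\<^sub>R v)) \<le> M1"
    using insert.IH[of "x + r *\<^sub>R v"] insert.prems by auto
  obtain M2 where M2: "\<And>c. (\<forall>v\<in>S. \<bar>c v\<bar> \<le> r) \<Longrightarrow> f ((x - r *\<^sub>R v) + (\<Sum>v\<in>S. c v *\<^sub>R v)) \<le> M2"
    using insert.IH[of "x - r *\<^sub>R v"] insert.prems by auto
  have "f (x + (\<Sum>v\<in>insert v S. c v *\<^sub>R v)) \<le> max M1 M2" if c: "\<forall>v\<in>insert v S. \<bar>c v\<bar> \<le> r" for c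
  proof -
    let ?y = "x + (\<Sum>v\<in>S. c v *\<^sub>R v)"
    have "f (?y + c v *\<^sub>R v) \<le> max (f (?y + r *\<^sub>R v)) (f (?y - r *\<^sub>R v))"
      using c insert.prems by (intro convex_along_interval[OF assms(1)]) auto
    also have "\<dots> \<le> max M1 M2" using M1[of c] M2[of c] c by (intro max.mono) (auto simp: algebra_simps)
    finally show ?thesis using insert.hyps by (simp add: algebra_simps)
  qed
  then show ?case by blast
qed

text \<open>Reflection in the new direction: the midpoint inequality gives
  \<open>f (y + c v) \<ge> 2 * f y - f (y - c v)\<close>, where \<open>f y\<close> is bounded below
  by induction and the reflected value is bounded above by the previous lemma.\<close>

lemma convex_along_bounded_below:
  fixes f :: "'a::real_vector \<Rightarrow> real"
  assumes "convex_along V f" "finite S" "S \<subseteq> V"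
  shows "\<exists>m. \<forall>c. (\<forall>v\<in>S. \<bar>c v\<bar> \<le> r) \<longrightarrow> m \<le> f (x + (\<Sum>v\<in>S. c v *\<^sub>R v))"
  using assms(2,3)
proof (induction S)
  case empty then show ?case by auto
next
  case (insert v S)
  obtain m where m: "\<And>c. (\<forall>v\<in>S. \<bar>c v\<bar> \<le> r) \<Longrightarrow> m \<le> f (x + (\<Sum>v\<in>S. c v *\<^sub>R v))"
    using insert.IH insert.prems by auto
  obtain M where M: "\<And>c. (\<forall>v\<in>insert v S. \<bar>c v\<bar> \<le> r) \<Longrightarrow> f (x + (\<Sum>v\<in>insert v S. c v *\<^sub>R v)) \<le> M"
    using convex_along_bounded_above[OF assms(1), of "insert v S" r x] insert by auto
  have "2 * m - M \<le> f (x + (\<Sum>v\<in>insert v S. c v *\<^sub>R v))" if c: "\<forall>v\<in>insert v S. \<bar>c v\<bar> \<le> r" for c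
  proof -
    let ?y = "x + (\<Sum>v\<in>S. c v *\<^sub>R v)"
    have eq: "(\<Sum>w\<in>S. (c(v := - c v)) w *\<^sub>R w) = (\<Sum>w\<in>S. c w *\<^sub>R w)"
      using insert.hyps by (intro sum.cong) auto
    have "2 * f ?y \<le> f (?y + c v *\<^sub>R v) + f (?y - c v *\<^sub>R v)"
      using insert.prems by (intro convex_along_midpoint[OF assms(1)]) auto
    moreover have "f (?y - c v *\<^sub>R v) \<le> M"
      using M[of "c(v := - c v)"] c insert.hyps eq by (simp add: algebra_simps)
    moreover have "m \<le> f ?y" using m[of c] c by auto
    ultimately have "2 * m - M \<le> f (?y + c v *\<^sub>R v)" by linarith
    then show ?thesis using insert.hyps by (simp add: algebra_simps)
  qed
  then show ?case by blast
qed

text \<open>The upper estimate is the chord from 0 to the end point on the same side. The lower one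
  follows from the midpoint inequality at 0 and the chord on the opposite side.\<close>

lemma convex_on_unit_slope:
  fixes \<phi> :: "real \<Rightarrow> real"
  assumes "convex_on UNIV \<phi>" "\<bar>\<phi> 0\<bar> \<le> B" "\<bar>\<phi> 1\<bar> \<le> B" "\<bar>\<phi> (-1)\<bar> \<le> B" "\<bar>t\<bar> \<le> 1"
  shows "\<bar>\<phi> t - \<phi> 0\<bar> \<le> 2 * B * \<bar>t\<bar>"
proof -
  have pos: "\<bar>\<phi> (\<sigma> * t) - \<phi> 0\<bar> \<le> 2 * B * t" if t: "0 \<le> t" "t \<le> 1" and \<sigma>: "\<sigma> = 1 \<or> \<sigma> = -1" for t \<sigma> :: real
  proof -
    have B: "\<bar>\<phi> \<sigma>\<bar> \<le> B" "\<bar>\<phi> (- \<sigma>)\<bar> \<le> B" using \<sigma> assms by auto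
    have "\<phi> (\<sigma> * t) \<le> (1 - t) * \<phi> 0 + t * \<phi> \<sigma>"
      using convex_onD[OF assms(1) t, of 0 \<sigma>] by (simp add: mult.commute)
    moreover have "t * (\<phi> \<sigma> - \<phi> 0) \<le> t * (2 * B)" using B assms t by (intro mult_left_mono) auto
    ultimately have up: "\<phi> (\<sigma> * t) - \<phi> 0 \<le> 2 * B * t" by (simp add: algebra_simps)
    have "2 * \<phi> 0 \<le> \<phi> (\<sigma> * t) + \<phi> (- (\<sigma> * t))"
      using convex_onD[OF assms(1), of "1/2" "\<sigma> * t" "- (\<sigma> * t)"] by simp
    moreover have "\<phi> (- (\<sigma> * t)) \<le> (1 - t) * \<phi> 0 + t * \<phi> (- \<sigma>)"
      using convex_onD[OF assms(1) t, of 0 "- \<sigma>"] by (simp add: mult.commute)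
    moreover have "t * (\<phi> (- \<sigma>) - \<phi> 0) \<le> t * (2 * B)" using B assms t by (intro mult_left_mono) auto
    ultimately have "- (2 * B * t) \<le> \<phi> (\<sigma> * t) - \<phi> 0" by (simp add: algebra_simps)
    then show ?thesis using up by linarith
  qed
  show ?thesis using pos[of t 1] pos[of "- t" "-1"] assms(5) by (cases "0 \<le> t") auto
qed

text \<open>Boundedness on a box bounds the slopes of the one dimensional sections. Changing the
  coordinates one after the other then gives a local Lipschitz estimate in the l1 norm of the
  displacement.\<close>

lemma convex_along_Basis_continuous:
  fixes f :: "'a::euclidean_space \<Rightarrow> real"
  assumes "convex_along Basis f"
  shows "continuous_on UNIV f"
proof -
  have "isCont f x" for x
  proof -
    obtain M where M: "\<And>c. (\<forall>b\<in>Basis. \<bar>c b\<bar> \<le> 2) \<Longrightarrow> f (x + (\<Sum>b\<in>Basis. c b *\<^sub>R b)) \<le> M"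
      using convex_along_bounded_above[OF assms finite_Basis, of 2 x] by auto
    obtain m where m: "\<And>c. (\<forall>b\<in>Basis. \<bar>c b\<bar> \<le> 2) \<Longrightarrow> m \<le> f (x + (\<Sum>b\<in>Basis. c b *\<^sub>R b))"
      using convex_along_bounded_below[OF assms finite_Basis, of 2 x] by auto
    define B where "B = max \<bar>M\<bar> \<bar>m\<bar>"
    have B: "\<bar>f (x + (\<Sum>b\<in>Basis. c b *\<^sub>R b))\<bar> \<le> B" if "\<forall>b\<in>Basis. \<bar>c b\<bar> \<le> 2" for c
      using M[OF that] m[OF that] by (auto simp: B_def)
    have B0: "0 \<le> B" by (simp add: B_def)
    have step: "\<bar>f (x + (\<Sum>b\<in>S. c b *\<^sub>R b)) - f x\<bar> \<le> (\<Sum>b\<in>S. 2 * B * \<bar>c b\<bar>)"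
      if "finite S" "S \<subseteq> Basis" "\<forall>b\<in>Basis. \<bar>c b\<bar> \<le> 1" for S c
      using that
    proof (induction S)
      case empty then show ?case by simp
    next
      case (insert v S)
      let ?y = "x + (\<Sum>b\<in>S. c b *\<^sub>R b)"
      define \<phi> where "\<phi> = (\<lambda>t. f (?y + t *\<^sub>R v))"
      have \<phi>b: "\<bar>\<phi> s\<bar> \<le> B" if "\<bar>s\<bar> \<le> 1" for s
      proof -
        \<comment> \<open>The point on the section through \<open>?y\<close>, written in full
          coordinates so that the bound on the box applies.\<close>
        define c' where "c' = (\<lambda>b. if b = v then s else if b \<in> S then c b else 0)"
        have "(\<Sum>b\<in>Basis. c' b *\<^sub>R b) = (\<Sum>b\<in>insert v S. c' b *\<^sub>R b)"
          using insert by (intro sum.mono_neutral_right) (auto simp: c'_def)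
        also have "\<dots> = s *\<^sub>R v + (\<Sum>b\<in>S. c' b *\<^sub>R b)" using insert by (simp add: c'_def)
        also have "(\<Sum>b\<in>S. c' b *\<^sub>R b) = (\<Sum>b\<in>S. c b *\<^sub>R b)"
          using insert.hyps by (intro sum.cong) (auto simp: c'_def)
        finally have e: "x + (\<Sum>b\<in>Basis. c' b *\<^sub>R b) = ?y + s *\<^sub>R v" by (simp add: algebra_simps)
        have "\<forall>b\<in>Basis. \<bar>c' b\<bar> \<le> 2"
        proof
          fix b :: 'a assume "b \<in> Basis"
          then have "\<bar>c b\<bar> \<le> 1" using insert.prems by blast
          then show "\<bar>c' b\<bar> \<le> 2" using that by (simp add: c'_def)
        qed
        from B[OF this] show ?thesis unfolding e \<phi>_def .
      qed
      have "convex_on UNIV \<phi>" using assms insert.prems by (simp add: convex_along_def \<phi>_def)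
      then have "\<bar>\<phi> (c v) - \<phi> 0\<bar> \<le> 2 * B * \<bar>c v\<bar>"
        using \<phi>b insert.prems by (intro convex_on_unit_slope) auto
      moreover have "\<bar>f ?y - f x\<bar> \<le> (\<Sum>b\<in>S. 2 * B * \<bar>c b\<bar>)" using insert by auto
      ultimately have "\<bar>f (?y + c v *\<^sub>R v) - f x\<bar> \<le> 2 * B * \<bar>c v\<bar> + (\<Sum>b\<in>S. 2 * B * \<bar>c b\<bar>)"
        unfolding \<phi>_def by simp
      then show ?case using insert.hyps by (simp add: algebra_simps)
    qed
    have loc: "\<bar>f y - f x\<bar> \<le> (\<Sum>b\<in>Basis. 2 * B * \<bar>(y - x) \<bullet> b\<bar>)" if "y \<in> ball x 1" for y
    proof -
      have "\<forall>b\<in>Basis. \<bar>(y - x) \<bullet> b\<bar> \<le> 1"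
        using Basis_le_norm[of _ "y - x"] that by (force simp: dist_norm norm_minus_commute)
      from step[OF finite_Basis order_refl this] show ?thesis
        unfolding euclidean_representation by simp
    qed
    have lim: "((\<lambda>y. \<Sum>b\<in>Basis. 2 * B * \<bar>(y - x) \<bullet> b\<bar>) \<longlongrightarrow> (\<Sum>b\<in>Basis. 2 * B * \<bar>(x - x) \<bullet> b\<bar>)) (at x)"
      by (intro tendsto_intros)
    then have lim0: "((\<lambda>y. \<Sum>b\<in>Basis. 2 * B * \<bar>(y - x) \<bullet> b\<bar>) \<longlongrightarrow> 0) (at x)" by simp
    have "((\<lambda>y. f y - f x) \<longlongrightarrow> 0) (at x)"
      by (rule Lim_null_comparison[OF _ lim0])
         (use loc in \<open>auto simp: eventually_at intro!: exI[of _ 1] simp: dist_commute\<close>)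
    then show ?thesis using LIM_zero_cancel isCont_def by blast
  qed
  then show ?thesis by (simp add: continuous_at_imp_continuous_on)
qed

text \<open>Links the algebraic rank to the dyadic form on which laminates rely: only along a dyad
  does a scalar profile in \<open>\<nu> \<bullet> x\<close>, multiplied by the fixed vector
  \<open>a\<close>, realise both gradients.\<close>

lemma rank_one_iff:
  fixes M :: "real^'n^'N"
  shows "rank M = 1 \<longleftrightarrow> M \<noteq> 0 \<and> (\<exists>\<nu> a. \<forall>h. M *v h = (\<nu> \<bullet> h) *\<^sub>R a)"
proof
  assume r: "rank M = 1"
  then have d: "dim (range ((*v) M)) = 1" by (simp add: rank_dim_range)
  obtain B where B: "B \<subseteq> range ((*v) M)" "independent B" "range ((*v) M) \<subseteq> span B" "card B = 1"
    using basis_exists[of "range ((*v) M)"] d by metis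
  then obtain a where a: "B = {a}" using card_1_singletonE by blast
  have a0: "a \<noteq> 0" using B(2) a by auto
  \<comment> \<open>All columns of \<open>M\<close> are multiples of \<open>a\<close>; their
    coefficients are read off by projecting onto \<open>a\<close>.\<close>
  define \<nu> where "\<nu> = (\<chi> j. (a \<bullet> (M *v axis j 1)) / (a \<bullet> a))"
  have "M *v h = (\<nu> \<bullet> h) *\<^sub>R a" for h
  proof -
    have e: "\<exists>k. M *v h = k *\<^sub>R a" for h using B(3) a by (auto simp: span_singleton)
    obtain k where k: "M *v h = k *\<^sub>R a" using e by blast
    have "(\<lambda>h. (a \<bullet> (M *v h)) / (a \<bullet> a)) = (\<lambda>h. \<nu> \<bullet> h)"
    proof -
      obtain v where v: "(\<lambda>h. (a \<bullet> (M *v h)) / (a \<bullet> a)) = (\<lambda>h. v \<bullet> h)"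
        by (rule linear_functional_inner[of "\<lambda>h. (a \<bullet> (M *v h)) / (a \<bullet> a)"])
           (auto intro!: linearI simp: matrix_vector_right_distrib inner_add_right add_divide_distrib matrix_vector_mult_scaleR)
      have "\<nu> $ j = v $ j" for j using fun_cong[OF v, of "axis j 1"] by (simp add: \<nu>_def inner_axis)
      then have "\<nu> = v" by (simp add: vec_eq_iff)
      then show ?thesis using v by simp
    qed
    from fun_cong[OF this, of h] have "\<nu> \<bullet> h = k" using k a0 by simp
    then show ?thesis using k by simp
  qed
  moreover have "M \<noteq> 0" using r by auto
  ultimately show "M \<noteq> 0 \<and> (\<exists>\<nu> a. \<forall>h. M *v h = (\<nu> \<bullet> h) *\<^sub>R a)" by blast
next
  assume "M \<noteq> 0 \<and> (\<exists>\<nu> a. \<forall>h. M *v h = (\<nu> \<bullet> h) *\<^sub>R a)"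
  then obtain \<nu> a where M: "M \<noteq> 0" "\<And>h. M *v h = (\<nu> \<bullet> h) *\<^sub>R a" by blast
  have "range ((*v) M) \<subseteq> span {a}" using M(2) by (auto simp: span_singleton)
  then have "dim (range ((*v) M)) \<le> card {a}" by (rule dim_le_card) simp
  then have "rank M \<le> 1" by (simp add: rank_dim_range)
  moreover have "rank M \<noteq> 0" using M(1) by (simp add: rank_eq_0)
  ultimately show "rank M = 1" by linarith
qed

lemma rank_one_scaleR:
  fixes M :: "real^'n^'N"
  assumes "rank M = 1" "c \<noteq> 0"
  shows "rank (c *\<^sub>R M) = 1"
proof -
  obtain \<nu> a where M: "M \<noteq> 0" "\<And>h. M *v h = (\<nu> \<bullet> h) *\<^sub>R a" using assms(1) rank_one_iff by blast
  have "(c *\<^sub>R M) *v h = (\<nu> \<bullet> h) *\<^sub>R (c *\<^sub>R a)" for h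
    by (simp add: scaleR_matrix_vector_assoc[symmetric] M(2) mult.commute)
  moreover have "c *\<^sub>R M \<noteq> 0" using M(1) assms(2) by simp
  ultimately show ?thesis unfolding rank_one_iff by blast
qed

text \<open>The matrix units are dyads of coordinate vectors, so rank one convexity contains
  separate convexity in the entries.\<close>

lemma rank_one_Basis:
  fixes M :: "real^'n^'N"
  assumes "M \<in> Basis"
  shows "rank M = 1"
proof -
  obtain i j where M: "M = axis i (axis j 1)" using assms by (auto simp: Basis_vec_def)
  have "M *v h = (axis j 1 \<bullet> h) *\<^sub>R axis i 1" for h
  proof (rule vec_eq_iff[THEN iffD2], rule allI)
    fix k
    show "(M *v h) $ k = ((axis j 1 \<bullet> h) *\<^sub>R axis i 1) $ k"
      by (simp add: matrix_vector_mul_component M axis_def inner_vec_def)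
  qed
  moreover have "M \<noteq> 0" using assms nonzero_Basis by blast
  ultimately show ?thesis unfolding rank_one_iff by blast
qed

lemma rank_one_convexD:
  assumes "rank_one_convex f" "0 \<le> t" "t \<le> 1" "rank (\<xi> - \<eta>) = 1"
  shows "f (t *\<^sub>R \<xi> + (1 - t) *\<^sub>R \<eta>) \<le> t * f \<xi> + (1 - t) * f \<eta>"
  using assms unfolding rank_one_convex_def by simp

lemma rank_one_convex_continuous:
  fixes f :: "real^'n^'N \<Rightarrow> real"
  assumes "rank_one_convex f"
  shows "continuous_on UNIV f"
proof (rule convex_along_Basis_continuous)
  show "convex_along Basis f"
    unfolding convex_along_def
  proof (intro allI ballI convex_onI)
    fix x v :: "real^'n^'N" and t a b :: real
    assume v: "v \<in> Basis" and t: "0 < t" "t < 1"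
    show "f (x + ((1 - t) *\<^sub>R a + t *\<^sub>R b) *\<^sub>R v) \<le> (1 - t) * f (x + a *\<^sub>R v) + t * f (x + b *\<^sub>R v)"
    proof (cases "a = b")
      case True then show ?thesis by (simp add: algebra_simps)
    next
      case False
      have "(x + b *\<^sub>R v) - (x + a *\<^sub>R v) = (b - a) *\<^sub>R v" by (simp add: algebra_simps)
      then have "rank ((x + b *\<^sub>R v) - (x + a *\<^sub>R v)) = 1"
        using rank_one_scaleR[OF rank_one_Basis[OF v], of "b - a"] False by simp
      from rank_one_convexD[OF assms _ _ this, of t] t
      have "f (t *\<^sub>R (x + b *\<^sub>R v) + (1 - t) *\<^sub>R (x + a *\<^sub>R v)) \<le> t * f (x + b *\<^sub>R v) + (1 - t) * f (x + a *\<^sub>R v)" by simp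
      moreover have "t *\<^sub>R (x + b *\<^sub>R v) + (1 - t) *\<^sub>R (x + a *\<^sub>R v) = x + ((1 - t) *\<^sub>R a + t *\<^sub>R b) *\<^sub>R v"
        by (simp add: algebra_simps)
      ultimately show ?thesis by simp
    qed
  qed simp
qed

section \<open>Relaxation on the rank one convex hull\<close>

lemma rank_one_convex_max0_sum:
  assumes "finite F" "\<And>f. f \<in> F \<Longrightarrow> rank_one_convex f" "0 \<le> (c::real)"
  shows "rank_one_convex (\<lambda>X. c * (\<Sum>f\<in>F. max 0 (f X)))"
  unfolding rank_one_convex_def
proof (intro ballI allI impI)
  fix t :: real and \<xi> \<eta> :: "real^'a^'b"
  assume t: "t \<in> {0..1}" and r: "rank (\<xi> - \<eta>) = 1"
  have "max 0 (f (t *\<^sub>R \<xi> + (1 - t) *\<^sub>R \<eta>)) \<le> t * max 0 (f \<xi>) + (1 - t) * max 0 (f \<eta>)" if "f \<in> F" for f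
  proof -
    have "f (t *\<^sub>R \<xi> + (1 - t) *\<^sub>R \<eta>) \<le> t * f \<xi> + (1 - t) * f \<eta>"
      using rank_one_convexD[OF assms(2)[OF that] _ _ r] t by simp
    also have "\<dots> \<le> t * max 0 (f \<xi>) + (1 - t) * max 0 (f \<eta>)"
      using t by (intro add_mono mult_left_mono) auto
    finally show ?thesis using t by simp
  qed
  then have "(\<Sum>f\<in>F. max 0 (f (t *\<^sub>R \<xi> + (1 - t) *\<^sub>R \<eta>))) \<le> (\<Sum>f\<in>F. t * max 0 (f \<xi>) + (1 - t) * max 0 (f \<eta>))"
    by (rule sum_mono)
  also have "\<dots> = t * (\<Sum>f\<in>F. max 0 (f \<xi>)) + (1 - t) * (\<Sum>f\<in>F. max 0 (f \<eta>))"
    by (simp add: sum.distrib sum_distrib_left)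
  finally have "c * (\<Sum>f\<in>F. max 0 (f (t *\<^sub>R \<xi> + (1 - t) *\<^sub>R \<eta>))) \<le>
    c * (t * (\<Sum>f\<in>F. max 0 (f \<xi>)) + (1 - t) * (\<Sum>f\<in>F. max 0 (f \<eta>)))"
    using assms(3) by (rule mult_left_mono)
  then show "c * (\<Sum>f\<in>F. max 0 (f (t *\<^sub>R \<xi> + (1 - t) *\<^sub>R \<eta>))) \<le>
     t * (c * (\<Sum>f\<in>F. max 0 (f \<xi>))) + (1 - t) * (c * (\<Sum>f\<in>F. max 0 (f \<eta>)))"
    by (simp add: algebra_simps)
qed

text \<open>Every point outside the hull has its own separating function, by definition. Continuity
  and compactness of \<open>Z\<close> leave finitely many of them, and the sum of their positive
  parts is rank one convex, zero on \<open>K\<close> and positive on \<open>Z\<close>.\<close>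

lemma rank_one_convex_barrier:
  fixes K :: "(real^'n^'N) set"
  assumes "compact Z" "Z \<inter> Rco_f K = {}"
  obtains G where "rank_one_convex G" "\<And>X. 0 \<le> G X" "\<And>X. X \<in> K \<Longrightarrow> G X = 0" "\<And>X. X \<in> Z \<Longrightarrow> M < G X"
proof -
  define P where "P = {f. rank_one_convex f \<and> (\<forall>\<eta>\<in>K. f \<eta> \<le> 0)}"
  have c: "continuous_on UNIV f" if "f \<in> P" for f
    using that rank_one_convex_continuous by (auto simp: P_def)
  have o: "open {X. 0 < f X}" if "f \<in> P" for f
    using c[OF that] by (intro open_Collect_less) auto
  have cov: "Z \<subseteq> (\<Union>f\<in>P. {X. 0 < f X})"
  proof
    fix X assume "X \<in> Z"
    then have "X \<notin> Rco_f K" using assms(2) by blast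
    then obtain f where "rank_one_convex f" "\<forall>\<eta>\<in>K. f \<eta> \<le> 0" "\<not> f X \<le> 0"
      unfolding Rco_f_def by blast
    then show "X \<in> (\<Union>f\<in>P. {X. 0 < f X})" by (auto simp: P_def intro!: bexI[of _ f])
  qed
  obtain F where F: "F \<subseteq> P" "finite F" "Z \<subseteq> (\<Union>f\<in>F. {X. 0 < f X})"
    using compactE_image[OF assms(1) o cov] by blast
  define S where "S = (\<lambda>X. \<Sum>f\<in>F. max 0 (f X))"
  have Sc: "continuous_on UNIV S" unfolding S_def
    using c F(1) by (intro continuous_intros) auto
  have Sp: "0 < S X" if "X \<in> Z" for X
  proof -
    obtain f where "f \<in> F" "0 < f X" using F(3) \<open>X \<in> Z\<close> by auto
    then show ?thesis unfolding S_def using F(2) by (intro sum_pos2[of F f]) auto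
  qed
  obtain m where m: "m > 0" "\<And>X. X \<in> Z \<Longrightarrow> m \<le> S X"
    using compact_positive_lower_bound[OF assms(1) continuous_on_subset[OF Sc] Sp] by auto
  \<comment> \<open>As \<open>S\<close> is at least \<open>m\<close> on \<open>Z\<close>, this
    factor lifts it to at least \<open>\<bar>M\<bar> + 1\<close>, while the zeros on
    \<open>K\<close> remain.\<close>
  define G where "G = (\<lambda>X. (\<bar>M\<bar> + 1) / m * S X)"
  show ?thesis
  proof (rule that)
    show "rank_one_convex G" unfolding G_def S_def
      using F m by (intro rank_one_convex_max0_sum) (auto simp: P_def)
    have S0: "0 \<le> S X" for X unfolding S_def by (intro sum_nonneg) auto
    show "0 \<le> G X" for X using S0 m by (simp add: G_def)
    show "G X = 0" if "X \<in> K" for X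
    proof -
      have "max 0 (f X) = 0" if "f \<in> F" for f using F(1) \<open>X \<in> K\<close> that by (auto simp: P_def)
      then show ?thesis by (simp add: G_def S_def)
    qed
    show "M < G X" if "X \<in> Z" for X
    proof -
      have "(\<bar>M\<bar> + 1) / m * m \<le> (\<bar>M\<bar> + 1) / m * S X" using m(2)[OF that] m(1) by (intro mult_left_mono) auto
      then show ?thesis using m(1) by (simp add: G_def)
    qed
  qed
qed

text \<open>The parameters outside the open set \<open>U\<close> form a compact set, so there is a
  first exit time \<open>s0\<close>, and the exit point lies on the frontier. Just before that time
  the segment is still in \<open>U\<close> and already in the neighbourhood
  \<open>W\<close>.\<close>

lemma exit_segment:
  fixes U :: "'a::real_normed_vector set"
  assumes U: "open U" "x \<in> U" "y \<notin> U" and W: "open W" "frontier U \<subseteq> W"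
  obtains s where "0 < s" "s < 1" "x + s *\<^sub>R (y - x) \<in> U \<inter> W"
proof -
  define \<gamma> where "\<gamma> = (\<lambda>s. x + s *\<^sub>R (y - x))"
  have c: "continuous_on UNIV \<gamma>" unfolding \<gamma>_def by (intro continuous_intros)
  define T where "T = {0..1} \<inter> \<gamma> -` (- U)"
  have "closed (\<gamma> -` (- U))" using U(1) by (intro continuous_closed_vimage) (auto simp: c[unfolded continuous_on_eq_continuous_at[OF open_UNIV]])
  then have cT: "compact T" unfolding T_def by (intro compact_Int_closed) auto
  have "1 \<in> T" using U by (simp add: T_def \<gamma>_def)
  then obtain s0 where s0: "s0 \<in> T" "\<And>s. s \<in> T \<Longrightarrow> s0 \<le> s" using compact_attains_inf[OF cT] by blast
  have "0 \<notin> T" using U by (simp add: T_def \<gamma>_def)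
  then have p: "0 < s0" "s0 \<le> 1" using s0(1) by (auto simp: T_def less_le)
  have inU: "\<gamma> s \<in> U" if "0 \<le> s" "s < s0" for s using s0(2)[of s] that p by (auto simp: T_def)
  have "\<gamma> s0 \<in> closure U"
  proof -
    have "\<gamma> ` closure {0..<s0} \<subseteq> closure U"
      using inU closure_subset[of U] by (intro image_closure_subset continuous_on_subset[OF c]) auto
    moreover have "s0 \<in> closure {0..<s0}" using p by simp
    ultimately show ?thesis by blast
  qed
  then have "s0 \<in> \<gamma> -` W" using s0(1) W(2) U(1) by (auto simp: frontier_def interior_open T_def)
  moreover have "open (\<gamma> -` W)" using W(1) c by (intro open_vimage) auto
  ultimately obtain e where e: "e > 0" "ball s0 e \<subseteq> \<gamma> -` W" using openE by blast
  \<comment> \<open>Any parameter slightly below \<open>s0\<close> would do; the entry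
    \<open>s0 / 2\<close> keeps it positive.\<close>
  define s where "s = max (s0 / 2) (s0 - e / 2)"
  have "0 < s" "s < s0" using p e by (auto simp: s_def)
  moreover have "s \<in> ball s0 e" using p e by (auto simp: s_def dist_real_def)
  ultimately show ?thesis using that[of s] inU[of s] e(2) p by (auto simp: \<gamma>_def)
qed

lemma relaxes_mono:
  assumes "relaxes U g \<xi> c" "c \<le> c'"
  shows "relaxes U g \<xi> c'"
proof -
  have "c * m + \<epsilon> \<le> c' * m + \<epsilon>" if "0 \<le> m" for m \<epsilon> :: real
    using assms(2) that by (simp add: mult_right_mono)
  then show ?thesis using assms(1) unfolding relaxes_def by (smt (verit, best) measure_nonneg)
qed

text \<open>The least admissible constant \<open>h\<close> is rank one convex, but only on \<open>U\<close>. It is extended to a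
  function \<open>F\<close> on the whole space by a barrier \<open>G\<close> that dominates \<open>h\<close> near the frontier of \<open>U\<close>. When
  \<open>F = h > G\<close> at a point, the ends of a segment through it can be pulled back into \<open>U\<close>, where either
  the end point is unchanged or \<open>h\<close> lies below \<open>G\<close>.\<close>

lemma relaxes_zero_on_Rco_f:
  fixes U K :: "(real^'n^'N) set"
  assumes U: "open U" "bounded U" and K: "Rco_f K \<subseteq> U" "K \<subseteq> Rco_f K" "\<xi>\<^sub>0 \<in> Rco_f K"
    and g: "\<And>X. X \<in> U \<Longrightarrow> 0 \<le> g X" "\<And>X. X \<in> U \<Longrightarrow> g X \<le> M" "\<And>X. X \<in> K \<Longrightarrow> g X = 0"
  shows "relaxes U g \<xi>\<^sub>0 0"
proof -
  define h where "h X = Inf {c. relaxes U g X c}" for X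
  have bdd: "bdd_below {c. relaxes U g X c}" for X
    using relaxes_nonneg[OF _ g(1)] by (intro bdd_belowI[of _ 0]) auto
  have hle: "h X \<le> c" if "relaxes U g X c" for X c
    unfolding h_def using bdd that by (intro cInf_lower) auto
  \<comment> \<open>Since the infimum is itself admissible, \<open>relaxes_rank_one\<close> can be
    applied with \<open>h A\<close> and \<open>h B\<close> as the constants.\<close>
  have hr: "relaxes U g X (h X)" if "X \<in> U" for X
  proof (rule relaxes_approx)
    fix c' assume "h X < c'"
    moreover have "{c. relaxes U g X c} \<noteq> {}" using relaxes_zero[OF that] by blast
    ultimately obtain c where "relaxes U g X c" "c < c'" unfolding h_def
      using cInf_lessD[of "{c. relaxes U g X c}" c'] by auto
    then show "relaxes U g X c'" by (intro relaxes_mono[of U g X c c']) auto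
  qed
  have h0: "0 \<le> h X" if "X \<in> U" for X using relaxes_nonneg[OF hr[OF that] g(1)] by blast
  have hM: "h X \<le> M" if "X \<in> U" for X using hle[OF relaxes_zero[OF that]] g(2)[OF that] by (rule order_trans)
  have hc: "h X \<le> t * h A + (1 - t) * h B"
    if AB: "A \<in> U" "B \<in> U" "X \<in> U" "rank (A - B) = 1" and t: "0 < t" "t < 1" and X: "X = t *\<^sub>R A + (1 - t) *\<^sub>R B" for A B X t
  proof (rule hle)
    obtain \<nu> a where o: "A - B \<noteq> 0" "\<And>h. (A - B) *v h = (\<nu> \<bullet> h) *\<^sub>R a" using AB(4) rank_one_iff by blast
    have "A \<noteq> B" using o(1) by simp
    show "relaxes U g X (t * h A + (1 - t) * h B)"
      by (rule relaxes_rank_one[OF U(1) AB(1-3) g(1) g(2) o(2) \<open>A \<noteq> B\<close> t X hr[OF AB(1)] hr[OF AB(2)]])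
  qed
  have cf: "compact (frontier U)" using U(2) by (rule compact_frontier_bounded)
  have "frontier U \<inter> Rco_f K = {}" using K(1) U(1) by (auto simp: frontier_def interior_open)
  then obtain G where G: "rank_one_convex G" "\<And>X. 0 \<le> G X" "\<And>X. X \<in> K \<Longrightarrow> G X = 0"
     "\<And>X. X \<in> frontier U \<Longrightarrow> M < G X" using rank_one_convex_barrier[OF cf, of K M] by metis
  have oW: "open {X. M < G X}"
    using rank_one_convex_continuous[OF G(1)] by (intro open_Collect_less) auto
  have ZW: "frontier U \<subseteq> {X. M < G X}" using G(4) by blast
  define F where "F X = (if X \<in> U then max (h X) (G X) else G X)" for X
  have FG: "G X \<le> F X" for X by (simp add: F_def)
  have Fh: "h X \<le> F X" if "X \<in> U" for X using that by (simp add: F_def)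
  \<comment> \<open>If \<open>A\<close> is outside \<open>U\<close>, the point obtained by pulling
    it back satisfies \<open>h \<le> M < G\<close>. There the convexity inequality of
    \<open>G\<close> is available, and \<open>G X < h X\<close> together with
    \<open>G \<le> F\<close> replaces its right side by the desired one.\<close>
  have key: "\<exists>s. 0 < s \<and> s \<le> 1 \<and> X + s *\<^sub>R (A - X) \<in> U \<and> h (X + s *\<^sub>R (A - X)) \<le> s * F A + (1 - s) * h X"
    if X: "X \<in> U" "G X < h X" and r: "rank (A - X) = 1" for X A
  proof (cases "A \<in> U")
    case True
    then show ?thesis using Fh[OF True] by (intro exI[of _ 1]) simp
  next
    case False
    obtain s where s: "0 < s" "s < 1" "X + s *\<^sub>R (A - X) \<in> U \<inter> {X. M < G X}"
      by (rule exit_segment[OF U(1) X(1) False oW ZW])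
    have "h (X + s *\<^sub>R (A - X)) \<le> G (X + s *\<^sub>R (A - X))" using hM s(3) by fastforce
    also have "G (X + s *\<^sub>R (A - X)) = G (s *\<^sub>R A + (1 - s) *\<^sub>R X)" by (simp add: algebra_simps)
    also have "\<dots> \<le> s * G A + (1 - s) * G X" using s r by (intro rank_one_convexD[OF G(1)]) auto
    also have "\<dots> \<le> s * F A + (1 - s) * h X" using s X FG by (intro add_mono mult_left_mono) auto
    finally show ?thesis using s by (intro exI[of _ s]) auto
  qed
  have "rank_one_convex F"
    unfolding rank_one_convex_def
  proof (intro ballI allI impI)
    fix t :: real and A B :: "real^'n^'N"
    assume t01: "t \<in> {0..1}" and r: "rank (A - B) = 1"
    define X where "X = t *\<^sub>R A + (1 - t) *\<^sub>R B"
    have "F X \<le> t * F A + (1 - t) * F B"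
    proof (cases "X \<in> U \<and> G X < h X \<and> t \<noteq> 0 \<and> t \<noteq> 1")
      case False
      then consider "t = 0" | "t = 1" | "F X = G X" by (auto simp: F_def)
      then show ?thesis
      proof cases
        case 3
        have "G X \<le> t * G A + (1 - t) * G B" using t01 r unfolding X_def by (intro rank_one_convexD[OF G(1)]) auto
        also have "\<dots> \<le> t * F A + (1 - t) * F B" using t01 FG by (intro add_mono mult_left_mono) auto
        finally show ?thesis using 3 by simp
      qed (auto simp: X_def)
    next
      case True
      then have t: "0 < t" "t < 1" and X: "X \<in> U" "G X < h X" using t01 by auto
      have AX: "A - X = (1 - t) *\<^sub>R (A - B)" and BX: "B - X = (- t) *\<^sub>R (A - B)" by (auto simp: X_def algebra_simps)
      have rA: "rank (A - X) = 1" unfolding AX using t by (intro rank_one_scaleR[OF r]) auto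
      have rB: "rank (B - X) = 1" unfolding BX using t by (intro rank_one_scaleR[OF r]) auto
      obtain s where s: "0 < s" "s \<le> 1" "X + s *\<^sub>R (A - X) \<in> U" "h (X + s *\<^sub>R (A - X)) \<le> s * F A + (1 - s) * h X"
        using key[OF X rA] by blast
      obtain s' where s': "0 < s'" "s' \<le> 1" "X + s' *\<^sub>R (B - X) \<in> U" "h (X + s' *\<^sub>R (B - X)) \<le> s' * F B + (1 - s') * h X"
        using key[OF X rB] by blast
      define A' where "A' = X + s *\<^sub>R (A - X)"
      define B' where "B' = X + s' *\<^sub>R (B - X)"
      \<comment> \<open>In multiples of \<open>A - B\<close>, the point \<open>A'\<close> sits at
        \<open>s * (1 - t)\<close> and \<open>B'\<close> at \<open>- s' * t\<close> relative to
        \<open>X\<close>. So \<open>q\<close> is the relative length of the segment from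
        \<open>B'\<close> to \<open>A'\<close>, and \<open>t'\<close> is the weight with which
        \<open>X\<close> divides it.\<close>
      define q where "q = s * (1 - t) + s' * t"
      have q: "q > 0" using s s' t by (simp add: q_def add_pos_pos)
      define t' where "t' = s' * t / q"
      have t': "0 < t'" "t' < 1" using s s' t q by (auto simp: t'_def q_def)
      have qt: "q * t' = s' * t" "q * (1 - t') = s * (1 - t)" using q by (auto simp: t'_def right_diff_distrib q_def)
      have "A' - B' = q *\<^sub>R (A - B)" unfolding A'_def B'_def AX BX by (simp add: q_def algebra_simps)
      then have r': "rank (A' - B') = 1" using rank_one_scaleR[OF r, of q] q by simp
      have "q *\<^sub>R X = q *\<^sub>R (t' *\<^sub>R A' + (1 - t') *\<^sub>R B')"
      proof -
        have "q *\<^sub>R (t' *\<^sub>R A' + (1 - t') *\<^sub>R B') = (q * t') *\<^sub>R A' + (q * (1 - t')) *\<^sub>R B'" by (simp add: scaleR_add_right)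
        also have "\<dots> = (s' * t) *\<^sub>R (X + (s * (1 - t)) *\<^sub>R (A - B)) + (s * (1 - t)) *\<^sub>R (X + (s' * (- t)) *\<^sub>R (A - B))"
          unfolding qt A'_def B'_def AX BX by simp
        also have "\<dots> = (s' * t + s * (1 - t)) *\<^sub>R X + ((s' * t) * (s * (1 - t)) + (s * (1 - t)) * (s' * (- t))) *\<^sub>R (A - B)"
          by (simp only: scaleR_add_right scaleR_add_left scaleR_scaleR) (simp add: algebra_simps)
        also have "(s' * t) * (s * (1 - t)) + (s * (1 - t)) * (s' * (- t)) = 0" by (simp add: algebra_simps)
        also have "s' * t + s * (1 - t) = q" by (simp add: q_def)
        finally show ?thesis by auto
      qed
      then have Xe: "X = t' *\<^sub>R A' + (1 - t') *\<^sub>R B'" using q by simp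
      have "h X \<le> t' * h A' + (1 - t') * h B'"
        using s(3) s'(3) X(1) by (intro hc[OF _ _ _ r' t' Xe]) (auto simp: A'_def B'_def)
      also have "\<dots> \<le> t' * (s * F A + (1 - s) * h X) + (1 - t') * (s' * F B + (1 - s') * h X)"
        using t' s(4) s'(4) by (intro add_mono mult_left_mono) (auto simp: A'_def B'_def)
      \<comment> \<open>Multiplying by \<open>q\<close> clears the denominator of \<open>t'\<close>.
        The coefficient of \<open>h X\<close> on the right becomes \<open>q - s * s'\<close>, so
        moving it to the left leaves \<open>s * s'\<close> times the claimed inequality.\<close>
      finally have "q * h X \<le> q * (t' * (s * F A + (1 - s) * h X) + (1 - t') * (s' * F B + (1 - s') * h X))"
        using q by (intro mult_left_mono) auto
      also have "\<dots> = (q * t') * (s * F A + (1 - s) * h X) + (q * (1 - t')) * (s' * F B + (1 - s') * h X)"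
        by (simp add: algebra_simps)
      also have "\<dots> = (s * s') * (t * F A + (1 - t) * F B) + (q - s * s') * h X"
        unfolding qt by (simp add: q_def algebra_simps)
      finally have "(s * s') * h X \<le> (s * s') * (t * F A + (1 - t) * F B)" by (simp add: algebra_simps)
      then have "h X \<le> t * F A + (1 - t) * F B" using s(1) s'(1) by simp
      moreover have "F X = h X" using X by (simp add: F_def)
      ultimately show ?thesis by simp
    qed
    then show "F (t *\<^sub>R A + (1 - t) *\<^sub>R B) \<le> t * F A + (1 - t) * F B" by (simp add: X_def)
  qed
  moreover have "F X \<le> 0" if "X \<in> K" for X
  proof -
    have XU: "X \<in> U" using that K by blast
    have "h X \<le> g X" by (rule hle[OF relaxes_zero[OF XU]])
    then show ?thesis using g(3)[OF that] G(3)[OF that] XU by (simp add: F_def)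
  qed
  ultimately have "F \<xi>\<^sub>0 \<le> 0" using K(3) unfolding Rco_f_def by blast
  moreover have "\<xi>\<^sub>0 \<in> U" using K by blast
  ultimately have "h \<xi>\<^sub>0 \<le> 0" using Fh order_trans by blast
  then show ?thesis using relaxes_mono[OF hr[OF \<open>\<xi>\<^sub>0 \<in> U\<close>]] by simp
qed

section \<open>Smooth mollifiers\<close>

lemma Ck_SucI:
  assumes "\<And>x. (f has_derivative f' x) (at x)" "\<And>e. e \<in> Basis \<Longrightarrow> Ck k (\<lambda>x. f' x e)"
  shows "Ck (Suc k) f"
proof -
  have "frechet_derivative f (at x) = f' x" for x using assms(1) frechet_derivative_at by metis
  then show ?thesis using assms by (auto simp: differentiable_def)
qed

lemma Ck_SucD:
  assumes "Ck (Suc k) f"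
  shows "(f has_derivative frechet_derivative f (at x)) (at x)"
    "e \<in> Basis \<Longrightarrow> Ck k (\<lambda>x. frechet_derivative f (at x) e)"
  using assms frechet_derivative_works by auto

lemma Ck_Suc_imp: "Ck (Suc k) f \<Longrightarrow> Ck k f"
proof (induction k arbitrary: f)
  case 0
  then have "\<And>x. f differentiable at x" by simp
  then show ?case using differentiable_imp_continuous_within by (auto simp: continuous_on_eq_continuous_at)
next
  case (Suc k)
  from Ck_SucD[OF Suc.prems] Suc.IH show ?case by (intro Ck_SucI) auto
qed

lemma Ck_const: "Ck k (\<lambda>x. c)"
  by (induction k arbitrary: c) (auto simp del: Ck.simps(2) intro: Ck_SucI[where f'="\<lambda>x h. 0"])

lemma Ck_linear:
  assumes "bounded_linear f" shows "Ck k f"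
proof (cases k)
  case 0 then show ?thesis using linear_continuous_on[OF assms] by simp
next
  case (Suc n)
  have "Ck (Suc n) f"
    by (rule Ck_SucI[where f'="\<lambda>x. f"]) (auto intro: bounded_linear_imp_has_derivative assms Ck_const)
  then show ?thesis using Suc by simp
qed

lemma Ck_add: "Ck k f \<Longrightarrow> Ck k g \<Longrightarrow> Ck k (\<lambda>x. f x + g x)"
proof (induction k arbitrary: f g)
  case 0 then show ?case by (auto intro: continuous_intros)
next
  case (Suc k)
  show ?case
    by (rule Ck_SucI[OF has_derivative_add[OF Ck_SucD(1)[OF Suc.prems(1)] Ck_SucD(1)[OF Suc.prems(2)]]])
       (intro Suc.IH Ck_SucD(2)[OF Suc.prems(1)] Ck_SucD(2)[OF Suc.prems(2)])
qed

lemma Ck_mult: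
  fixes f g :: "'a::euclidean_space \<Rightarrow> real"
  shows "Ck k f \<Longrightarrow> Ck k g \<Longrightarrow> Ck k (\<lambda>x. f x * g x)"
proof (induction k arbitrary: f g)
  case 0 then show ?case by (auto intro: continuous_intros)
next
  case (Suc k)
  show ?case
    by (rule Ck_SucI[OF has_derivative_mult[OF Ck_SucD(1)[OF Suc.prems(1)] Ck_SucD(1)[OF Suc.prems(2)]]])
       (intro Ck_add Suc.IH Ck_SucD(2)[OF Suc.prems(1)] Ck_SucD(2)[OF Suc.prems(2)] Ck_Suc_imp[OF Suc.prems(1)] Ck_Suc_imp[OF Suc.prems(2)])
qed

text \<open>Taking all polynomials \<open>p\<close> at once makes this family closed under differentiation.\<close>

definition exp_inv :: "real poly \<Rightarrow> real \<Rightarrow> real" where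
  "exp_inv p t = (if t \<le> 0 then 0 else poly p (inverse t) * exp (- inverse t))"

lemma poly_exp_tendsto_0: "((\<lambda>s. poly p s * exp (- s)) \<longlongrightarrow> (0::real)) at_top"
proof -
  have "((\<lambda>s. \<Sum>i\<le>degree p. coeff p i * (s ^ i / exp s)) \<longlongrightarrow> (\<Sum>i\<le>degree p. coeff p i * 0)) at_top"
    by (intro tendsto_intros tendsto_power_div_exp_0)
  then show ?thesis by (simp add: poly_altdef exp_minus divide_inverse sum_distrib_right mult.assoc)
qed

text \<open>With \<open>s = 1 / t\<close> one has \<open>ds/dt = - s * s\<close>, so the derivative
  of \<open>p(s) exp(-s)\<close> is \<open>s * s * (p(s) - p'(s)) exp(-s)\<close>. This explains the
  factor \<open>[:0, 0, 1:]\<close>.\<close>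

lemma exp_inv_derivative:
  "(exp_inv p has_real_derivative exp_inv ([:0, 0, 1:] * (p - pderiv p)) t) (at t)"
proof -
  consider "t < 0" | "t > 0" | "t = 0" by linarith
  then show ?thesis
  proof cases
    case 1
    have "((\<lambda>t. 0) has_real_derivative 0) (at t)" by simp
    then have "(exp_inv p has_real_derivative 0) (at t)"
      by (rule has_field_derivative_transform_within_open[of _ _ _ "{..<0}"]) (use 1 in \<open>auto simp: exp_inv_def\<close>)
    then show ?thesis using 1 by (simp add: exp_inv_def)
  next
    case 2
    have i: "(inverse has_real_derivative - (inverse t * inverse t)) (at t)"
      using DERIV_inverse[of t] 2 by (simp add: power2_eq_square)
    have a: "((\<lambda>t. poly p (inverse t)) has_real_derivative poly (pderiv p) (inverse t) * (- (inverse t * inverse t))) (at t)"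
      by (rule DERIV_chain2[OF poly_DERIV i])
    have b: "((\<lambda>t. exp (- inverse t)) has_real_derivative exp (- inverse t) * (inverse t * inverse t)) (at t)"
      using DERIV_chain2[OF DERIV_exp DERIV_minus[OF i]] by simp
    have "((\<lambda>t. poly p (inverse t) * exp (- inverse t)) has_real_derivative
       (inverse t * inverse t) * (poly p (inverse t) - poly (pderiv p) (inverse t)) * exp (- inverse t)) (at t)"
      using DERIV_mult[OF a b] by (simp add: algebra_simps)
    then have "(exp_inv p has_real_derivative
       (inverse t * inverse t) * (poly p (inverse t) - poly (pderiv p) (inverse t)) * exp (- inverse t)) (at t)"
      by (rule has_field_derivative_transform_within_open[of _ _ _ "{0<..}"]) (use 2 in \<open>auto simp: exp_inv_def\<close>)
    then show ?thesis using 2 by (simp add: exp_inv_def mult_ac)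
  next
    case 3
    have "((\<lambda>h. (exp_inv p (0 + h) - exp_inv p 0) / h) \<longlongrightarrow> 0) (at 0)"
    proof (rule filterlim_split_at)
      have "((\<lambda>h. 0) \<longlongrightarrow> (0::real)) (at_left 0)" by simp
      then show "((\<lambda>h. (exp_inv p (0 + h) - exp_inv p 0) / h) \<longlongrightarrow> 0) (at_left 0)"
        by (rule Lim_transform_eventually) (auto simp: eventually_at_filter exp_inv_def)
      \<comment> \<open>The substitution of \<open>inverse h\<close> for \<open>h\<close> turns the
        right difference quotient at 0 into \<open>s * p(s) * exp(-s)\<close> for large
        \<open>s\<close>; the division accounts for the extra factor
        \<open>[:0, 1:]\<close>.\<close>
      have "((\<lambda>h. (exp_inv p (0 + inverse h) - exp_inv p 0) / inverse h) \<longlongrightarrow> 0) at_top"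
      proof (rule Lim_transform_eventually[OF poly_exp_tendsto_0[of "[:0, 1:] * p"]])
        show "\<forall>\<^sub>F h in at_top. poly ([:0, 1:] * p) h * exp (- h) = (exp_inv p (0 + inverse h) - exp_inv p 0) / inverse h"
          using eventually_gt_at_top[of 0] by eventually_elim (simp add: exp_inv_def divide_inverse)
      qed
      then show "((\<lambda>h. (exp_inv p (0 + h) - exp_inv p 0) / h) \<longlongrightarrow> 0) (at_right 0)"
        unfolding filterlim_at_right_to_top .
    qed
    then show ?thesis using 3 by (simp add: DERIV_def exp_inv_def)
  qed
qed

text \<open>Composing with \<open>c - x \<bullet> x\<close> instead of a function of the norm keeps
  the inner map smooth at the origin. Its partial derivatives are linear, so a partial derivative of
  the whole is a linear function times a member of the same family.\<close>

lemma Ck_exp_inv: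
  "Ck k (\<lambda>x::'a::euclidean_space. exp_inv p (c - x \<bullet> x))"
proof (induction k arbitrary: p)
  case 0
  have "continuous_on UNIV (exp_inv p)"
    using DERIV_isCont[OF exp_inv_derivative] by (simp add: continuous_on_eq_continuous_at)
  then show ?case by (auto intro!: continuous_on_compose2[of UNIV "exp_inv p"] continuous_intros)
next
  case (Suc k)
  let ?q = "[:0, 0, 1:] * (p - pderiv p)"
  show ?case
  proof (rule Ck_SucI)
    fix x :: 'a
    have "((\<lambda>x::'a. c - x \<bullet> x) has_derivative (\<lambda>h. - (2 * (x \<bullet> h)))) (at x)"
      by (auto intro!: derivative_eq_intros simp: inner_commute)
    from has_derivative_compose[OF this exp_inv_derivative[unfolded has_field_derivative_def]]
    show "((\<lambda>x. exp_inv p (c - x \<bullet> x)) has_derivative (\<lambda>h. exp_inv ?q (c - x \<bullet> x) * (- (2 * (x \<bullet> h))))) (at x)"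
      by simp
  next
    fix e :: 'a
    have "bounded_linear (\<lambda>x. - (2 * (x \<bullet> e)))"
      by (intro bounded_linear_minus bounded_linear_const_mult bounded_linear_inner_left)
    then show "Ck k (\<lambda>x. exp_inv ?q (c - x \<bullet> x) * (- (2 * (x \<bullet> e))))"
      by (intro Ck_mult Suc.IH Ck_linear)
  qed
qed

text \<open>The classical bump \<open>exp (- 1 / (\<delta>\<^sup>2 - x \<bullet> x))\<close>,
  normalised. Its integral is positive because a nonnegative continuous function with integral zero
  would vanish on every open set, yet it is positive at 0. Evenness is kept for rewriting the
  convolution.\<close>

lemma mollifier:
  fixes \<delta> :: real
  assumes \<delta>: "\<delta> > 0"
  obtains \<rho> :: "'a::euclidean_space \<Rightarrow> real" where "\<And>k. Ck k \<rho>" "\<And>x. 0 \<le> \<rho> x" "\<And>x. \<rho> x \<noteq> 0 \<Longrightarrow> norm x < \<delta>"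
    "\<And>x. \<rho> (- x) = \<rho> x" "integrable lebesgue \<rho>" "(LINT x|lebesgue. \<rho> x) = 1"
proof -
  define \<eta> :: "'a \<Rightarrow> real" where "\<eta> = (\<lambda>x. exp_inv 1 (\<delta>\<^sup>2 - x \<bullet> x))"
  have Ck\<eta>: "Ck k \<eta>" for k unfolding \<eta>_def by (rule Ck_exp_inv)
  have c\<eta>: "continuous_on UNIV \<eta>" using Ck\<eta>[of 0] by simp
  have \<eta>0: "0 \<le> \<eta> x" for x by (simp add: \<eta>_def exp_inv_def)
  have \<eta>s: "norm x < \<delta>" if "\<eta> x \<noteq> 0" for x
  proof -
    have "x \<bullet> x < \<delta>\<^sup>2" using that by (auto simp: \<eta>_def exp_inv_def split: if_splits)
    then have "(norm x)\<^sup>2 < \<delta>\<^sup>2" by (simp add: power2_norm_eq_inner)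
    then show ?thesis using \<delta> power_less_imp_less_base by (metis less_eq_real_def)
  qed
  have \<eta>i: "integrable lebesgue \<eta>"
    by (rule integrable_lebesgue_continuous_bounded_support[OF c\<eta>, of \<delta>]) (use \<eta>s in force)
  have pos: "(LINT x|lebesgue. \<eta> x) > 0"
  proof -
    have "(LINT x|lebesgue. \<eta> x) \<noteq> 0"
    proof
      assume "(LINT x|lebesgue. \<eta> x) = 0"
      then have ae: "AE x in lebesgue. \<eta> x = 0" using integral_nonneg_eq_0_iff_AE[OF \<eta>i] \<eta>0 by auto
      have "{x. \<eta> x \<noteq> 0} = \<eta> -` (- {0})" by auto
      then have o: "open {x. \<eta> x \<noteq> 0}" using open_vimage[of "- {0}" \<eta>] c\<eta> by auto
      then have "{x \<in> space lebesgue. \<not> \<eta> x = 0} \<in> sets lebesgue" by simp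
      from AE_iff_null[OF this] ae have "negligible {x. \<eta> x \<noteq> 0}"
        by (simp add: negligible_iff_null_sets)
      then have "{x. \<eta> x \<noteq> 0} = {}" using open_not_negligible o by metis
      moreover have "\<eta> 0 \<noteq> 0" using \<delta> by (simp add: \<eta>_def exp_inv_def not_le)
      ultimately show False by blast
    qed
    moreover have "(LINT x|lebesgue. \<eta> x) \<ge> 0" using \<eta>0 by (intro integral_nonneg_AE) auto
    ultimately show ?thesis by linarith
  qed
  define I where "I = (LINT x|lebesgue. \<eta> x)"
  show ?thesis
  proof (rule that)
    show "Ck k (\<lambda>x. inverse I * \<eta> x)" for k by (intro Ck_mult Ck_const Ck\<eta>)
    show "0 \<le> inverse I * \<eta> x" for x using \<eta>0[of x] pos by (simp add: I_def)
    show "inverse I * \<eta> x \<noteq> 0 \<Longrightarrow> norm x < \<delta>" for x using \<eta>s by auto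
    show "inverse I * \<eta> (- x) = inverse I * \<eta> x" for x by (simp add: \<eta>_def)
    show "integrable lebesgue (\<lambda>x. inverse I * \<eta> x)" using \<eta>i by simp
    show "(LINT x|lebesgue. inverse I * \<eta> x) = 1" using pos by (simp add: I_def[symmetric])
  qed
qed

text \<open>A convolution, taken over a set that will be a box containing the support of
  \<open>w\<close>, so that a parameter integral over a compact box has to be differentiated. The
  kernel is an argument because a derivative is again such an integral, with a differentiated
  kernel.\<close>

definition mollify :: "'a::euclidean_space set \<Rightarrow> ('a \<Rightarrow> real) \<Rightarrow> ('a \<Rightarrow> 'b::euclidean_space) \<Rightarrow> 'a \<Rightarrow> 'b" where
  "mollify S \<rho> w x = integral S (\<lambda>y. \<rho> (x - y) *\<^sub>R w y)"

text \<open>Differentiation under the integral: the derivative falls on the kernel, so continuity of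
  \<open>w\<close> is all that is asked of it.\<close>

lemma mollify_has_derivative:
  fixes w :: "'a::euclidean_space \<Rightarrow> 'b::euclidean_space"
  assumes w: "continuous_on UNIV w" and \<rho>: "Ck (Suc 0) \<rho>"
  shows "(mollify (cbox a b) \<rho> w has_derivative (\<lambda>h. mollify (cbox a b) (\<lambda>x. frechet_derivative \<rho> (at x) h) w x)) (at x)"
proof -
  let ?D = "\<lambda>z. frechet_derivative \<rho> (at z)"
  have d: "(\<rho> has_derivative ?D z) (at z)" for z using Ck_SucD(1)[OF \<rho>] .
  have c\<rho>: "continuous_on UNIV \<rho>" using Ck_Suc_imp[OF \<rho>] by simp
  have cD: "continuous_on UNIV (\<lambda>z. ?D z e)" if "e \<in> Basis" for e using Ck_SucD(2)[OF \<rho> that] by simp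
  have bl: "bounded_linear (\<lambda>h. ?D z h *\<^sub>R v)" for z and v :: 'b
    using has_derivative_bounded_linear[OF d] by (intro bounded_linear_scaleR_const)
  \<comment> \<open>The Leibniz rule takes the derivative as a jointly continuous map into bounded
    linear functions; its continuity is checked on basis vectors.\<close>
  define F where "F = (\<lambda>x y. Blinfun (\<lambda>h. ?D (x - y) h *\<^sub>R w y))"
  have F: "blinfun_apply (F x y) h = ?D (x - y) h *\<^sub>R w y" for x y h
    unfolding F_def using bounded_linear_Blinfun_apply[OF bl] by metis
  have Fc: "continuous_on (UNIV \<times> cbox a b) (\<lambda>(x, y). F x y)"
    unfolding split_def
  proof (rule continuous_on_blinfun_componentwise)
    fix e :: 'a assume e: "e \<in> Basis"
    show "continuous_on (UNIV \<times> cbox a b) (\<lambda>p. blinfun_apply (F (fst p) (snd p)) e)"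
      unfolding F
      by (intro continuous_intros continuous_on_compose2[OF cD[OF e]] continuous_on_compose2[OF w]) auto
  qed
  have i: "(\<lambda>y. \<rho> (x - y) *\<^sub>R w y) integrable_on cbox a b" for x
    by (intro integrable_continuous continuous_intros continuous_on_compose2[OF c\<rho>] continuous_on_compose2[OF w]) auto
  have fx: "((\<lambda>x. \<rho> (x - y) *\<^sub>R w y) has_derivative blinfun_apply (F x y)) (at x within UNIV)" for x y
  proof -
    have "((\<lambda>x. x - y) has_derivative (\<lambda>h. h)) (at x)" by (auto intro!: derivative_eq_intros)
    from has_derivative_compose[OF this d]
    have "((\<lambda>x. \<rho> (x - y)) has_derivative (\<lambda>h. ?D (x - y) h)) (at x)" .
    from has_derivative_scaleR_left[OF this, of "w y"]
    have "((\<lambda>x. \<rho> (x - y) *\<^sub>R w y) has_derivative (\<lambda>h. ?D (x - y) h *\<^sub>R w y)) (at x)" .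
    moreover have "blinfun_apply (F x y) = (\<lambda>h. ?D (x - y) h *\<^sub>R w y)" using F by auto
    ultimately show ?thesis by simp
  qed
  have "((\<lambda>x. integral (cbox a b) (\<lambda>y. \<rho> (x - y) *\<^sub>R w y)) has_derivative blinfun_apply (integral (cbox a b) (F x))) (at x within UNIV)"
    by (rule leibniz_rule[where f="\<lambda>x y. \<rho> (x - y) *\<^sub>R w y"]) (use fx i Fc in auto)
  moreover have "blinfun_apply (integral (cbox a b) (F x)) h = mollify (cbox a b) (\<lambda>x. ?D x h) w x" for h
  proof -
    have "continuous_on (cbox a b) (\<lambda>y. F x y)"
      by (rule continuous_on_compose2[OF Fc, of _ "\<lambda>y. (x, y)", unfolded split_conv]) (auto intro!: continuous_intros)
    then have "F x integrable_on cbox a b" by (rule integrable_continuous)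
    then show ?thesis by (simp add: blinfun_apply_integral F mollify_def)
  qed
  then have "blinfun_apply (integral (cbox a b) (F x)) = (\<lambda>h. mollify (cbox a b) (\<lambda>x. ?D x h) w x)" by auto
  ultimately show ?thesis unfolding mollify_def[abs_def] by simp
qed

lemma Ck_mollify:
  fixes w :: "'a::euclidean_space \<Rightarrow> 'b::euclidean_space"
  assumes w: "continuous_on UNIV w"
  shows "(\<And>j. Ck j \<rho>) \<Longrightarrow> Ck k (mollify (cbox a b) \<rho> w)"
proof (induction k arbitrary: \<rho>)
  case 0
  have "isCont (mollify (cbox a b) \<rho> w) x" for x
    by (rule has_derivative_continuous[OF mollify_has_derivative[OF w 0]])
  then show ?case by (simp add: continuous_on_eq_continuous_at)
next
  case (Suc k)
  show ?case
    by (rule Ck_SucI[OF mollify_has_derivative[OF w Suc.prems]]) (intro Suc.IH Ck_SucD(2)[OF Suc.prems])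
qed

text \<open>Moves the variable \<open>x\<close> from the kernel, which is convenient for
  differentiation, to \<open>w\<close>, where the average visibly inherits Lipschitz bounds and
  local affinity.\<close>

lemma mollify_eq_convolution:
  fixes w :: "'a::euclidean_space \<Rightarrow> 'b::euclidean_space"
  assumes w: "continuous_on UNIV w" "\<And>y. w y \<noteq> 0 \<Longrightarrow> y \<in> cbox a b"
    and \<rho>: "continuous_on UNIV \<rho>" "\<And>x. \<rho> (- x) = \<rho> x"
  shows "mollify (cbox a b) \<rho> w x = (LINT z|lebesgue. \<rho> z *\<^sub>R w (x + z))"
proof -
  let ?f = "\<lambda>y. \<rho> (y - x) *\<^sub>R w y"
  have c: "continuous_on UNIV ?f"
    by (intro continuous_intros continuous_on_compose2[OF \<rho>(1)] continuous_on_compose2[OF w(1)]) auto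
  have ev: "\<rho> (x - y) = \<rho> (y - x)" for y using \<rho>(2)[of "y - x"] by simp
  obtain R where R: "cbox a b \<subseteq> cball 0 R"
    using bounded_cbox[of a b] by (auto simp: bounded_iff subset_iff)
  have "integrable lebesgue ?f"
    by (rule integrable_lebesgue_continuous_bounded_support[OF c, of R]) (use w(2) R in force)
  then have "(?f has_integral (LINT y|lebesgue. ?f y)) UNIV" by (rule has_integral_integral_lebesgue)
  then have "(LINT y|lebesgue. ?f y) = integral UNIV ?f" by (simp add: integral_unique)
  also have "\<dots> = integral UNIV (\<lambda>y. if y \<in> cbox a b then ?f y else 0)"
    by (rule arg_cong[where f="integral UNIV"]) (use w(2) in force)
  also have "\<dots> = integral (cbox a b) ?f" by (rule Henstock_Kurzweil_Integration.integral_restrict_UNIV)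
  finally have "mollify (cbox a b) \<rho> w x = (LINT y|lebesgue. ?f y)" by (simp add: mollify_def ev)
  also have "\<dots> = (LINT z|lebesgue. ?f (z + x))" by (rule lebesgue_integral_translation[OF c, symmetric])
  finally show ?thesis by (simp add: add.commute)
qed

text \<open>Pairing \<open>f\<close> with the fixed vector \<open>f' h\<close> gives a scalar
  function whose difference quotients tend to the squared norm of \<open>f' h\<close> and are
  bounded by \<open>norm (f' h) * (L * norm h)\<close>.\<close>

lemma has_derivative_lipschitz_bound:
  fixes f :: "'a::euclidean_space \<Rightarrow> 'b::euclidean_space"
  assumes f: "L-lipschitz_on UNIV f" and d: "(f has_derivative f') (at x)"
  shows "norm (f' h) \<le> L * norm h"
proof -
  let ?v = "f' h"
  have "((\<lambda>y. ?v \<bullet> f y) has_derivative (\<lambda>k. ?v \<bullet> f' k)) (at x)"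
    by (auto intro!: derivative_eq_intros d)
  from has_derivative_imp_sequentially[OF this, of h]
  have lim: "(\<lambda>k. (?v \<bullet> f (x + inverse (real (Suc k)) *\<^sub>R h) - ?v \<bullet> f x) * real (Suc k)) \<longlonglongrightarrow> ?v \<bullet> ?v" .
  have "(?v \<bullet> f (x + inverse (real (Suc k)) *\<^sub>R h) - ?v \<bullet> f x) * real (Suc k) \<le> norm ?v * (L * norm h)" for k
  proof -
    have "?v \<bullet> (f (x + inverse (real (Suc k)) *\<^sub>R h) - f x) \<le> norm ?v * norm (f (x + inverse (real (Suc k)) *\<^sub>R h) - f x)"
      by (rule norm_cauchy_schwarz)
    also have "\<dots> \<le> norm ?v * (L * (inverse (real (Suc k)) * norm h))"
      using lipschitz_onD[OF f, of "x + inverse (real (Suc k)) *\<^sub>R h" x]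
      by (intro mult_left_mono) (auto simp: dist_norm)
    finally have "?v \<bullet> (f (x + inverse (real (Suc k)) *\<^sub>R h) - f x) * real (Suc k) \<le> norm ?v * (L * (inverse (real (Suc k)) * norm h)) * real (Suc k)"
      by (intro mult_right_mono) auto
    then show ?thesis by (simp add: inner_diff_right field_simps del: of_nat_Suc)
  qed
  then have "?v \<bullet> ?v \<le> norm ?v * (L * norm h)" by (intro LIMSEQ_le_const2[OF lim]) auto
  then have "norm ?v * norm ?v \<le> norm ?v * (L * norm h)" by (simp add: power2_norm_eq_inner[symmetric] power2_eq_square)
  moreover have "0 \<le> L * norm h" using lipschitz_on_nonneg[OF f] by simp
  ultimately show ?thesis by (cases "?v = 0") (auto simp: mult_le_cancel_left)
qed

text \<open>The last conclusion is what makes the Jacobians of the mollifications of a piecewise affine map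
  converge: at almost every point they are eventually constant.\<close>

lemma mollification:
  fixes w :: "'a::euclidean_space \<Rightarrow> 'b::euclidean_space"
  assumes w: "L-lipschitz_on UNIV w" "bounded {x. w x \<noteq> 0}" and \<delta>: "\<delta> > 0"
  obtains \<phi> where "\<And>k. Ck k \<phi>" "L-lipschitz_on UNIV \<phi>" "\<And>x. norm (\<phi> x - w x) \<le> L * \<delta>"
    "\<And>x. \<phi> x \<noteq> 0 \<Longrightarrow> \<exists>y. w y \<noteq> 0 \<and> dist x y < \<delta>"
    "\<And>x D r. linear D \<Longrightarrow> \<delta> < r \<Longrightarrow> (\<And>y. y \<in> ball x r \<Longrightarrow> w y = w x + D (y - x)) \<Longrightarrow> aff_at \<phi> D x"
proof -
  obtain \<rho> :: "'a \<Rightarrow> real" where \<rho>: "\<And>k. Ck k \<rho>" "\<And>x. 0 \<le> \<rho> x" "\<And>x. \<rho> x \<noteq> 0 \<Longrightarrow> norm x < \<delta>"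
    "\<And>x. \<rho> (- x) = \<rho> x" "integrable lebesgue \<rho>" "(LINT x|lebesgue. \<rho> x) = 1"
    by (rule mollifier[OF \<delta>]) (rule that; assumption)
  obtain a b where ab: "{x. w x \<noteq> 0} \<subseteq> cbox a b" using bounded_subset_cbox_symmetric[OF w(2)] by blast
  have cw: "continuous_on UNIV w" using lipschitz_on_continuous_on[OF w(1)] .
  have c\<rho>: "continuous_on UNIV \<rho>" using \<rho>(1)[of 0] by simp
  define \<phi> where "\<phi> = mollify (cbox a b) \<rho> w"
  have \<phi>: "\<phi> x = (LINT z|lebesgue. \<rho> z *\<^sub>R w (x + z))" for x
    unfolding \<phi>_def by (rule mollify_eq_convolution[OF cw _ c\<rho> \<rho>(4)]) (use ab in auto)
  have i: "integrable lebesgue (\<lambda>z. \<rho> z *\<^sub>R f z)" if f: "continuous_on UNIV f" for f :: "'a \<Rightarrow> 'b"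
  proof (rule integrable_lebesgue_continuous_bounded_support)
    show "continuous_on UNIV (\<lambda>z. \<rho> z *\<^sub>R f z)" by (intro continuous_intros c\<rho> f)
    show "z \<notin> cball 0 \<delta> \<Longrightarrow> \<rho> z *\<^sub>R f z = 0" for z using \<rho>(3)[of z] by force
  qed
  have cx: "continuous_on UNIV (\<lambda>z. w (x + z))" for x
    by (intro continuous_on_compose2[OF cw] continuous_intros) auto
  \<comment> \<open>The kernel is a probability density on the ball of radius
    \<open>\<delta>\<close>, so averages keep any bound valid on that ball.\<close>
  have bnd: "norm (LINT z|lebesgue. \<rho> z *\<^sub>R f z) \<le> C" if f: "continuous_on UNIV f" and le: "\<And>z. norm z < \<delta> \<Longrightarrow> norm (f z) \<le> C" 
    for f :: "'a \<Rightarrow> 'b" and C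
  proof -
    have "norm (LINT z|lebesgue. \<rho> z *\<^sub>R f z) \<le> (LINT z|lebesgue. norm (\<rho> z *\<^sub>R f z))" by (rule integral_norm_bound)
    also have "\<dots> \<le> (LINT z|lebesgue. \<rho> z * C)"
    proof (rule integral_mono)
      show "integrable lebesgue (\<lambda>z. norm (\<rho> z *\<^sub>R f z))" using i[OF f] by (rule integrable_norm)
      show "integrable lebesgue (\<lambda>z. \<rho> z * C)" using \<rho>(5) by simp
      show "norm (\<rho> z *\<^sub>R f z) \<le> \<rho> z * C" for z
        using \<rho>(2)[of z] \<rho>(3)[of z] le[of z] by (cases "\<rho> z = 0") (auto intro: mult_left_mono)
    qed
    also have "\<dots> = C" using \<rho>(5,6) by simp
    finally show ?thesis .
  qed
  have diff: "(LINT z|lebesgue. \<rho> z *\<^sub>R f z) - (LINT z|lebesgue. \<rho> z *\<^sub>R g z) = (LINT z|lebesgue. \<rho> z *\<^sub>R (f z - g z))"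
    if "continuous_on UNIV f" "continuous_on UNIV g" for f g :: "'a \<Rightarrow> 'b"
    using Bochner_Integration.integral_diff[OF i[OF that(1)] i[OF that(2)]] by (simp add: scaleR_diff_right)
  have cst: "(LINT z|lebesgue. \<rho> z *\<^sub>R v) = v" for v :: 'b using \<rho>(5,6) by simp
  show ?thesis
  proof (rule that)
    show "Ck k \<phi>" for k unfolding \<phi>_def by (rule Ck_mollify[OF cw \<rho>(1)])
    show "L-lipschitz_on UNIV \<phi>"
    proof (rule lipschitz_onI)
      show "0 \<le> L" using w(1) by (rule lipschitz_on_nonneg)
      fix x y
      have "norm (\<phi> x - \<phi> y) \<le> L * dist x y" unfolding \<phi> diff[OF cx cx]
      proof (rule bnd)
        show "continuous_on UNIV (\<lambda>z. w (x + z) - w (y + z))" by (intro continuous_intros cx)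
        show "norm (w (x + z) - w (y + z)) \<le> L * dist x y" for z
          using lipschitz_onD[OF w(1), of "x + z" "y + z"] by (simp add: dist_norm)
      qed
      then show "dist (\<phi> x) (\<phi> y) \<le> L * dist x y" by (simp add: dist_norm)
    qed
    show "norm (\<phi> x - w x) \<le> L * \<delta>" for x
    proof -
      have "\<phi> x - w x = (LINT z|lebesgue. \<rho> z *\<^sub>R (w (x + z) - w x))"
        using diff[OF cx[of x] continuous_on_const[of UNIV "w x"]] unfolding \<phi> cst .
      also have "norm \<dots> \<le> L * \<delta>"
      proof (rule bnd)
        show "continuous_on UNIV (\<lambda>z. w (x + z) - w x)" by (intro continuous_intros cx)
        fix z :: 'a assume z: "norm z < \<delta>"
        have "norm (w (x + z) - w x) \<le> L * norm z"
          using lipschitz_onD[OF w(1), of "x + z" x] by (simp add: dist_norm)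
        also have "\<dots> \<le> L * \<delta>" using z lipschitz_on_nonneg[OF w(1)] by (intro mult_left_mono) auto
        finally show "norm (w (x + z) - w x) \<le> L * \<delta>" .
      qed
      finally show ?thesis .
    qed
    show "\<exists>y. w y \<noteq> 0 \<and> dist x y < \<delta>" if "\<phi> x \<noteq> 0" for x
    proof (rule ccontr)
      assume n: "\<not> ?thesis"
      have z0: "\<rho> z *\<^sub>R w (x + z) = 0" for z
        using n[unfolded not_ex, rule_format, of "x + z"] \<rho>(3)[of z] by (auto simp: dist_norm)
      have "\<phi> x = 0" unfolding \<phi> z0 by simp
      then show False using \<open>\<phi> x \<noteq> 0\<close> by simp
    qed
    show "aff_at \<phi> D x" if D: "linear D" and r: "\<delta> < r" and aff: "\<And>y. y \<in> ball x r \<Longrightarrow> w y = w x + D (y - x)" for x D r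
    proof (rule aff_atI[OF D open_ball])
      show "x \<in> ball x (r - \<delta>)" using r by simp
      fix y assume y: "y \<in> ball x (r - \<delta>)"
      have cD: "continuous_on UNIV D" using D by (simp add: linear_continuous_on linear_conv_bounded_linear)
      have "\<phi> y - (w x - D x + D y) = (LINT z|lebesgue. \<rho> z *\<^sub>R (w (y + z) - (w x - D x + D y)))"
        using diff[OF cx[of y] continuous_on_const[of UNIV "w x - D x + D y"]] unfolding \<phi> cst .
      \<comment> \<open>For \<open>y\<close> in the smaller ball all points \<open>y + z\<close>
        that matter stay in \<open>ball x r\<close>. The remaining average of \<open>D z\<close>
        does not depend on \<open>y\<close>, so it only shifts the additive constant and leaves the
        linear part \<open>D\<close>.\<close>
      also have "\<dots> = (LINT z|lebesgue. \<rho> z *\<^sub>R D z)"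
      proof (rule Bochner_Integration.integral_cong[OF refl])
        fix z
        show "\<rho> z *\<^sub>R (w (y + z) - (w x - D x + D y)) = \<rho> z *\<^sub>R D z"
        proof (cases "\<rho> z = 0")
          case False
          then have "norm z < \<delta>" by (rule \<rho>(3))
          then have "y + z \<in> ball x r" using y norm_triangle_ineq[of "y - x" z]
            by (simp add: dist_norm norm_minus_commute[of x] algebra_simps)
          then have "w (y + z) = w x + D (y + z - x)" by (rule aff)
          then show ?thesis using D by (simp add: linear_add linear_diff)
        qed simp
      qed
      finally show "\<phi> y = (w x - D x + (LINT z|lebesgue. \<rho> z *\<^sub>R D z)) + D y" by (simp add: algebra_simps)
    qed
  qed
qed

section \<open>Sobolev properties of piecewise affine maps\<close>

lemma AE_lebesgue_on:
  assumes "AE x in lebesgue. P x" "S \<in> sets lebesgue"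
  shows "AE x in lebesgue_on S. P x"
  using assms by (subst AE_restrict_space_iff) (auto elim: eventually_mono)

lemma integrable_lebesgue_on_bounded:
  fixes f :: "'a::euclidean_space \<Rightarrow> 'b::euclidean_space"
  assumes "f \<in> borel_measurable (lebesgue_on S)" "AE x in lebesgue_on S. norm (f x) \<le> B" "S \<in> lmeasurable"
  shows "integrable (lebesgue_on S) f"
proof (rule Bochner_Integration.integrable_bound)
  show "integrable (lebesgue_on S) (\<lambda>x. B)"
    using finite_measure.integrable_const[OF finite_measure_lebesgue_on[OF assms(3)]] .
  show "f \<in> borel_measurable (lebesgue_on S)" by fact
  show "AE x in lebesgue_on S. norm (f x) \<le> norm B"
    using assms(2) by eventually_elim auto
qed

lemma lebesgue_on_measurable:
  "f \<in> borel_measurable lebesgue \<Longrightarrow> f \<in> borel_measurable (lebesgue_on S)"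
  by (rule measurable_restrict_space1)

lemma jacobian_component:
  "jacobian u (at x) $ i $ j = frechet_derivative u (at x) (axis j 1) $ i"
  by (simp add: jacobian_def matrix_def)

lemma pw_affine_jacobian_measurable:
  fixes u :: "real^'n \<Rightarrow> real^'N"
  assumes "pw_affine \<Gamma> u"
  shows "(\<lambda>x. jacobian u (at x)) \<in> borel_measurable lebesgue"
  unfolding jacobian_def by (rule pw_affine_borel_measurable[OF assms])

lemma pw_affine_jacobian_bound:
  fixes u :: "real^'n \<Rightarrow> real^'N"
  assumes "pw_affine \<Gamma> u" "L-lipschitz_on UNIV u"
  shows "AE x in lebesgue. norm (jacobian u (at x)) \<le> real (CARD('N) * CARD('n)) * L"
  using pw_affine_AE_derivative(1)[OF assms(1)]
proof eventually_elim
  case (elim x)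
  then obtain D where D: "aff_at u D x" by blast
  show ?case unfolding jacobian_aff_at[OF D]
    using aff_at_bound[OF assms(2) D] lipschitz_on_nonneg[OF assms(2)]
    by (intro norm_matrix_bound) (simp_all add: matrix_apply_linear[OF aff_at_linear[OF D]])
qed

lemma lipschitz_component:
  fixes u :: "'a::metric_space \<Rightarrow> real^'N"
  assumes "L-lipschitz_on UNIV u"
  shows "L-lipschitz_on UNIV (\<lambda>x. u x $ i)"
proof (rule lipschitz_onI)
  show "0 \<le> L" using assms by (rule lipschitz_on_nonneg)
  fix x y
  have "dist (u x $ i) (u y $ i) \<le> dist (u x) (u y)" by (rule dist_vec_nth_le)
  then show "dist (u x $ i) (u y $ i) \<le> L * dist x y" using lipschitz_onD[OF assms, of x y] by simp
qed

lemma linear_component: "linear (\<lambda>v::real^'N. v $ i)"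
  by (rule linearI) auto

lemma frechet_derivative_off_support:
  assumes "x \<notin> closure {x. \<phi> x \<noteq> 0}"
  shows "frechet_derivative \<phi> (at x) = (\<lambda>h. 0)"
proof -
  have "((\<lambda>x. 0) has_derivative (\<lambda>h. 0)) (at x)" by simp
  then have "(\<phi> has_derivative (\<lambda>h. 0)) (at x)"
    by (rule has_derivative_transform_within_open[of _ _ _ _ "- closure {x. \<phi> x \<noteq> 0}"])
       (use assms closure_subset[of "{x. \<phi> x \<noteq> 0}"] in auto)
  then show ?thesis using frechet_derivative_at by metis
qed

text \<open>The partial derivatives are continuous and vanish off a compact set, hence are bounded.
  This admits test functions to the Lipschitz integration by parts.\<close>

lemma test_function_lipschitz:
  fixes \<phi> :: "'a::euclidean_space \<Rightarrow> 'b::real_normed_vector"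
  assumes "\<phi> \<in> test_functions \<Omega>"
  obtains M where "M-lipschitz_on UNIV \<phi>"
proof -
  let ?K = "closure {x. \<phi> x \<noteq> 0}"
  have K: "compact ?K" and C: "Ck (Suc 0) \<phi>" using assms by (auto simp: test_functions_def simp del: Ck.simps)
  have "\<exists>B. \<forall>x. norm (frechet_derivative \<phi> (at x) b) \<le> B" if "b \<in> Basis" for b
  proof -
    have c: "continuous_on UNIV (\<lambda>x. frechet_derivative \<phi> (at x) b)" using Ck_SucD(2)[OF C that] by simp
    have "bounded ((\<lambda>x. frechet_derivative \<phi> (at x) b) ` ?K)"
      using compact_imp_bounded[OF compact_continuous_image[OF continuous_on_subset[OF c] K]] by simp
    then obtain B where B: "\<And>x. x \<in> ?K \<Longrightarrow> norm (frechet_derivative \<phi> (at x) b) \<le> B" unfolding bounded_iff by blast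
    have "norm (frechet_derivative \<phi> (at x) b) \<le> \<bar>B\<bar>" for x
      using B[of x] frechet_derivative_off_support[of x \<phi>] by (cases "x \<in> ?K") auto
    then show ?thesis by blast
  qed
  then obtain B where B: "\<And>b x. b \<in> Basis \<Longrightarrow> norm (frechet_derivative \<phi> (at x) b) \<le> B b" by metis
  let ?M = "\<Sum>b\<in>Basis. B b"
  have B0: "0 \<le> B b" if "b \<in> Basis" for b using B[OF that, of 0] norm_ge_zero order_trans by blast
  have d: "(\<phi> has_derivative frechet_derivative \<phi> (at x)) (at x)" for x using Ck_SucD(1)[OF C] .
  have on: "onorm (frechet_derivative \<phi> (at x)) \<le> ?M" for x
  proof (rule onorm_le)
    fix h :: 'a
    have l: "linear (frechet_derivative \<phi> (at x))" using d has_derivative_linear by blast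
    have "frechet_derivative \<phi> (at x) h = frechet_derivative \<phi> (at x) (\<Sum>b\<in>Basis. (h \<bullet> b) *\<^sub>R b)"
      by (simp only: euclidean_representation)
    also have "\<dots> = (\<Sum>b\<in>Basis. (h \<bullet> b) *\<^sub>R frechet_derivative \<phi> (at x) b)"
      using l by (simp add: linear_sum linear_scale)
    also have "norm \<dots> \<le> (\<Sum>b\<in>Basis. norm ((h \<bullet> b) *\<^sub>R frechet_derivative \<phi> (at x) b))" by (rule norm_sum)
    also have "\<dots> \<le> (\<Sum>b\<in>Basis. norm h * B b)"
      using B Basis_le_norm by (intro sum_mono) (auto intro!: mult_mono)
    finally show "norm (frechet_derivative \<phi> (at x) h) \<le> ?M * norm h" by (simp add: sum_distrib_left mult.commute)
  qed
  have "?M-lipschitz_on UNIV \<phi>"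
  proof (rule lipschitz_onI)
    show "0 \<le> ?M" using B0 by (intro sum_nonneg) auto
    fix x y
    have "norm (\<phi> x - \<phi> y) \<le> ?M * norm (x - y)"
      by (rule differentiable_bound[of UNIV \<phi> "\<lambda>x. frechet_derivative \<phi> (at x)"]) (use d on in auto)
    then show "dist (\<phi> x) (\<phi> y) \<le> ?M * dist x y" by (simp add: dist_norm)
  qed
  then show ?thesis by (rule that)
qed

lemma lebesgue_on_integral_eq:
  fixes f :: "'a::euclidean_space \<Rightarrow> real"
  assumes "S \<in> sets lebesgue" "\<And>x. x \<notin> S \<Longrightarrow> f x = 0"
  shows "(LINT x|lebesgue_on S. f x) = (LINT x|lebesgue. f x)"
proof -
  have "(LINT x|lebesgue_on S. f x) = (LINT x|lebesgue. indicator S x *\<^sub>R f x)"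
    using assms(1) by (intro integral_restrict_space) simp
  also have "\<dots> = (LINT x|lebesgue. f x)"
    using assms(2) by (intro Bochner_Integration.integral_cong) (auto simp: indicator_def)
  finally show ?thesis .
qed

text \<open>The test function carries the compact support in \<Omega>, so both integrals extend to
  the whole space, where the Lipschitz integration by parts applies to each component of
  \<open>u\<close>.\<close>

lemma pw_affine_has_weak_gradient:
  fixes u :: "real^'n \<Rightarrow> real^'N"
  assumes u: "L-lipschitz_on UNIV u" "pw_affine \<Gamma> u" and \<Omega>: "open \<Omega>"
  shows "has_weak_gradient u (\<lambda>x. jacobian u (at x)) \<Omega>"
  unfolding has_weak_gradient_def
proof (intro conjI ballI allI)
  have cu: "continuous_on UNIV u" using lipschitz_on_continuous_on[OF u(1)] .
  show "u \<in> L1loc \<Omega>" unfolding L1loc_def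
  proof (safe)
    fix C :: "(real^'n) set" assume C: "compact C" "C \<subseteq> \<Omega>"
    have "bounded (u ` C)"
      using compact_imp_bounded[OF compact_continuous_image[OF continuous_on_subset[OF cu] C(1)]] by simp
    then obtain B where "\<And>x. x \<in> C \<Longrightarrow> norm (u x) \<le> B" unfolding bounded_iff by blast
    then show "integrable (lebesgue_on C) u"
      by (intro integrable_lebesgue_on_bounded[of _ _ B] lebesgue_on_measurable borel_measurable_lebesgue_continuous[OF cu]
          lmeasurable_compact C AE_I2) auto
  qed
  show "(\<lambda>x. jacobian u (at x)) \<in> L1loc \<Omega>" unfolding L1loc_def
  proof (safe)
    fix C :: "(real^'n) set" assume C: "compact C" "C \<subseteq> \<Omega>"
    show "integrable (lebesgue_on C) (\<lambda>x. jacobian u (at x))"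
      by (rule integrable_lebesgue_on_bounded[OF lebesgue_on_measurable[OF pw_affine_jacobian_measurable[OF u(2)]]
          AE_lebesgue_on[OF pw_affine_jacobian_bound[OF u(2,1)]] lmeasurable_compact[OF C(1)]])
         (use lmeasurable_compact[OF C(1)] in auto)
  qed
  fix \<phi> :: "real^'n \<Rightarrow> real" and i j
  assume \<phi>: "\<phi> \<in> test_functions \<Omega>"
  then have K: "compact (closure {x. \<phi> x \<noteq> 0})" "closure {x. \<phi> x \<noteq> 0} \<subseteq> \<Omega>" and C: "Ck (Suc 0) \<phi>"
    by (auto simp: test_functions_def simp del: Ck.simps)
  obtain M where M: "M-lipschitz_on UNIV \<phi>" by (rule test_function_lipschitz[OF \<phi>])
  let ?e = "axis j 1 :: real^'n"
  have e: "?e \<in> Basis" by (simp add: axis_in_Basis_iff)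
  have \<Omega>s: "\<Omega> \<in> sets lebesgue" using \<Omega> by auto
  have z: "\<phi> x = 0" if "x \<notin> \<Omega>" for x using that K(2) closure_subset[of "{x. \<phi> x \<noteq> 0}"] by auto
  have z': "frechet_derivative \<phi> (at x) = (\<lambda>h. 0)" if "x \<notin> \<Omega>" for x
    using that K(2) by (intro frechet_derivative_off_support) auto
  have "(LINT x|lebesgue. (\<lambda>h. frechet_derivative u (at x) h $ i) ?e * \<phi> x) = - (LINT x|lebesgue. u x $ i * frechet_derivative \<phi> (at x) ?e)"
  proof (rule integration_by_parts_lipschitz[OF lipschitz_component[OF u(1)] M])
    show "bounded {x. \<phi> x \<noteq> 0}" by (rule bounded_subset[OF compact_imp_bounded[OF K(1)] closure_subset])
    show "AE x in lebesgue. ((\<lambda>x. u x $ i) has_derivative (\<lambda>h. frechet_derivative u (at x) h $ i)) (at x)"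
      using pw_affine_AE_derivative(2)[OF u(2)]
      by eventually_elim (rule bounded_linear.has_derivative[OF bounded_linear_vec_nth])
    show "(\<lambda>x. frechet_derivative u (at x) ?e $ i) \<in> borel_measurable lebesgue"
      by (rule pw_affine_borel_measurable[OF u(2)])
    show "AE x in lebesgue. (\<phi> has_derivative frechet_derivative \<phi> (at x)) (at x)" using Ck_SucD(1)[OF C] by simp
    show "(\<lambda>x. frechet_derivative \<phi> (at x) ?e) \<in> borel_measurable lebesgue"
      using Ck_SucD(2)[OF C e] by (intro borel_measurable_lebesgue_continuous) simp
  qed
  moreover have "(LINT x|lebesgue_on \<Omega>. u x $ i * frechet_derivative \<phi> (at x) ?e) = (LINT x|lebesgue. u x $ i * frechet_derivative \<phi> (at x) ?e)"
    by (rule lebesgue_on_integral_eq[OF \<Omega>s]) (simp add: z')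
  moreover have "(LINT x|lebesgue_on \<Omega>. jacobian u (at x) $ i $ j * \<phi> x) = (LINT x|lebesgue. jacobian u (at x) $ i $ j * \<phi> x)"
    by (rule lebesgue_on_integral_eq[OF \<Omega>s]) (simp add: z)
  ultimately show "(LINT x|lebesgue_on \<Omega>. u x $ i * frechet_derivative \<phi> (at x) ?e) = - (LINT x|lebesgue_on \<Omega>. jacobian u (at x) $ i $ j * \<phi> x)"
    by (simp add: jacobian_component)
qed

lemma pw_affine_W1inf:
  fixes u :: "real^'n \<Rightarrow> real^'N"
  assumes u: "L-lipschitz_on UNIV u" "pw_affine \<Gamma> u" and \<Omega>: "open \<Omega>" "bounded \<Omega>"
  shows "u \<in> Linf \<Omega>" "(\<lambda>x. jacobian u (at x)) \<in> Linf \<Omega>" "u \<in> W1inf \<Omega>"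
proof -
  have cu: "continuous_on UNIV u" using lipschitz_on_continuous_on[OF u(1)] .
  have "compact (closure \<Omega>)" using \<Omega>(2) by simp
  from compact_imp_bounded[OF compact_continuous_image[OF continuous_on_subset[OF cu] this]]
  have "bounded (u ` closure \<Omega>)" by simp
  then obtain B where "\<And>x. x \<in> closure \<Omega> \<Longrightarrow> norm (u x) \<le> B" unfolding bounded_iff by blast
  then have "\<And>x. x \<in> \<Omega> \<Longrightarrow> norm (u x) \<le> B" using closure_subset by blast
  then show 1: "u \<in> Linf \<Omega>" unfolding Linf_def
    by (auto intro!: lebesgue_on_measurable borel_measurable_lebesgue_continuous[OF cu] exI[of _ B] AE_I2)
  have \<Omega>s: "\<Omega> \<in> sets lebesgue" using \<Omega> by auto
  show 2: "(\<lambda>x. jacobian u (at x)) \<in> Linf \<Omega>" unfolding Linf_def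
    using AE_lebesgue_on[OF pw_affine_jacobian_bound[OF u(2,1)] \<Omega>s] lebesgue_on_measurable[OF pw_affine_jacobian_measurable[OF u(2)]]
    by blast
  show "u \<in> W1inf \<Omega>" unfolding W1inf_def
    using 1 2 pw_affine_has_weak_gradient[OF u \<Omega>(1)] by blast
qed

text \<open>Mollifications of \<open>w\<close> at scales tending to 0 are test functions, because
  the support of \<open>w\<close> is a compact subset of \<Omega>. They converge uniformly, and
  their Jacobians converge almost everywhere under a common bound.\<close>

lemma pw_affine_W01inf:
  fixes w :: "real^'n \<Rightarrow> real^'N"
  assumes w: "L-lipschitz_on UNIV w" "pw_affine \<Gamma> w" "cpt_supp w \<Omega>" and \<Omega>: "open \<Omega>" "bounded \<Omega>"
  shows "w \<in> W01inf \<Omega>"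
proof -
  have \<Omega>s: "\<Omega> \<in> sets lebesgue" "\<Omega> \<in> lmeasurable" using \<Omega> by (auto simp: lmeasurable_open)
  obtain K where K: "compact K" "K \<subseteq> \<Omega>" "\<And>x. w x \<noteq> 0 \<Longrightarrow> x \<in> K" by (rule cpt_suppE[OF w(3)]) (rule that; assumption)
  have bw: "bounded {x. w x \<noteq> 0}" by (rule bounded_subset[OF compact_imp_bounded[OF K(1)]]) (use K(3) in auto)
  have "compact K \<Longrightarrow> open \<Omega> \<Longrightarrow> K \<subseteq> \<Omega> \<Longrightarrow> \<exists>d>0. (\<Union>x\<in>K. cball x d) \<subseteq> \<Omega>"
    by (rule compact_subset_open_imp_cball_epsilon_subset) auto
  then obtain d where d: "d > 0" "(\<Union>x\<in>K. cball x d) \<subseteq> \<Omega>" using K \<Omega> by blast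
  \<comment> \<open>Scales at most \<open>d\<close> keep the mollified supports within distance
    \<open>d\<close> of \<open>K\<close>, hence inside \<Omega>.\<close>
  define \<delta> where "\<delta> k = d / real (Suc (Suc k))" for k
  have \<delta>: "0 < \<delta> k" "\<delta> k \<le> d" for k using d by (auto simp: \<delta>_def field_simps)
  have \<delta>lim: "\<delta> \<longlonglongrightarrow> 0"
  proof -
    have "(\<lambda>k. d / real (Suc k)) \<longlonglongrightarrow> 0"
      using tendsto_mult[OF tendsto_const[of d] LIMSEQ_inverse_real_of_nat] by (simp add: divide_inverse)
    from LIMSEQ_Suc[OF this] show ?thesis by (simp add: \<delta>_def[abs_def])
  qed
  have "\<exists>\<phi>. (\<forall>j. Ck j \<phi>) \<and> L-lipschitz_on UNIV \<phi> \<and> (\<forall>x. norm (\<phi> x - w x) \<le> L * \<delta> k) \<and>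
    (\<forall>x. \<phi> x \<noteq> 0 \<longrightarrow> (\<exists>y. w y \<noteq> 0 \<and> dist x y < \<delta> k)) \<and>
    (\<forall>x D r. linear D \<longrightarrow> \<delta> k < r \<longrightarrow> (\<forall>y\<in>ball x r. w y = w x + D (y - x)) \<longrightarrow> aff_at \<phi> D x)" for k
    by (rule mollification[OF w(1) bw \<delta>(1)[of k]]) blast
  then obtain \<phi> where \<phi>: "\<And>k j. Ck j (\<phi> k)" "\<And>k. L-lipschitz_on UNIV (\<phi> k)" "\<And>k x. norm (\<phi> k x - w x) \<le> L * \<delta> k"
    "\<And>k x. \<phi> k x \<noteq> 0 \<Longrightarrow> (\<exists>y. w y \<noteq> 0 \<and> dist x y < \<delta> k)"
    "\<And>k x D r. linear D \<Longrightarrow> \<delta> k < r \<Longrightarrow> (\<forall>y\<in>ball x r. w y = w x + D (y - x)) \<Longrightarrow> aff_at (\<phi> k) D x"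
    by metis
  have cs: "compact (\<Union>x\<in>K. cball x d)" using compact_minkowski_sum_cball[OF K(1)] .
  have test: "\<phi> k \<in> test_functions \<Omega>" for k
  proof -
    have "cpt_supp (\<phi> k) \<Omega>"
    proof (rule cpt_suppI[OF cs d(2)])
      fix x assume "\<phi> k x \<noteq> 0"
      then obtain y where "w y \<noteq> 0" "dist x y < \<delta> k" using \<phi>(4) by blast
      then show "x \<in> (\<Union>x\<in>K. cball x d)" using K(3)[of y] \<delta>(2)[of k] by (auto intro!: bexI[of _ y] simp: dist_commute)
    qed
    then show ?thesis using \<phi>(1) by (simp add: test_functions_def cpt_supp_def)
  qed
  have cw: "continuous_on UNIV w" using lipschitz_on_continuous_on[OF w(1)] .
  have l1: "(\<lambda>k. LINT x|lebesgue_on \<Omega>. norm (\<phi> k x - w x)) \<longlonglongrightarrow> 0"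
  proof (rule tendsto_sandwich[OF _ _ tendsto_const])
    show "\<forall>\<^sub>F k in sequentially. 0 \<le> (LINT x|lebesgue_on \<Omega>. norm (\<phi> k x - w x))"
      by (intro always_eventually allI integral_nonneg_AE) auto
    have "(LINT x|lebesgue_on \<Omega>. norm (\<phi> k x - w x)) \<le> (LINT x|lebesgue_on \<Omega>. L * \<delta> k)" for k
    proof (rule integral_mono)
      have c: "continuous_on UNIV (\<lambda>x. norm (\<phi> k x - w x))"
        using \<phi>(1)[of 0 k] cw by (auto intro!: continuous_intros)
      show "integrable (lebesgue_on \<Omega>) (\<lambda>x. norm (\<phi> k x - w x))"
        by (rule integrable_lebesgue_on_bounded[OF lebesgue_on_measurable[OF borel_measurable_lebesgue_continuous[OF c]] _ \<Omega>s(2), of "L * \<delta> k"])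
           (use \<phi>(3) in auto)
      show "integrable (lebesgue_on \<Omega>) (\<lambda>x. L * \<delta> k)"
        by (rule integrable_lebesgue_on_bounded[OF _ _ \<Omega>s(2), of _ "\<bar>L * \<delta> k\<bar>"]) auto
      show "norm (\<phi> k x - w x) \<le> L * \<delta> k" for x by (rule \<phi>(3))
    qed
    then show "\<forall>\<^sub>F k in sequentially. (LINT x|lebesgue_on \<Omega>. norm (\<phi> k x - w x)) \<le> L * \<delta> k * measure (lebesgue_on \<Omega>) \<Omega>"
      by (intro always_eventually allI) (simp add: mult_ac)
    show "(\<lambda>k. L * \<delta> k * measure (lebesgue_on \<Omega>) \<Omega>) \<longlonglongrightarrow> 0"
      using tendsto_mult[OF tendsto_mult[OF tendsto_const[of L] \<delta>lim] tendsto_const] by simp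
  qed
  let ?B = "real (CARD('N) * CARD('n)) * L"
  have jm: "(\<lambda>x. jacobian (\<phi> k) (at x)) \<in> borel_measurable lebesgue" for k
  proof (rule borel_measurable_lebesgue_continuous)
    have "continuous_on UNIV (\<lambda>x. frechet_derivative (\<phi> k) (at x) (axis j 1))" for j
      using Ck_SucD(2)[OF \<phi>(1)[of "Suc 0" k], of "axis j 1"] by (simp add: axis_in_Basis_iff)
    then show "continuous_on UNIV (\<lambda>x. jacobian (\<phi> k) (at x))"
      unfolding jacobian_def matrix_def by (intro continuous_intros)
  qed
  have l2: "(\<lambda>k. LINT x|lebesgue_on \<Omega>. norm (jacobian (\<phi> k) (at x) - jacobian w (at x))) \<longlonglongrightarrow> (LINT x|lebesgue_on \<Omega>. 0)"
  proof (rule integral_dominated_convergence)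
    \<comment> \<open>Mollification does not increase the Lipschitz constant, so \<open>?B\<close>
      bounds both Jacobians and their sum of bounds dominates.\<close>
    show "integrable (lebesgue_on \<Omega>) (\<lambda>x. ?B + ?B)"
      by (rule integrable_lebesgue_on_bounded[OF _ _ \<Omega>s(2), of _ "\<bar>?B + ?B\<bar>"]) auto
    show "(\<lambda>x. norm (jacobian (\<phi> k) (at x) - jacobian w (at x))) \<in> borel_measurable (lebesgue_on \<Omega>)" for k
    proof (rule lebesgue_on_measurable)
      note [measurable] = jm pw_affine_jacobian_measurable[OF w(2)]
      show "(\<lambda>x. norm (jacobian (\<phi> k) (at x) - jacobian w (at x))) \<in> borel_measurable lebesgue" by measurable
    qed
    show "AE x in lebesgue_on \<Omega>. (\<lambda>k. norm (jacobian (\<phi> k) (at x) - jacobian w (at x))) \<longlonglongrightarrow> 0"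
    proof (rule AE_lebesgue_on[OF _ \<Omega>s(1)])
      show "AE x in lebesgue. (\<lambda>k. norm (jacobian (\<phi> k) (at x) - jacobian w (at x))) \<longlonglongrightarrow> 0"
        using pw_affine_AE_derivative(1)[OF w(2)]
      proof eventually_elim
        case (elim x)
        then obtain D where D: "aff_at w D x" by blast
        then obtain r where r: "linear D" "r > 0" "\<forall>y\<in>ball x r. w y = w x + D (y - x)" unfolding aff_at_def by blast
        have "\<forall>\<^sub>F k in sequentially. \<delta> k < r" using \<delta>lim r(2) by (rule order_tendstoD)
        then have "\<forall>\<^sub>F k in sequentially. norm (jacobian (\<phi> k) (at x) - jacobian w (at x)) = 0"
        proof eventually_elim
          case (elim k)
          show ?case using jacobian_aff_at[OF \<phi>(5)[OF r(1) elim r(3)]] jacobian_aff_at[OF D] by simp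
        qed
        then show ?case by (rule tendsto_eventually)
      qed
    qed
    show "AE x in lebesgue_on \<Omega>. norm (norm (jacobian (\<phi> k) (at x) - jacobian w (at x))) \<le> ?B + ?B" for k
    proof (rule AE_lebesgue_on[OF _ \<Omega>s(1)])
      show "AE x in lebesgue. norm (norm (jacobian (\<phi> k) (at x) - jacobian w (at x))) \<le> ?B + ?B"
        using pw_affine_jacobian_bound[OF w(2,1)]
      proof eventually_elim
        case (elim x)
        have d: "(\<phi> k has_derivative frechet_derivative (\<phi> k) (at x)) (at x)" using Ck_SucD(1)[OF \<phi>(1)[of "Suc 0" k]] .
        have "norm (jacobian (\<phi> k) (at x)) \<le> ?B"
          unfolding jacobian_def
          using has_derivative_lipschitz_bound[OF \<phi>(2) d] lipschitz_on_nonneg[OF w(1)]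
          by (intro norm_matrix_bound) (simp_all add: matrix_apply_linear[OF has_derivative_linear[OF d]])
        then show ?case using elim norm_triangle_ineq4[of "jacobian (\<phi> k) (at x)" "jacobian w (at x)"]
          unfolding real_norm_def abs_norm_cancel by linarith
      qed
    qed
  qed simp
  have iw: "integrable (lebesgue_on \<Omega>) w"
  proof -
    have "w \<in> Linf \<Omega>" using pw_affine_W1inf(1)[OF w(1,2) \<Omega>] .
    then show ?thesis unfolding Linf_def using integrable_lebesgue_on_bounded \<Omega>s(2) by blast
  qed
  have iJ: "integrable (lebesgue_on \<Omega>) (\<lambda>x. jacobian w (at x))"
  proof -
    have "(\<lambda>x. jacobian w (at x)) \<in> Linf \<Omega>" using pw_affine_W1inf(2)[OF w(1,2) \<Omega>] .
    then show ?thesis unfolding Linf_def using integrable_lebesgue_on_bounded \<Omega>s(2) by blast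
  qed
  have "w \<in> W011 \<Omega>" unfolding W011_def
    using iw iJ pw_affine_has_weak_gradient[OF w(1,2) \<Omega>(1)] test l1 l2 by auto
  then show ?thesis unfolding W01inf_def using pw_affine_W1inf(3)[OF w(1,2) \<Omega>] by simp
qed

text \<open>Almost every point of \<Omega> is the centre of arbitrarily small balls on which
  \<open>u\<close> is affine. Vitali's theorem selects countably many disjoint ones that cover
  \<Omega> up to a null set.\<close>

lemma pw_affine_Aff_piec:
  fixes u :: "real^'n \<Rightarrow> real^'N"
  assumes u: "L-lipschitz_on UNIV u" "pw_affine \<Gamma> u" and \<Omega>: "open \<Omega>" "bounded \<Omega>"
  shows "u \<in> Aff_piec \<Omega>"
proof -
  define S where "S = {x \<in> \<Omega>. \<exists>D\<in>\<Gamma>. aff_at u D x}"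
  define P where "P = {(x, r). ball x r \<subseteq> \<Omega> \<and> (\<exists>\<xi>. affine_with_gradient (ball x r) \<xi> u)}"
  have cover: "\<exists>i. i \<in> P \<and> x \<in> ball (fst i) (snd i) \<and> snd i < d" if x: "x \<in> S" and "0 < d" for x and d :: real
  proof -
    obtain D where D: "aff_at u D x" using x by (auto simp: S_def)
    obtain r c where r: "r > 0" "\<And>y. y \<in> ball x r \<Longrightarrow> u y = c + D y" using aff_at_nbhd[OF D] by metis
    have "x \<in> \<Omega>" using x by (simp add: S_def)
    then obtain s where s: "s > 0" "ball x s \<subseteq> \<Omega>" using openE[OF \<Omega>(1)] by metis
    \<comment> \<open>The entry \<open>d / 2\<close> makes the radius strictly smaller than
      \<open>d\<close>, as a Vitali covering demands.\<close>
    define q where "q = min (min r s) (d / 2)"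
    have q: "q > 0" "q \<le> r" "q \<le> s" "q < d" using r s \<open>0 < d\<close> by (auto simp: q_def)
    have "u y = matrix D *v y + c" if "y \<in> ball x q" for y
    proof -
      have "y \<in> ball x r" using that q(2) by simp
      then show ?thesis using r(2)[of y] by (simp add: matrix_apply_linear[OF aff_at_linear[OF D]])
    qed
    then have "affine_with_gradient (ball x q) (matrix D) u" unfolding affine_with_gradient_def by blast
    moreover have "ball x q \<subseteq> \<Omega>" using s(2) q(3) subset_ball[of q s x] by blast
    ultimately show ?thesis using q by (intro exI[of _ "(x, q)"]) (auto simp: P_def)
  qed
  obtain C where C: "countable C" "C \<subseteq> P" "pairwise (\<lambda>i j. disjnt (ball (fst i) (snd i)) (ball (fst j) (snd j))) C"
     "negligible (S - (\<Union>i\<in>C. ball (fst i) (snd i)))"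
  proof (rule Vitali_covering_theorem_balls[of S P fst snd])
    show "\<exists>i. i \<in> P \<and> x \<in> ball (fst i) (snd i) \<and> snd i < d" if "x \<in> S" "0 < d" for x d
      using that by (rule cover)
  qed
  \<comment> \<open>Enumerates the balls by natural numbers; codes that no ball of \<open>C\<close>
    uses yield empty pieces, so a finite \<open>C\<close> needs no separate treatment.\<close>
  define B where "B k = (\<Union>i\<in>{i \<in> C. to_nat_on C i = k}. ball (fst i) (snd i))" for k
  have inj: "inj_on (to_nat_on C) C" using C(1) by (rule inj_on_to_nat_on)
  have dis: "disjoint_family B"
    unfolding disjoint_family_on_def
  proof (intro ballI impI)
    fix m n :: nat assume "m \<noteq> n"
    then show "B m \<inter> B n = {}"
      using C(3) unfolding B_def pairwise_def disjnt_def by fastforce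
  qed
  have BP: "open (B k) \<and> B k \<subseteq> \<Omega> \<and> (\<exists>\<xi>. affine_with_gradient (B k) \<xi> u)" for k
  proof (cases "\<exists>i\<in>C. to_nat_on C i = k")
    case True
    then obtain i where i: "i \<in> C" "to_nat_on C i = k" by blast
    have "{i \<in> C. to_nat_on C i = k} = {i}" using i inj by (auto simp: inj_on_def)
    then have "B k = ball (fst i) (snd i)" unfolding B_def by simp
    then show ?thesis using i(1) C(2) by (auto simp: P_def split_def)
  next
    case False
    then have "B k = {}" by (auto simp: B_def)
    then show ?thesis by (simp add: affine_with_gradient_def)
  qed
  have "(\<Union>k. B k) = (\<Union>i\<in>C. ball (fst i) (snd i))" by (auto simp: B_def)
  moreover have "negligible (\<Omega> - (\<Union>i\<in>C. ball (fst i) (snd i)))"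
  proof (rule negligible_subset)
    show "negligible ((S - (\<Union>i\<in>C. ball (fst i) (snd i))) \<union> {x. \<not> (\<exists>D\<in>\<Gamma>. aff_at u D x)})"
      using C(4) u(2) unfolding pw_affine_def by simp
  qed (auto simp: S_def)
  ultimately have neg: "negligible (\<Omega> - (\<Union>k. B k))" by simp
  have "continuous_on (closure \<Omega>) u" using lipschitz_on_continuous_on[OF u(1)] continuous_on_subset by blast
  then show ?thesis unfolding Aff_piec_def using pw_affine_W1inf(3)[OF u \<Omega>] dis BP neg by blast
qed

section \<open>Weak* convergence of gradients\<close>

text \<open>A uniform bound on the functions \<open>G \<nu>\<close> makes the pairing equicontinuous
  in L1, so that convergence has to be checked only on the indicators, whose span is dense.\<close>

lemma bounded_weak_star_null:
  fixes G :: "nat \<Rightarrow> 'a \<Rightarrow> real"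
  assumes Gm: "\<And>\<nu>. G \<nu> \<in> borel_measurable M" and Gb: "\<And>\<nu>. AE x in M. \<bar>G \<nu> x\<bar> \<le> C"
    and base: "\<And>A. A \<in> sets M \<Longrightarrow> emeasure M A < \<infinity> \<Longrightarrow> (\<lambda>\<nu>. LINT x|M. G \<nu> x * indicator A x) \<longlonglongrightarrow> 0"
    and h: "integrable M h"
  shows "(\<lambda>\<nu>. LINT x|M. G \<nu> x * h x) \<longlonglongrightarrow> 0"
proof -
  have i: "integrable M (\<lambda>x. G \<nu> x * f x)" if f: "integrable M f" for f :: "'a \<Rightarrow> real" and \<nu>
  proof (rule Bochner_Integration.integrable_bound)
    show "integrable M (\<lambda>x. C * f x)" using f by simp
    show "(\<lambda>x. G \<nu> x * f x) \<in> borel_measurable M" using Gm f by (intro borel_measurable_times) auto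
    show "AE x in M. norm (G \<nu> x * f x) \<le> norm (C * f x)" using Gb[of \<nu>]
      by eventually_elim (auto simp: abs_mult intro!: mult_right_mono)
  qed
  show ?thesis using h
  proof (induction h rule: integrable_induct)
    case (base A c)
    have "(\<lambda>\<nu>. (LINT x|M. G \<nu> x * indicator A x) * c) \<longlonglongrightarrow> 0 * c"
      by (intro tendsto_mult assms(3) base tendsto_const)
    moreover have "(LINT x|M. G \<nu> x * (indicator A x *\<^sub>R c)) = (LINT x|M. G \<nu> x * indicator A x) * c" for \<nu>
      by (simp add: mult.assoc[symmetric] del: integral_mult_left_zero flip: integral_mult_left_zero)
    ultimately show ?case by simp
  next
    case (add f g)
    have "(LINT x|M. G \<nu> x * (f x + g x)) = (LINT x|M. G \<nu> x * f x) + (LINT x|M. G \<nu> x * g x)" for \<nu>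
      using Bochner_Integration.integral_add[OF i[OF add.hyps(1)] i[OF add.hyps(2)]] by (simp add: distrib_left)
    then show ?case using tendsto_add[OF add.IH] by simp
  next
    case (lim f s)
    \<comment> \<open>L1 convergence of the approximations: \<open>s k\<close> is at most twice
      \<open>f\<close> in norm, hence the dominating function \<open>3 * norm (f x)\<close>.\<close>
    have "(\<lambda>k. LINT x|M. norm (s k x - f x)) \<longlonglongrightarrow> (LINT x|M. 0)"
    proof (rule integral_dominated_convergence)
      show "integrable M (\<lambda>x. 3 * norm (f x))" using lim.hyps by simp
      show "(\<lambda>x. norm (s k x - f x)) \<in> borel_measurable M" for k
        using borel_measurable_diff[OF borel_measurable_integrable[OF lim.hyps(1)[of k]] borel_measurable_integrable[OF lim.hyps(4)]] by measurable
      show "AE x in M. (\<lambda>k. norm (s k x - f x)) \<longlonglongrightarrow> 0"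
      proof (rule AE_I2)
        fix x assume "x \<in> space M"
        then have "(\<lambda>k. s k x) \<longlonglongrightarrow> f x" by (rule lim.hyps)
        then show "(\<lambda>k. norm (s k x - f x)) \<longlonglongrightarrow> 0" by (intro tendsto_norm_zero LIM_zero)
      qed
      show "AE x in M. norm (norm (s k x - f x)) \<le> 3 * norm (f x)" for k
      proof (rule AE_I2)
        fix x assume "x \<in> space M"
        then have "norm (s k x) \<le> 2 * norm (f x)" by (rule lim.hyps)
        then show "norm (norm (s k x - f x)) \<le> 3 * norm (f x)" by simp
      qed
    qed simp
    then have sl: "(\<lambda>k. LINT x|M. norm (s k x - f x)) \<longlonglongrightarrow> 0" by simp
    show ?case
    proof (rule LIMSEQ_I)
      fix e :: real assume e: "0 < e"
      \<comment> \<open>An approximation this close changes every pairing by less than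
        \<open>e / 2\<close>, for all \<nu> at once; the summand 1 covers
        \<open>C = 0\<close>.\<close>
      have "0 < e / (2 * (\<bar>C\<bar> + 1))" using e by simp
      from order_tendstoD(2)[OF sl this] obtain k where k: "(LINT x|M. norm (s k x - f x)) < e / (2 * (\<bar>C\<bar> + 1))"
        by (auto simp: eventually_sequentially)
      have k': "(\<bar>C\<bar> + 1) * (LINT x|M. norm (s k x - f x)) < e / 2"
        using k by (simp add: field_simps)
      obtain N where N: "\<And>\<nu>. \<nu> \<ge> N \<Longrightarrow> norm ((LINT x|M. G \<nu> x * s k x) - 0) < e / 2"
        using LIMSEQ_D[OF lim.IH[of k], of "e / 2"] e by auto
      have "norm ((LINT x|M. G \<nu> x * f x) - 0) < e" if "\<nu> \<ge> N" for \<nu>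
      proof -
        have isf: "integrable M (\<lambda>x. s k x - f x)" using lim.hyps by simp
        have "(LINT x|M. G \<nu> x * s k x) - (LINT x|M. G \<nu> x * f x) = (LINT x|M. G \<nu> x * (s k x - f x))"
          using Bochner_Integration.integral_diff[OF i[OF lim.hyps(1)[of k]] i[OF lim.hyps(4)]] by (simp add: right_diff_distrib)
        also have "\<bar>\<dots>\<bar> \<le> (LINT x|M. \<bar>G \<nu> x * (s k x - f x)\<bar>)" by (rule integral_abs_bound)
        also have "\<dots> \<le> (LINT x|M. (\<bar>C\<bar> + 1) * norm (s k x - f x))"
        proof (rule integral_mono_AE)
          show "integrable M (\<lambda>x. \<bar>G \<nu> x * (s k x - f x)\<bar>)" using i[OF isf] by simp
          show "integrable M (\<lambda>x. (\<bar>C\<bar> + 1) * norm (s k x - f x))" using isf by simp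
          show "AE x in M. \<bar>G \<nu> x * (s k x - f x)\<bar> \<le> (\<bar>C\<bar> + 1) * norm (s k x - f x)" using Gb[of \<nu>]
            by eventually_elim (auto simp: abs_mult intro!: mult_right_mono)
        qed
        also have "\<dots> < e / 2" using k' by simp
        finally show ?thesis using N[OF that] unfolding real_norm_def diff_0_right by linarith
      qed
      then show "\<exists>N. \<forall>\<nu>\<ge>N. norm ((LINT x|M. G \<nu> x * f x) - 0) < e" by blast
    qed
  qed
qed

text \<open>The gradients are only bounded; it is the functions that tend to 0. An indicator is
  replaced by a Lipschitz cutoff, onto which the derivative is then moved. The constants
  \<open>L \<nu>\<close> may be unbounded, since only \<open>C\<close> and
  \<open>\<epsilon> \<nu>\<close> enter the estimates.\<close>

lemma gradient_weak_star_null: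
  fixes v :: "nat \<Rightarrow> 'a::euclidean_space \<Rightarrow> real"
  assumes v: "\<And>\<nu>. (L \<nu>)-lipschitz_on UNIV (v \<nu>)" "\<And>\<nu>. pw_affine UNIV (v \<nu>)"
    and C: "\<And>\<nu>. AE x in lebesgue. \<bar>frechet_derivative (v \<nu>) (at x) e\<bar> \<le> C"
    and s: "\<And>\<nu> x. \<bar>v \<nu> x\<bar> \<le> \<epsilon> \<nu>" "\<epsilon> \<longlonglongrightarrow> 0"
    and \<Omega>: "open \<Omega>" "bounded \<Omega>" and h: "integrable (lebesgue_on \<Omega>) h"
  shows "(\<lambda>\<nu>. LINT x|lebesgue_on \<Omega>. frechet_derivative (v \<nu>) (at x) e * h x) \<longlonglongrightarrow> 0"
proof -
  let ?G = "\<lambda>\<nu> x. frechet_derivative (v \<nu>) (at x) e"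
  have \<Omega>s: "\<Omega> \<in> sets lebesgue" "\<Omega> \<in> lmeasurable" using \<Omega> by (auto simp: lmeasurable_open)
  have Gm: "?G \<nu> \<in> borel_measurable lebesgue" for \<nu> by (rule pw_affine_borel_measurable[OF v(2)])
  have ind: "integrable lebesgue (\<lambda>x. indicator S x * c :: real)" if "S \<in> lmeasurable" for S :: "'a set" and c
    using that by (intro integrable_mult_left integrable_real_indicator) (auto simp: fmeasurable_def)
  have indv: "(LINT x|lebesgue. indicator S x * c :: real) = c * measure lebesgue S" if "S \<in> lmeasurable" for S :: "'a set" and c
    using that by (simp add: fmeasurable_def)
  have base: "(\<lambda>\<nu>. LINT x|lebesgue_on \<Omega>. ?G \<nu> x * indicator A x) \<longlonglongrightarrow> 0" if A: "A \<in> sets (lebesgue_on \<Omega>)" for A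
  proof (rule LIMSEQ_I)
    fix r :: real assume r: "0 < r"
    have A\<Omega>: "A \<subseteq> \<Omega>" "A \<in> sets lebesgue" using A \<Omega>s by (auto simp: sets_restrict_space_iff)
    have mA: "A \<in> lmeasurable" using A\<Omega> \<Omega>s fmeasurableI2 by blast
    \<comment> \<open>The cutoff will differ from the indicator of \<open>A\<close> on a set of
      measure at most \<open>2 * \<eta>\<close>, so the replacement costs at most
      \<open>r / 2\<close>.\<close>
    define \<eta> where "\<eta> = r / (4 * (\<bar>C\<bar> + 1))"
    have \<eta>: "\<eta> > 0" using r by (simp add: \<eta>_def)
    obtain K where K: "closed K" "K \<subseteq> A" "A - K \<in> lmeasurable" "emeasure lebesgue (A - K) < ennreal \<eta>"
      using sets_lebesgue_inner_closed[OF A\<Omega>(2) \<eta>] by blast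
    obtain T where T: "open T" "A \<subseteq> T" "T - A \<in> lmeasurable" "emeasure lebesgue (T - A) < ennreal \<eta>"
      using sets_lebesgue_outer_open[OF A\<Omega>(2) \<eta>] by blast
    have "bounded K" using bounded_subset[OF \<Omega>(2)] A\<Omega>(1) K(2) by blast
    then have cK: "compact K" using K(1) by (simp add: compact_eq_bounded_closed)
    have oT: "open (T \<inter> \<Omega>)" using T(1) \<Omega>(1) by (rule open_Int)
    have KT: "K \<subseteq> T \<inter> \<Omega>" using K(2) T(2) A\<Omega>(1) by blast
    obtain d M where d: "M-lipschitz_on UNIV d" "pw_affine UNIV d" "\<And>x. 0 \<le> d x"
      "cpt_supp d (T \<inter> \<Omega>)" "\<And>x. x \<in> K \<Longrightarrow> 0 < (d x :: real)"
      by (rule cutoff_function[OF oT cK KT]) (rule that; assumption)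
    obtain m where m: "m > 0" "\<And>x. x \<in> K \<Longrightarrow> m \<le> d x"
      using compact_positive_lower_bound[OF cK continuous_on_subset[OF lipschitz_on_continuous_on[OF d(1)]] d(5)] by auto
    \<comment> \<open>Rescaling by the minimum \<open>m\<close> and capping at 1 gives a function
      that equals 1 on \<open>K\<close>, lies between 0 and 1, and is supported inside
      \<open>T\<close> and \<Omega>.\<close>
    define \<phi> where "\<phi> x = min 1 (inverse m * d x)" for x
    define M' where "M' = inverse m * M"
    have dl: "M'-lipschitz_on UNIV (\<lambda>x. inverse m * d x)"
      unfolding M'_def using m(1) by (intro lipschitz_on_cmult_real_nonneg d(1)) auto
    have M'0: "0 \<le> M'" using lipschitz_on_nonneg[OF dl] .
    have \<phi>l: "M'-lipschitz_on UNIV \<phi>" unfolding \<phi>_def[abs_def]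
      by (intro lipschitz_on_min dl lipschitz_on_mono[OF lipschitz_on_constant]) (use M'0 in auto)
    have dp: "pw_affine UNIV (\<lambda>x. inverse m * d x)"
      by (rule pw_affine_compose[OF d(2)]) (auto intro: linearI simp: algebra_simps)
    have \<phi>p: "pw_affine UNIV \<phi>" unfolding \<phi>_def[abs_def]
      by (intro pw_affine_min dp pw_affine_const lipschitz_on_continuous_on[OF dl]) auto
    have \<phi>0: "0 \<le> \<phi> x" "\<phi> x \<le> 1" for x using d(3)[of x] m(1) by (auto simp: \<phi>_def)
    have \<phi>1: "\<phi> x = 1" if "x \<in> K" for x using m(2)[OF that] m(1) by (auto simp: \<phi>_def min_def field_simps)
    obtain K' where K': "compact K'" "K' \<subseteq> T \<inter> \<Omega>" "\<And>x. d x \<noteq> 0 \<Longrightarrow> x \<in> K'" by (rule cpt_suppE[OF d(4)]) (rule that; assumption)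
    have \<phi>s: "x \<in> K'" if "\<phi> x \<noteq> 0" for x
    proof (rule K'(3))
      show "d x \<noteq> 0" using \<open>\<phi> x \<noteq> 0\<close> by (auto simp: \<phi>_def)
    qed
    have \<phi>bd: "bounded {x. \<phi> x \<noteq> 0}" by (rule bounded_subset[OF compact_imp_bounded[OF K'(1)]]) (use \<phi>s in auto)
    have cl: "closure {x. \<phi> x \<noteq> 0} \<subseteq> \<Omega>"
    proof -
      have "closure {x. \<phi> x \<noteq> 0} \<subseteq> K'" using \<phi>s by (intro closure_minimal compact_imp_closed[OF K'(1)]) auto
      then show ?thesis using K'(2) by blast
    qed
    define mu where "mu = measure lebesgue \<Omega>"
    have mu0: "0 \<le> mu" by (simp add: mu_def)
    have cv: "continuous_on UNIV (v \<nu>)" for \<nu> using lipschitz_on_continuous_on[OF v(1)] .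
    have c\<phi>: "continuous_on UNIV \<phi>" using lipschitz_on_continuous_on[OF \<phi>l] .
    let ?d\<phi> = "\<lambda>x. frechet_derivative \<phi> (at x) e"
    have d\<phi>m: "?d\<phi> \<in> borel_measurable lebesgue" by (rule pw_affine_borel_measurable[OF \<phi>p])
    have d\<phi>b: "AE x in lebesgue. \<bar>?d\<phi> x\<bar> \<le> indicator \<Omega> x * (M' * norm e)"
      using pw_affine_AE_derivative(1)[OF \<phi>p]
    proof eventually_elim
      case (elim x)
      then obtain D where D: "aff_at \<phi> D x" by blast
      show ?case
      proof (cases "x \<in> \<Omega>")
        case True
        then show ?thesis using aff_at_bound[OF \<phi>l D, of e] by (simp add: frechet_derivative_aff_at[OF D])
      next
        case False
        then have "x \<notin> closure {x. \<phi> x \<noteq> 0}" using cl by blast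
        from frechet_derivative_off_support[OF this] show ?thesis using False by simp
      qed
    qed
    \<comment> \<open>After integration by parts the factor \<open>v \<nu>\<close> is at most
      \<open>\<epsilon> \<nu>\<close>, and the derivative of the fixed cutoff is bounded
      independently of \<nu>.\<close>
    have main: "\<bar>LINT x|lebesgue. ?G \<nu> x * \<phi> x\<bar> \<le> \<epsilon> \<nu> * (M' * norm e * mu)" for \<nu>
    proof -
      have \<epsilon>0: "0 \<le> \<epsilon> \<nu>" using s(1)[of \<nu> 0] by linarith
      have ae: "AE x in lebesgue. \<bar>v \<nu> x * ?d\<phi> x\<bar> \<le> indicator \<Omega> x * (\<epsilon> \<nu> * (M' * norm e))"
        using d\<phi>b
      proof eventually_elim
        case (elim x)
        have "\<bar>v \<nu> x\<bar> * \<bar>?d\<phi> x\<bar> \<le> \<epsilon> \<nu> * (indicator \<Omega> x * (M' * norm e))"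
          using s(1) elim \<epsilon>0 by (intro mult_mono) auto
        then show ?case by (simp add: abs_mult mult_ac)
      qed
      have int: "integrable lebesgue (\<lambda>x. v \<nu> x * ?d\<phi> x)"
      proof (rule Bochner_Integration.integrable_bound[OF ind[OF \<Omega>s(2), of "\<epsilon> \<nu> * (M' * norm e)"]])
        show "(\<lambda>x. v \<nu> x * ?d\<phi> x) \<in> borel_measurable lebesgue"
          using borel_measurable_lebesgue_continuous[OF cv] d\<phi>m by (rule borel_measurable_times)
        show "AE x in lebesgue. norm (v \<nu> x * ?d\<phi> x) \<le> norm (indicator \<Omega> x * (\<epsilon> \<nu> * (M' * norm e)))"
          using ae by eventually_elim (auto intro: order_trans[OF _ abs_ge_self])
      qed
      have "(LINT x|lebesgue. ?G \<nu> x * \<phi> x) = - (LINT x|lebesgue. v \<nu> x * ?d\<phi> x)"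
        by (rule integration_by_parts_lipschitz[OF v(1) \<phi>l \<phi>bd pw_affine_AE_derivative(2)[OF v(2)] Gm
             pw_affine_AE_derivative(2)[OF \<phi>p] d\<phi>m])
      then have "\<bar>LINT x|lebesgue. ?G \<nu> x * \<phi> x\<bar> = \<bar>LINT x|lebesgue. v \<nu> x * ?d\<phi> x\<bar>" by simp
      also have "\<dots> \<le> (LINT x|lebesgue. \<bar>v \<nu> x * ?d\<phi> x\<bar>)" by (rule integral_abs_bound)
      also have "\<dots> \<le> (LINT x|lebesgue. indicator \<Omega> x * (\<epsilon> \<nu> * (M' * norm e)))"
        using int by (intro integral_mono_AE ae ind \<Omega>s) auto
      also have "\<dots> = \<epsilon> \<nu> * (M' * norm e * mu)" unfolding indv[OF \<Omega>s(2)] mu_def by simp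
      finally show ?thesis .
    qed
    have mT: "(A - K) \<union> (T - A) \<in> lmeasurable" using K(3) T(3) by (rule fmeasurable.Un)
    have meas: "measure lebesgue ((A - K) \<union> (T - A)) \<le> 2 * \<eta>"
    proof -
      have "measure lebesgue (A - K) < \<eta>" "measure lebesgue (T - A) < \<eta>"
        using K(3,4) T(3,4) \<eta> by (metis emeasure_eq_measure2 ennreal_less_iff measure_nonneg)+
      then show ?thesis using measure_Un_le[of "A - K" lebesgue "T - A"] K(3) T(3) by auto
    qed
    \<comment> \<open>The cutoff and the indicator agree on \<open>K\<close> and off
      \<open>T\<close>, and elsewhere differ by at most 1.\<close>
    have rest: "\<bar>(LINT x|lebesgue. ?G \<nu> x * indicator A x) - (LINT x|lebesgue. ?G \<nu> x * \<phi> x)\<bar> \<le> \<bar>C\<bar> * (2 * \<eta>)" for \<nu>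
    proof -
      have iA: "integrable lebesgue (\<lambda>x. ?G \<nu> x * indicator A x)"
      proof (rule Bochner_Integration.integrable_bound[OF ind[OF mA, of "\<bar>C\<bar>"]])
        show "(\<lambda>x. ?G \<nu> x * indicator A x) \<in> borel_measurable lebesgue"
          using Gm A\<Omega>(2) by (intro borel_measurable_times borel_measurable_indicator)
        show "AE x in lebesgue. norm (?G \<nu> x * indicator A x) \<le> norm (indicator A x * \<bar>C\<bar>)"
          using C[of \<nu>] by eventually_elim (auto simp: indicator_def)
      qed
      have i\<phi>: "integrable lebesgue (\<lambda>x. ?G \<nu> x * \<phi> x)"
      proof (rule Bochner_Integration.integrable_bound[OF ind[OF \<Omega>s(2), of "\<bar>C\<bar>"]])
        show "(\<lambda>x. ?G \<nu> x * \<phi> x) \<in> borel_measurable lebesgue"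
          using Gm borel_measurable_lebesgue_continuous[OF c\<phi>] by (intro borel_measurable_times)
        show "AE x in lebesgue. norm (?G \<nu> x * \<phi> x) \<le> norm (indicator \<Omega> x * \<bar>C\<bar>)"
          using C[of \<nu>]
        proof eventually_elim
          case (elim x)
          show ?case
          proof (cases "\<phi> x = 0")
            case False
            then have "x \<in> \<Omega>" using \<phi>s K'(2) by blast
            moreover have "\<bar>?G \<nu> x\<bar> * \<bar>\<phi> x\<bar> \<le> \<bar>C\<bar> * 1" using elim \<phi>0[of x] by (intro mult_mono) auto
            ultimately show ?thesis by (simp add: abs_mult)
          qed simp
        qed
      qed
      have "(LINT x|lebesgue. ?G \<nu> x * indicator A x) - (LINT x|lebesgue. ?G \<nu> x * \<phi> x) = (LINT x|lebesgue. ?G \<nu> x * indicator A x - ?G \<nu> x * \<phi> x)"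
        using Bochner_Integration.integral_diff[OF iA i\<phi>] by simp
      also have "\<bar>\<dots>\<bar> \<le> (LINT x|lebesgue. \<bar>?G \<nu> x * indicator A x - ?G \<nu> x * \<phi> x\<bar>)" by (rule integral_abs_bound)
      also have "\<dots> \<le> (LINT x|lebesgue. indicator ((A - K) \<union> (T - A)) x * \<bar>C\<bar>)"
      proof (rule integral_mono_AE)
        show "integrable lebesgue (\<lambda>x. \<bar>?G \<nu> x * indicator A x - ?G \<nu> x * \<phi> x\<bar>)"
          using Bochner_Integration.integrable_diff[OF iA i\<phi>] by simp
        show "integrable lebesgue (\<lambda>x. indicator ((A - K) \<union> (T - A)) x * \<bar>C\<bar>)" by (rule ind[OF mT])
        show "AE x in lebesgue. \<bar>?G \<nu> x * indicator A x - ?G \<nu> x * \<phi> x\<bar> \<le> indicator ((A - K) \<union> (T - A)) x * \<bar>C\<bar>"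
          using C[of \<nu>]
        proof eventually_elim
          case (elim x)
          consider "x \<in> K" | "x \<notin> T" | "x \<in> (A - K) \<union> (T - A)" by blast
          then show ?case
          proof cases
            case 1 then show ?thesis using \<phi>1[OF 1] K(2) by auto
          next
            case 2
            then have "\<phi> x = 0" "x \<notin> A" using \<phi>s K'(2) T(2) by blast+
            then show ?thesis by simp
          next
            case 3
            have "\<bar>indicator A x - \<phi> x\<bar> \<le> 1" using \<phi>0[of x] by (auto simp: indicator_def)
            then have "\<bar>?G \<nu> x\<bar> * \<bar>indicator A x - \<phi> x\<bar> \<le> \<bar>C\<bar> * 1" using elim by (intro mult_mono) auto
            moreover have "?G \<nu> x * indicator A x - ?G \<nu> x * \<phi> x = ?G \<nu> x * (indicator A x - \<phi> x)" by (simp add: right_diff_distrib)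
            ultimately show ?thesis using 3 by (simp only: abs_mult indicator_simps mult_1)
          qed
        qed
      qed
      also have "\<dots> = \<bar>C\<bar> * measure lebesgue ((A - K) \<union> (T - A))" by (rule indv[OF mT])
      also have "\<dots> \<le> \<bar>C\<bar> * (2 * \<eta>)" using meas by (intro mult_left_mono) auto
      finally show ?thesis .
    qed
    have C\<eta>: "\<bar>C\<bar> * (2 * \<eta>) < r / 2 + r / 4"
    proof -
      have "\<bar>C\<bar> * (2 * \<eta>) \<le> (\<bar>C\<bar> + 1) * (2 * \<eta>)" using \<eta> by (intro mult_right_mono) auto
      also have "\<dots> = r / 2" by (simp add: \<eta>_def field_simps)
      finally show ?thesis using r by simp
    qed
    have "(\<lambda>\<nu>. \<epsilon> \<nu> * (M' * norm e * mu)) \<longlonglongrightarrow> 0" using tendsto_mult[OF s(2) tendsto_const] by simp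
    then obtain N where N: "\<And>\<nu>. \<nu> \<ge> N \<Longrightarrow> norm (\<epsilon> \<nu> * (M' * norm e * mu) - 0) < r / 4"
      using LIMSEQ_D[of _ 0 "r / 4"] r by (metis divide_pos_pos zero_less_numeral)
    have "norm ((LINT x|lebesgue_on \<Omega>. ?G \<nu> x * indicator A x) - 0) < r" if "\<nu> \<ge> N" for \<nu>
    proof -
      have "(LINT x|lebesgue_on \<Omega>. ?G \<nu> x * indicator A x) = (LINT x|lebesgue. ?G \<nu> x * indicator A x)"
        by (rule lebesgue_on_integral_eq[OF \<Omega>s(1)]) (use A\<Omega>(1) in \<open>auto simp: indicator_def\<close>)
      then show ?thesis using rest[of \<nu>] main[of \<nu>] C\<eta> N[OF that] by (simp add: abs_le_iff) linarith
    qed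
    then show "\<exists>N. \<forall>\<nu>\<ge>N. norm ((LINT x|lebesgue_on \<Omega>. ?G \<nu> x * indicator A x) - 0) < r" by blast
  qed
  show ?thesis
    by (rule bounded_weak_star_null[where C=C]) (use Gm lebesgue_on_measurable base h AE_lebesgue_on[OF C \<Omega>s(1)] in auto)
qed

section \<open>The relaxation property\<close>

text \<open>The function \<open>norm X - R\<close> is convex, hence one of the rank one convex
  functions that define the hull. Boundedness of \<open>U\<close> makes its frontier compact and
  bounds all gradients that occur.\<close>

lemma Rco_f_bounded:
  fixes E :: "(real^'n^'N) set"
  assumes "bounded E"
  shows "bounded (Rco_f E)"
proof -
  obtain R where R: "\<And>X. X \<in> E \<Longrightarrow> norm X \<le> R" using assms by (auto simp: bounded_iff)
  have "rank_one_convex (\<lambda>X::real^'n^'N. norm X - R)"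
    unfolding rank_one_convex_def
  proof (intro ballI allI impI)
    fix t :: real and X Y :: "real^'n^'N"
    assume "t \<in> {0..1}"
    then have "norm (t *\<^sub>R X + (1 - t) *\<^sub>R Y) \<le> t * norm X + (1 - t) * norm Y"
      using norm_triangle_ineq[of "t *\<^sub>R X" "(1 - t) *\<^sub>R Y"] by simp
    then show "norm (t *\<^sub>R X + (1 - t) *\<^sub>R Y) - R \<le> t * (norm X - R) + (1 - t) * (norm Y - R)"
      by (simp add: algebra_simps)
  qed
  then have "norm X - R \<le> 0" if "X \<in> Rco_f E" for X using that R unfolding Rco_f_def by auto
  then show ?thesis unfolding bounded_iff by (intro exI[of _ R]) force
qed

text \<open>Tested by the constant 1. A hull that contains a point thus comes from a nonempty set,
  which is required for nearest points; by convention \<open>infdist\<close> to the empty set is 0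
  and carries no information.\<close>

lemma Rco_f_empty: "Rco_f {} = {}"
proof -
  have "rank_one_convex (\<lambda>_. 1)" by (simp add: rank_one_convex_def)
  then have "\<not> (\<forall>f. rank_one_convex f \<longrightarrow> f \<xi> \<le> 0)" for \<xi> :: "real^'n^'N"
    using zero_less_one not_le by blast
  then show ?thesis unfolding Rco_f_def by auto
qed

lemma infdist_le_infdist_add:
  fixes A :: "'a::heine_borel set"
  assumes "closed A" "A \<noteq> {}" "\<And>a. a \<in> A \<Longrightarrow> infdist a E \<le> \<epsilon>"
  shows "infdist x E \<le> infdist x A + \<epsilon>"
proof -
  obtain a where "a \<in> A" "infdist x A = dist x a" using infdist_attains_inf[OF assms(1,2)] by blast
  then show ?thesis using infdist_triangle[of x E a] assms(3)[of a] by simp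
qed

text \<open>For small \<delta> the point \<open>\<xi>\<close> lies in the hull of
  \<open>E\<delta> \<delta>\<close>, so the distance to that set relaxes to 0 at
  \<open>\<xi>\<close>. The relaxation contributes \<open>\<epsilon>\<close>, and replacing the
  distance to \<open>E\<delta> \<delta>\<close> by the distance to \<open>E\<close> contributes
  \<open>\<epsilon>\<close> per unit volume; hence the factor
  \<open>1 + measure lebesgue \<Omega>\<close>.\<close>

lemma relaxing_map:
  fixes E :: "(real^'n^'N) set" and E\<delta> :: "real \<Rightarrow> (real^'n^'N) set"
  assumes E: "bounded E" and cpt: "\<And>\<delta>. \<delta> > 0 \<Longrightarrow> compact (E\<delta> \<delta>)"
    and sub: "\<And>\<delta>. \<delta> > 0 \<Longrightarrow> E\<delta> \<delta> \<subseteq> Rco_f (E\<delta> \<delta>) \<and> Rco_f (E\<delta> \<delta>) \<subseteq> interior (Rco_f E)"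
    and near: "\<And>\<epsilon>. \<epsilon> > 0 \<Longrightarrow> \<exists>\<delta>\<^sub>0>0. \<forall>\<delta>\<in>{0<..\<delta>\<^sub>0}. \<forall>\<eta>\<in>E\<delta> \<delta>. infdist \<eta> E \<le> \<epsilon>"
    and exh: "\<And>\<eta>. \<eta> \<in> interior (Rco_f E) \<Longrightarrow> \<exists>\<delta>\<^sub>0>0. \<forall>\<delta>\<in>{0<..\<delta>\<^sub>0}. \<eta> \<in> Rco_f (E\<delta> \<delta>)"
    and \<xi>: "\<xi> \<in> interior (Rco_f E)" and \<Omega>: "open \<Omega>" "bounded \<Omega>" and \<epsilon>: "\<epsilon> > 0"
  shows "\<exists>w L. L-lipschitz_on UNIV w \<and> cpt_supp w \<Omega> \<and> (\<forall>x. norm (w x) \<le> \<epsilon>) \<and>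
     pw_affine {D. \<xi> + matrix D \<in> interior (Rco_f E)} w \<and>
     (LINT x|lebesgue. indicator \<Omega> x * infdist (\<xi> + jacobian w (at x)) E) \<le> \<epsilon> * (1 + measure lebesgue \<Omega>)"
proof -
  let ?U = "interior (Rco_f E)"
  obtain \<delta>1 where \<delta>1: "\<delta>1 > 0" "\<forall>\<delta>\<in>{0<..\<delta>1}. \<forall>\<eta>\<in>E\<delta> \<delta>. infdist \<eta> E \<le> \<epsilon>" using near[OF \<epsilon>] by blast
  obtain \<delta>2 where \<delta>2: "\<delta>2 > 0" "\<forall>\<delta>\<in>{0<..\<delta>2}. \<xi> \<in> Rco_f (E\<delta> \<delta>)" using exh[OF \<xi>] by blast
  define \<delta> where "\<delta> = min \<delta>1 \<delta>2"
  have \<delta>: "\<delta> > 0" "\<delta> \<in> {0<..\<delta>1}" "\<delta> \<in> {0<..\<delta>2}" using \<delta>1 \<delta>2 by (auto simp: \<delta>_def)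
  let ?K = "E\<delta> \<delta>"
  have \<xi>K: "\<xi> \<in> Rco_f ?K" using \<delta>2 \<delta> by blast
  have K0: "?K \<noteq> {}" using \<xi>K Rco_f_empty by auto
  have cK: "closed ?K" using cpt[OF \<delta>(1)] by (rule compact_imp_closed)
  have bU: "bounded ?U" by (rule bounded_subset[OF Rco_f_bounded[OF E] interior_subset])
  have infb: "\<exists>M. \<forall>X\<in>?U. infdist X S \<le> M" for S :: "(real^'n^'N) set"
  proof (cases "S = {}")
    \<comment> \<open>The convention that \<open>infdist\<close> to the empty set is 0 makes 0 a
      bound here.\<close>
    case True then show ?thesis by (intro exI[of _ 0]) (simp add: infdist_def)
  next
    case False
    then obtain a where a: "a \<in> S" by blast
    obtain B where "\<And>X. X \<in> ?U \<Longrightarrow> norm X \<le> B" using bU by (auto simp: bounded_iff)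
    then have "infdist X S \<le> B + norm a" if "X \<in> ?U" for X
      using infdist_le[OF a, of X] norm_triangle_ineq4[of X a] that by (fastforce simp: dist_norm)
    then show ?thesis by blast
  qed
  obtain M where M: "\<And>X. X \<in> ?U \<Longrightarrow> infdist X ?K \<le> M" using infb by blast
  obtain M2 where M2: "\<And>X. X \<in> ?U \<Longrightarrow> infdist X E \<le> M2" using infb by blast
  have "relaxes ?U (\<lambda>X. infdist X ?K) \<xi> 0"
    by (rule relaxes_zero_on_Rco_f[OF open_interior bU _ _ \<xi>K, of _ M])
       (use sub[OF \<delta>(1)] M in \<open>auto simp: infdist_nonneg\<close>)
  then obtain w L where w: "L-lipschitz_on UNIV w" "cpt_supp w \<Omega>" "\<forall>x. norm (w x) \<le> \<epsilon>"
     "pw_affine {D. \<xi> + matrix D \<in> ?U} w"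
     "(LINT x|lebesgue. indicator \<Omega> x * infdist (\<xi> + jacobian w (at x)) ?K) \<le> 0 * measure lebesgue \<Omega> + \<epsilon>"
    unfolding relaxes_def using \<Omega> \<epsilon> by blast
  have m\<Omega>: "\<Omega> \<in> lmeasurable" using \<Omega> by (simp add: lmeasurable_open)
  have iE: "integrable lebesgue (\<lambda>x. indicator \<Omega> x * infdist (\<xi> + jacobian w (at x)) E)"
    by (rule integrable_pw_affine_integrand[OF w(4) infdist_nonneg M2 m\<Omega>])
  have iK: "integrable lebesgue (\<lambda>x. indicator \<Omega> x * infdist (\<xi> + jacobian w (at x)) ?K)"
    by (rule integrable_pw_affine_integrand[OF w(4) infdist_nonneg M m\<Omega>])
  have i\<epsilon>: "integrable lebesgue (\<lambda>x. indicator \<Omega> x * \<epsilon>)"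
    using m\<Omega> by (intro integrable_mult_left integrable_real_indicator) (auto simp: fmeasurable_def)
  have le: "infdist X E \<le> infdist X ?K + \<epsilon>" for X
    using \<delta>1(2) \<delta>(2) by (intro infdist_le_infdist_add[OF cK K0]) blast
  have "(LINT x|lebesgue. indicator \<Omega> x * infdist (\<xi> + jacobian w (at x)) E) \<le>
     (LINT x|lebesgue. indicator \<Omega> x * infdist (\<xi> + jacobian w (at x)) ?K + indicator \<Omega> x * \<epsilon>)"
    by (intro integral_mono Bochner_Integration.integrable_add iE iK i\<epsilon>) (simp add: indicator_def le)
  also have "\<dots> = (LINT x|lebesgue. indicator \<Omega> x * infdist (\<xi> + jacobian w (at x)) ?K) + (LINT x|lebesgue. indicator \<Omega> x * \<epsilon>)"
    by (rule Bochner_Integration.integral_add[OF iK i\<epsilon>])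
  also have "(LINT x|lebesgue. indicator \<Omega> x * \<epsilon>) = \<epsilon> * measure lebesgue \<Omega>" using m\<Omega> by (simp add: fmeasurable_def)
  finally have "(LINT x|lebesgue. indicator \<Omega> x * infdist (\<xi> + jacobian w (at x)) E) \<le> \<epsilon> * (1 + measure lebesgue \<Omega>)"
    using w(5) by (simp add: algebra_simps)
  then show ?thesis using w(1-4) by blast
qed

theorem theorem1p1:
  fixes E :: "(real^'n^'N) set" and E\<delta> :: "real \<Rightarrow> (real^'n^'N) set"
  assumes "bounded E"
    and "\<And>\<delta>. \<delta> > 0 \<Longrightarrow> compact (E\<delta> \<delta>)"
    and "\<And>\<delta>. \<delta> > 0 \<Longrightarrow>
           E\<delta> \<delta> \<subseteq> Rco_f (E\<delta> \<delta>) \<and> Rco_f (E\<delta> \<delta>) \<subseteq> interior (Rco_f E)"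
    and "\<And>\<epsilon>. \<epsilon> > 0 \<Longrightarrow>
           \<exists>\<delta>\<^sub>0>0. \<forall>\<delta>\<in>{0<..\<delta>\<^sub>0}. \<forall>\<eta>\<in>E\<delta> \<delta>. infdist \<eta> E \<le> \<epsilon>"
    and "\<And>\<eta>. \<eta> \<in> interior (Rco_f E) \<Longrightarrow>
           \<exists>\<delta>\<^sub>0>0. \<forall>\<delta>\<in>{0<..\<delta>\<^sub>0}. \<eta> \<in> Rco_f (E\<delta> \<delta>)"
  shows "relaxation_property (interior (Rco_f E)) E"
  unfolding relaxation_property_def
proof (intro allI impI ballI, elim conjE)
  fix \<Omega> :: "(real^'n) set" and \<xi> :: "real^'n^'N" and u\<xi> :: "real^'n \<Rightarrow> real^'N"
  assume \<Omega>: "bounded \<Omega>" "open \<Omega>" and \<xi>: "\<xi> \<in> interior (Rco_f E)" and "affine_with_gradient UNIV \<xi> u\<xi>"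
  then obtain b where u\<xi>: "\<And>x. u\<xi> x = \<xi> *v x + b" by (auto simp: affine_with_gradient_def)
  let ?U = "interior (Rco_f E)"
  define \<epsilon> where "\<epsilon> \<nu> = inverse (real (Suc \<nu>))" for \<nu>
  have \<epsilon>0: "\<epsilon> \<nu> > 0" for \<nu> by (simp add: \<epsilon>_def)
  have \<epsilon>lim: "\<epsilon> \<longlonglongrightarrow> 0" unfolding \<epsilon>_def[abs_def] by (rule LIMSEQ_inverse_real_of_nat)
  \<comment> \<open>Hides the Lipschitz constant behind a quantifier, so that the maps are chosen
    first and their constants, for which no bound uniform in \<nu> is known, afterwards.\<close>
  define Q where "Q \<nu> w \<longleftrightarrow> (\<exists>L. L-lipschitz_on UNIV w \<and> cpt_supp w \<Omega> \<and> (\<forall>x. norm (w x) \<le> \<epsilon> \<nu>) \<and>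
     pw_affine {D. \<xi> + matrix D \<in> ?U} w \<and>
     (LINT x|lebesgue. indicator \<Omega> x * infdist (\<xi> + jacobian w (at x)) E) \<le> \<epsilon> \<nu> * (1 + measure lebesgue \<Omega>))" for \<nu> w
  have "\<forall>\<nu>. \<exists>w. Q \<nu> w"
    unfolding Q_def using relaxing_map[OF assms \<xi> \<Omega>(2,1) \<epsilon>0] by (intro allI)
  from choice[OF this] obtain w where Q: "\<forall>\<nu>. Q \<nu> (w \<nu>)" ..
  then have "\<forall>\<nu>. \<exists>L. L-lipschitz_on UNIV (w \<nu>)" unfolding Q_def by blast
  from choice[OF this] obtain L where L: "\<forall>\<nu>. (L \<nu>)-lipschitz_on UNIV (w \<nu>)" ..
  have w: "\<And>\<nu>. (L \<nu>)-lipschitz_on UNIV (w \<nu>)" "\<And>\<nu>. cpt_supp (w \<nu>) \<Omega>" "\<And>\<nu> x. norm (w \<nu> x) \<le> \<epsilon> \<nu>"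
     "\<And>\<nu>. pw_affine {D. \<xi> + matrix D \<in> ?U} (w \<nu>)"
     "\<And>\<nu>. (LINT x|lebesgue. indicator \<Omega> x * infdist (\<xi> + jacobian (w \<nu>) (at x)) E) \<le> \<epsilon> \<nu> * (1 + measure lebesgue \<Omega>)"
    using L Q unfolding Q_def by blast+
  have \<Omega>s: "\<Omega> \<in> sets lebesgue" "\<Omega> \<in> lmeasurable" using \<Omega> by (auto simp: lmeasurable_open)
  have bU: "bounded ?U" by (rule bounded_subset[OF Rco_f_bounded[OF assms(1)] interior_subset])
  \<comment> \<open>The bound on gradients that is uniform in \<nu>; the constants
    \<open>L \<nu>\<close> cannot provide it.\<close>
  then obtain R where R: "\<And>X. X \<in> ?U \<Longrightarrow> norm X \<le> R" by (auto simp: bounded_iff)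
  have lin: "linear ((*v) \<xi>)" by (rule matrix_vector_mul_linear)
  have aff\<xi>: "aff_at u\<xi> ((*v) \<xi>) x" for x
  proof -
    have "u\<xi> = (\<lambda>x. b + \<xi> *v x)" using u\<xi> by (auto simp: add.commute)
    then show ?thesis using aff_at_affine[OF lin, of b x] by simp
  qed
  have p\<xi>: "pw_affine UNIV u\<xi>" unfolding pw_affine_def using aff\<xi> by (metis (mono_tags, lifting) UNIV_I empty_Collect_eq negligible_empty)
  have l\<xi>: "(onorm ((*v) \<xi>))-lipschitz_on UNIV u\<xi>"
  proof (rule lipschitz_onI)
    have bl: "bounded_linear ((*v) \<xi>)" using lin by (simp add: linear_conv_bounded_linear)
    show "0 \<le> onorm ((*v) \<xi>)" by (rule onorm_pos_le[OF bl])
    fix x y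
    show "dist (u\<xi> x) (u\<xi> y) \<le> onorm ((*v) \<xi>) * dist x y"
      using onorm[OF bl, of "x - y"] by (simp add: u\<xi> dist_norm matrix_vector_mult_diff_distrib)
  qed
  have j\<xi>: "jacobian u\<xi> (at x) = \<xi>" for x
    using jacobian_aff_at[OF aff\<xi>] by simp

  \<comment> \<open>The approximating maps and their gradients\<close>
  define u where "u \<nu> x = u\<xi> x + w \<nu> x" for \<nu> x
  define Du where "Du \<nu> x = jacobian (u \<nu>) (at x)" for \<nu> x
  have lu: "(onorm ((*v) \<xi>) + L \<nu>)-lipschitz_on UNIV (u \<nu>)" for \<nu>
    unfolding u_def[abs_def] by (intro lipschitz_on_add l\<xi> w)
  have affu: "aff_at (u \<nu>) (\<lambda>h. \<xi> *v h + D h) x \<and> Du \<nu> x = \<xi> + matrix D" if "aff_at (w \<nu>) D x" for \<nu> D x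
  proof -
    have a: "aff_at (u \<nu>) (\<lambda>h. \<xi> *v h + D h) x" unfolding u_def[abs_def] by (rule aff_at_add[OF aff\<xi> that])
    moreover have "matrix (\<lambda>h. \<xi> *v h + D h) = \<xi> + matrix D"
      by (rule matrix_eq_linear[OF aff_at_linear[OF a]])
         (simp add: matrix_vector_mult_add_rdistrib matrix_apply_linear[OF aff_at_linear[OF that]])
    ultimately show ?thesis unfolding Du_def using jacobian_aff_at[OF a] by simp
  qed
  have pu: "pw_affine UNIV (u \<nu>)" for \<nu>
    unfolding u_def[abs_def] by (rule pw_affine_add[OF p\<xi> w(4)]) simp
  \<comment> \<open>Only almost everywhere: off the affine pieces the Jacobians need not be true
    derivatives.\<close>
  have DuAE: "AE x in lebesgue. Du \<nu> x \<in> ?U \<and> Du \<nu> x = \<xi> + jacobian (w \<nu>) (at x)" for \<nu>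
    using pw_affine_AE_derivative(1)[OF w(4)[of \<nu>]]
  proof eventually_elim
    case (elim x)
    then obtain D where D: "\<xi> + matrix D \<in> ?U" "aff_at (w \<nu>) D x" by blast
    then show ?case using affu[OF D(2)] jacobian_aff_at[OF D(2)] by simp
  qed
  have AEU: "AE x in lebesgue_on \<Omega>. Du \<nu> x \<in> E \<union> ?U" for \<nu>
    by (rule AE_lebesgue_on[OF _ \<Omega>s(1)]) (use DuAE[of \<nu>] in \<open>auto elim: eventually_mono\<close>)
  have Duw: "has_weak_gradient (u \<nu>) (Du \<nu>) \<Omega>" for \<nu>
    unfolding Du_def[abs_def] by (rule pw_affine_has_weak_gradient[OF lu pu \<Omega>(2)])
  have DuL: "Du \<nu> \<in> Linf \<Omega>" for \<nu>
    unfolding Du_def[abs_def] by (rule pw_affine_W1inf(2)[OF lu pu \<Omega>(2,1)])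
  have uL: "u \<nu> \<in> Linf \<Omega>" for \<nu> by (rule pw_affine_W1inf(1)[OF lu pu \<Omega>(2,1)])
  have u\<xi>L: "u\<xi> \<in> Linf \<Omega>" by (rule pw_affine_W1inf(1)[OF l\<xi> p\<xi> \<Omega>(2,1)])
  have \<xi>L: "(\<lambda>_. \<xi>) \<in> Linf \<Omega>" using pw_affine_W1inf(2)[OF l\<xi> p\<xi> \<Omega>(2,1)] by (simp add: j\<xi>)
  have \<xi>w: "has_weak_gradient u\<xi> (\<lambda>_. \<xi>) \<Omega>" using pw_affine_has_weak_gradient[OF l\<xi> p\<xi> \<Omega>(2)] by (simp add: j\<xi>)
  have inti: "integrable (lebesgue_on \<Omega>) (\<lambda>x. f x \<bullet> h x)"
    if fL: "f \<in> Linf \<Omega>" and hI: "integrable (lebesgue_on \<Omega>) h" for f h :: "real^'n \<Rightarrow> 'c::euclidean_space"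
  proof -
    obtain C where C: "AE x in lebesgue_on \<Omega>. norm (f x) \<le> C" and fm: "f \<in> borel_measurable (lebesgue_on \<Omega>)"
      using fL by (auto simp: Linf_def)
    show ?thesis
    proof (rule Bochner_Integration.integrable_bound)
      show "integrable (lebesgue_on \<Omega>) (\<lambda>x. C * norm (h x))" using hI by simp
      show "(\<lambda>x. f x \<bullet> h x) \<in> borel_measurable (lebesgue_on \<Omega>)"
        using fm hI by (intro borel_measurable_inner) auto
      show "AE x in lebesgue_on \<Omega>. norm (f x \<bullet> h x) \<le> norm (C * norm (h x))" using C
      proof eventually_elim
        case (elim x)
        have "\<bar>f x \<bullet> h x\<bar> \<le> norm (f x) * norm (h x)" by (rule Cauchy_Schwarz_ineq2)
        also have "\<dots> \<le> C * norm (h x)" using elim by (intro mult_right_mono) auto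
        finally show ?case by simp
      qed
    qed
  qed

  \<comment> \<open>Weak* convergence of the maps, from uniform convergence\<close>
  have ws: "weak_star_Linf \<Omega> u u\<xi>"
    unfolding weak_star_Linf_def
  proof (intro conjI allI impI uL u\<xi>L)
    fix h :: "real^'n \<Rightarrow> real^'N" assume h: "integrable (lebesgue_on \<Omega>) h"
    have "(\<lambda>\<nu>. (LINT x|lebesgue_on \<Omega>. u \<nu> x \<bullet> h x) - (LINT x|lebesgue_on \<Omega>. u\<xi> x \<bullet> h x)) \<longlonglongrightarrow> 0"
    proof (rule Lim_null_comparison)
      show "(\<lambda>\<nu>. \<epsilon> \<nu> * (LINT x|lebesgue_on \<Omega>. norm (h x))) \<longlonglongrightarrow> 0"
        using tendsto_mult[OF \<epsilon>lim tendsto_const] by simp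
      have "norm ((LINT x|lebesgue_on \<Omega>. u \<nu> x \<bullet> h x) - (LINT x|lebesgue_on \<Omega>. u\<xi> x \<bullet> h x)) \<le> \<epsilon> \<nu> * (LINT x|lebesgue_on \<Omega>. norm (h x))" for \<nu>
      proof -
        have d: "(LINT x|lebesgue_on \<Omega>. u \<nu> x \<bullet> h x) - (LINT x|lebesgue_on \<Omega>. u\<xi> x \<bullet> h x) = (LINT x|lebesgue_on \<Omega>. u \<nu> x \<bullet> h x - u\<xi> x \<bullet> h x)"
          using Bochner_Integration.integral_diff[OF inti[OF uL h] inti[OF u\<xi>L h]] by simp
        have "norm (LINT x|lebesgue_on \<Omega>. u \<nu> x \<bullet> h x - u\<xi> x \<bullet> h x) \<le> (LINT x|lebesgue_on \<Omega>. norm (u \<nu> x \<bullet> h x - u\<xi> x \<bullet> h x))"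
          by (rule integral_norm_bound)
        also have "\<dots> \<le> (LINT x|lebesgue_on \<Omega>. \<epsilon> \<nu> * norm (h x))"
        proof (rule integral_mono)
          show "integrable (lebesgue_on \<Omega>) (\<lambda>x. norm (u \<nu> x \<bullet> h x - u\<xi> x \<bullet> h x))"
            using Bochner_Integration.integrable_diff[OF inti[OF uL h] inti[OF u\<xi>L h]] by (rule integrable_norm)
          show "integrable (lebesgue_on \<Omega>) (\<lambda>x. \<epsilon> \<nu> * norm (h x))" using h by simp
          fix x
          have "norm (u \<nu> x \<bullet> h x - u\<xi> x \<bullet> h x) = \<bar>w \<nu> x \<bullet> h x\<bar>" by (simp add: u_def inner_add_left)
          also have "\<dots> \<le> norm (w \<nu> x) * norm (h x)" by (rule Cauchy_Schwarz_ineq2)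
          also have "\<dots> \<le> \<epsilon> \<nu> * norm (h x)" using w(3) by (intro mult_right_mono) auto
          finally show "norm (u \<nu> x \<bullet> h x - u\<xi> x \<bullet> h x) \<le> \<epsilon> \<nu> * norm (h x)" .
        qed
        finally show ?thesis unfolding d by simp
      qed
      then show "\<forall>\<^sub>F \<nu> in sequentially. norm ((LINT x|lebesgue_on \<Omega>. u \<nu> x \<bullet> h x) - (LINT x|lebesgue_on \<Omega>. u\<xi> x \<bullet> h x)) \<le> \<epsilon> \<nu> * (LINT x|lebesgue_on \<Omega>. norm (h x))"
        by (intro always_eventually allI)
    qed
    then show "(\<lambda>\<nu>. LINT x|lebesgue_on \<Omega>. u \<nu> x \<bullet> h x) \<longlonglongrightarrow> (LINT x|lebesgue_on \<Omega>. u\<xi> x \<bullet> h x)"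
      by (rule LIM_zero_cancel)
  qed
  have wc: "(\<lambda>\<nu>. LINT x|lebesgue_on \<Omega>. jacobian (w \<nu>) (at x) $ i $ j * h x) \<longlonglongrightarrow> 0"
    if h: "integrable (lebesgue_on \<Omega>) h" for i j h
  proof -
    let ?v = "\<lambda>\<nu> x. w \<nu> x $ i"
    let ?e = "axis j 1 :: real^'n"
    have vp: "pw_affine UNIV (?v \<nu>)" for \<nu> by (rule pw_affine_compose[OF w(4) linear_component]) simp
    have eq: "frechet_derivative (?v \<nu>) (at x) ?e = jacobian (w \<nu>) (at x) $ i $ j" if "aff_at (w \<nu>) D x" for \<nu> D x
      using frechet_derivative_aff_at[OF aff_at_compose[OF that linear_component, of i]]
      by (simp add: jacobian_component frechet_derivative_aff_at[OF that])
    have eqAE: "AE x in lebesgue. frechet_derivative (?v \<nu>) (at x) ?e = jacobian (w \<nu>) (at x) $ i $ j" for \<nu>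
      using pw_affine_AE_derivative(1)[OF w(4)[of \<nu>]] by eventually_elim (use eq in blast)
    \<comment> \<open>The perturbed gradient lies in \<open>U\<close>, so its norm is at most
      \<open>R\<close>; subtracting \<open>\<xi>\<close> costs \<open>norm \<xi>\<close>.\<close>
    have bnd: "AE x in lebesgue. \<bar>frechet_derivative (?v \<nu>) (at x) ?e\<bar> \<le> R + norm \<xi>" for \<nu>
      using pw_affine_AE_derivative(1)[OF w(4)[of \<nu>]]
    proof eventually_elim
      case (elim x)
      then obtain D where D: "\<xi> + matrix D \<in> ?U" "aff_at (w \<nu>) D x" by blast
      have "\<bar>matrix D $ i $ j\<bar> \<le> norm (matrix D)"
        using component_le_norm_cart[of "matrix D $ i" j] Finite_Cartesian_Product.norm_nth_le[of "matrix D" i] by linarith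
      also have "\<dots> \<le> norm (\<xi> + matrix D) + norm \<xi>" using norm_triangle_ineq4[of "\<xi> + matrix D" \<xi>] by simp
      finally show ?case unfolding eq[OF D(2)] jacobian_aff_at[OF D(2)] using R[OF D(1)] by linarith
    qed
    have "(\<lambda>\<nu>. LINT x|lebesgue_on \<Omega>. frechet_derivative (?v \<nu>) (at x) ?e * h x) \<longlonglongrightarrow> 0"
    proof (rule gradient_weak_star_null[OF _ vp bnd _ \<epsilon>lim \<Omega>(2,1) h])
      show "(L \<nu>)-lipschitz_on UNIV (?v \<nu>)" for \<nu> by (rule lipschitz_component[OF w(1)])
      show "\<bar>w \<nu> x $ i\<bar> \<le> \<epsilon> \<nu>" for \<nu> x using component_le_norm_cart[of "w \<nu> x" i] w(3)[of \<nu> x] by linarith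
    qed
    moreover have "(LINT x|lebesgue_on \<Omega>. frechet_derivative (?v \<nu>) (at x) ?e * h x) = (LINT x|lebesgue_on \<Omega>. jacobian (w \<nu>) (at x) $ i $ j * h x)" for \<nu>
    proof (rule integral_cong_AE)
      have hm: "h \<in> borel_measurable (lebesgue_on \<Omega>)" using h by auto
      show "(\<lambda>x. frechet_derivative (?v \<nu>) (at x) ?e * h x) \<in> borel_measurable (lebesgue_on \<Omega>)"
        using lebesgue_on_measurable[OF pw_affine_borel_measurable[OF vp, of "\<lambda>D. D ?e"]] hm by (rule borel_measurable_times)
      show "(\<lambda>x. jacobian (w \<nu>) (at x) $ i $ j * h x) \<in> borel_measurable (lebesgue_on \<Omega>)"
        unfolding jacobian_component
        using lebesgue_on_measurable[OF pw_affine_borel_measurable[OF w(4), of "\<lambda>D. D ?e $ i"]] hm by (rule borel_measurable_times)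
      show "AE x in lebesgue_on \<Omega>. frechet_derivative (?v \<nu>) (at x) ?e * h x = jacobian (w \<nu>) (at x) $ i $ j * h x"
        by (rule AE_lebesgue_on[OF _ \<Omega>s(1)]) (use eqAE[of \<nu>] in \<open>auto elim: eventually_mono\<close>)
    qed
    ultimately show ?thesis by simp
  qed

  \<comment> \<open>Weak* convergence of the gradients\<close>
  have wD: "weak_star_Linf \<Omega> Du (\<lambda>_. \<xi>)"
    unfolding weak_star_Linf_def
  proof (intro conjI allI impI DuL \<xi>L)
    fix h :: "real^'n \<Rightarrow> real^'n^'N" assume h: "integrable (lebesgue_on \<Omega>) h"
    have hc: "integrable (lebesgue_on \<Omega>) (\<lambda>x. h x $ i $ j)" for i j
      by (intro integrable_bounded_linear[OF bounded_linear_vec_nth] h)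
    have wL: "(\<lambda>x. jacobian (w \<nu>) (at x)) \<in> Linf \<Omega>" for \<nu> by (rule pw_affine_W1inf(2)[OF w(1,4) \<Omega>(2,1)])
    have ic: "integrable (lebesgue_on \<Omega>) (\<lambda>x. jacobian (w \<nu>) (at x) $ i $ j * h x $ i $ j)" for \<nu> i j
    proof -
      have "(\<lambda>x. jacobian (w \<nu>) (at x) $ i $ j) \<in> Linf \<Omega>"
      proof -
        obtain C where C: "AE x in lebesgue_on \<Omega>. norm (jacobian (w \<nu>) (at x)) \<le> C" using wL[of \<nu>] by (auto simp: Linf_def)
        have "AE x in lebesgue_on \<Omega>. norm (jacobian (w \<nu>) (at x) $ i $ j) \<le> C" using C
        proof eventually_elim
          case (elim x)
          show ?case using elim Finite_Cartesian_Product.norm_nth_le[of "jacobian (w \<nu>) (at x)" i]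
            Finite_Cartesian_Product.norm_nth_le[of "jacobian (w \<nu>) (at x) $ i" j] by linarith
        qed
        moreover have "(\<lambda>x. jacobian (w \<nu>) (at x) $ i $ j) \<in> borel_measurable (lebesgue_on \<Omega>)"
          unfolding jacobian_component
          by (rule lebesgue_on_measurable[OF pw_affine_borel_measurable[OF w(4), of "\<lambda>D. D (axis j 1) $ i"]])
        ultimately show ?thesis by (auto simp: Linf_def)
      qed
      from inti[OF this hc] show ?thesis by simp
    qed
    \<comment> \<open>The inner product of matrices is expanded into its finitely many entries, to
      each of which the scalar statement \<open>wc\<close> applies.\<close>
    have "(\<lambda>\<nu>. (LINT x|lebesgue_on \<Omega>. \<xi> \<bullet> h x) + (\<Sum>i\<in>UNIV. \<Sum>j\<in>UNIV. LINT x|lebesgue_on \<Omega>. jacobian (w \<nu>) (at x) $ i $ j * h x $ i $ j))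
       \<longlonglongrightarrow> (LINT x|lebesgue_on \<Omega>. \<xi> \<bullet> h x) + (\<Sum>i\<in>(UNIV::'N set). \<Sum>j\<in>(UNIV::'n set). 0)"
      by (intro tendsto_add tendsto_const tendsto_sum wc hc)
    moreover have "(LINT x|lebesgue_on \<Omega>. Du \<nu> x \<bullet> h x) =
       (LINT x|lebesgue_on \<Omega>. \<xi> \<bullet> h x) + (\<Sum>i\<in>UNIV. \<Sum>j\<in>UNIV. LINT x|lebesgue_on \<Omega>. jacobian (w \<nu>) (at x) $ i $ j * h x $ i $ j)" for \<nu>
    proof -
      have "(LINT x|lebesgue_on \<Omega>. Du \<nu> x \<bullet> h x) = (LINT x|lebesgue_on \<Omega>. \<xi> \<bullet> h x + jacobian (w \<nu>) (at x) \<bullet> h x)"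
      proof (rule integral_cong_AE)
        show "(\<lambda>x. Du \<nu> x \<bullet> h x) \<in> borel_measurable (lebesgue_on \<Omega>)" using inti[OF DuL h] by auto
        show "(\<lambda>x. \<xi> \<bullet> h x + jacobian (w \<nu>) (at x) \<bullet> h x) \<in> borel_measurable (lebesgue_on \<Omega>)"
          using borel_measurable_integrable[OF Bochner_Integration.integrable_add[OF inti[OF \<xi>L h] inti[OF wL h]]] .
        show "AE x in lebesgue_on \<Omega>. Du \<nu> x \<bullet> h x = \<xi> \<bullet> h x + jacobian (w \<nu>) (at x) \<bullet> h x"
          by (rule AE_lebesgue_on[OF _ \<Omega>s(1)]) (rule eventually_mono[OF DuAE[of \<nu>]], auto simp: inner_add_left)
      qed
      also have "\<dots> = (LINT x|lebesgue_on \<Omega>. \<xi> \<bullet> h x) + (LINT x|lebesgue_on \<Omega>. jacobian (w \<nu>) (at x) \<bullet> h x)"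
        by (rule Bochner_Integration.integral_add[OF inti[OF \<xi>L h] inti[OF wL h]])
      also have "(LINT x|lebesgue_on \<Omega>. jacobian (w \<nu>) (at x) \<bullet> h x) =
          (LINT x|lebesgue_on \<Omega>. (\<Sum>i\<in>UNIV. \<Sum>j\<in>UNIV. jacobian (w \<nu>) (at x) $ i $ j * h x $ i $ j))"
        by (simp add: inner_vec_def)
      also have "\<dots> = (\<Sum>i\<in>UNIV. \<Sum>j\<in>UNIV. LINT x|lebesgue_on \<Omega>. jacobian (w \<nu>) (at x) $ i $ j * h x $ i $ j)"
        by (subst Bochner_Integration.integral_sum, intro Bochner_Integration.integrable_sum ic)
           (intro sum.cong refl Bochner_Integration.integral_sum ic)
      finally show ?thesis .
    qed
    ultimately show "(\<lambda>\<nu>. LINT x|lebesgue_on \<Omega>. Du \<nu> x \<bullet> h x) \<longlonglongrightarrow> (LINT x|lebesgue_on \<Omega>. \<xi> \<bullet> h x)" by simp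
  qed
  have wstar: "weak_star_W1inf \<Omega> u u\<xi>"
    unfolding weak_star_W1inf_def using ws Duw \<xi>w wD by blast

  \<comment> \<open>Vanishing of the integrated distance\<close>
  have dist0: "(\<lambda>\<nu>. LINT x|lebesgue_on \<Omega>. infdist (Du \<nu> x) E) \<longlonglongrightarrow> 0"
  proof (rule tendsto_sandwich[OF _ _ tendsto_const])
    show "\<forall>\<^sub>F \<nu> in sequentially. 0 \<le> (LINT x|lebesgue_on \<Omega>. infdist (Du \<nu> x) E)"
      by (intro always_eventually allI integral_nonneg_AE AE_I2 infdist_nonneg)
    have "(LINT x|lebesgue_on \<Omega>. infdist (Du \<nu> x) E) \<le> \<epsilon> \<nu> * (1 + measure lebesgue \<Omega>)" for \<nu>
    proof -
      have "(LINT x|lebesgue_on \<Omega>. infdist (Du \<nu> x) E) = (LINT x|lebesgue. indicator \<Omega> x *\<^sub>R infdist (Du \<nu> x) E)"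
        using \<Omega>s(1) by (intro integral_restrict_space) simp
      also have "\<dots> = (LINT x|lebesgue. indicator \<Omega> x * infdist (\<xi> + jacobian (w \<nu>) (at x)) E)"
      proof (rule integral_cong_AE)
        show "(\<lambda>x. indicator \<Omega> x *\<^sub>R infdist (Du \<nu> x) E) \<in> borel_measurable lebesgue"
          unfolding Du_def jacobian_def
          by (intro borel_measurable_scaleR borel_measurable_indicator \<Omega>s(1)
             pw_affine_borel_measurable[OF pu, of "\<lambda>D. infdist (matrix D) E"])
        show "(\<lambda>x. indicator \<Omega> x * infdist (\<xi> + jacobian (w \<nu>) (at x)) E) \<in> borel_measurable lebesgue"
          unfolding jacobian_def
          by (intro borel_measurable_times borel_measurable_indicator \<Omega>s(1)
             pw_affine_borel_measurable[OF w(4), of "\<lambda>D. infdist (\<xi> + matrix D) E"])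
        show "AE x in lebesgue. indicator \<Omega> x *\<^sub>R infdist (Du \<nu> x) E = indicator \<Omega> x * infdist (\<xi> + jacobian (w \<nu>) (at x)) E"
          using DuAE[of \<nu>] by eventually_elim auto
      qed
      also have "\<dots> \<le> \<epsilon> \<nu> * (1 + measure lebesgue \<Omega>)" by (rule w(5))
      finally show ?thesis .
    qed
    then show "\<forall>\<^sub>F \<nu> in sequentially. (LINT x|lebesgue_on \<Omega>. infdist (Du \<nu> x) E) \<le> \<epsilon> \<nu> * (1 + measure lebesgue \<Omega>)"
      by (intro always_eventually allI)
    show "(\<lambda>\<nu>. \<epsilon> \<nu> * (1 + measure lebesgue \<Omega>)) \<longlonglongrightarrow> 0" using tendsto_mult[OF \<epsilon>lim tendsto_const] by simp
  qed
  have w01: "(\<lambda>x. u \<nu> x - u\<xi> x) \<in> W01inf \<Omega>" for \<nu>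
    using pw_affine_W01inf[OF w(1,4,2) \<Omega>(2,1)] by (simp add: u_def)
  show "\<exists>u Du. (\<forall>\<nu>::nat. u \<nu> \<in> Aff_piec \<Omega> \<and> (\<lambda>x. u \<nu> x - u\<xi> x) \<in> W01inf \<Omega> \<and>
                 has_weak_gradient (u \<nu>) (Du \<nu>) \<Omega> \<and> (AE x in lebesgue_on \<Omega>. Du \<nu> x \<in> E \<union> ?U)) \<and>
              weak_star_W1inf \<Omega> u u\<xi> \<and> (\<lambda>\<nu>. LINT x|lebesgue_on \<Omega>. infdist (Du \<nu> x) E) \<longlonglongrightarrow> 0"
    using pw_affine_Aff_piec[OF lu pu \<Omega>(2,1)] w01 Duw AEU wstar dist0 by (intro exI[of _ u] exI[of _ Du]) blast
qed

end
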